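(* Let $\lambda=(\lambda_1,\ldots,\lambda_n)$ be a partition and set $m=\lambda_1$. Then, with $x=(x_1,\ldots,x_n)$ and $y=(y_1,\ldots,y_m)$, $$\prod_{(i,j)\in\lambda}\frac{1}{1-x_i y_j}=\sum_{\alpha\in\operatorname{Comp}(\lambda)}\hat K_\alpha(x)\,K_{\alpha^\lambda}(y)=\sum_{\substack{\alpha\in\operatorname{Comp}(\lambda),\ \beta\in\mathbb N^m\\ \beta^+=\alpha^+,\ K(\beta)\le K(\alpha^\lambda)}}\hat K_\alpha(x)\,\hat K_\beta(y).$$
   Context: $\mathbb N=\{0,1,2,\ldots\}$. $(i,j)\in\lambda$ means $1\le i\le n$, $1\le j\le\lambda_i$. Identities are of formal power series. For a weak composition $\alpha$, $\alpha^+$ is its weakly decreasing rearrangement (compared as partitions, up to trailing zeros) and $K(\alpha)$ is the key tableau: the semistandard tableau (English notation) of shape $\alpha^+$ and content $\alpha$, whose column $r$ consists of $\{i:\alpha_i\ge r\}$. For fillings of the same shape, $\le$ means entrywise comparison. Demazure atoms $\hat K_\alpha$ and key polynomials $K_\alpha$: let $\hat\pi_i=\frac{x_{i+1}}{x_i-x_{i+1}}(1-K_{i,i+1})$, where $K_{i,i+1}$ exchanges the variables $x_i,x_{i+1}$, and $\pi_i=\hat\pi_i+1$. Then $\hat K_\alpha=K_\alpha=x^\alpha$ if $\alpha_1\ge\alpha_2\ge\cdots$, and $\hat K_\alpha=\hat\pi_i\hat K_{s_i\alpha}$, $K_\alpha=\pi_iK_{s_i\alpha}$ if $\alpha_i<\alpha_{i+1}$.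 (By the classical formulas of Lascoux–Schützenberger, $\hat K_\alpha$, resp. $K_\alpha$, is the generating function $\sum x^{\operatorname{wt}(T)}$ of semistandard tableaux $T$ of shape $\alpha^+$ whose right key satisfies $K_+(T)=K(\alpha)$, resp. $K_+(T)\le K(\alpha)$.) Partitions may be padded with trailing zeros; write $\lambda[i]=\lambda_i$. For $\alpha\in\mathbb N^n$, $B_+^\lambda(\alpha)$ is the filling of shape $\alpha^+$ such that, if column $r$ has length $c_r$, its $i$-th entry from the top is $\lambda[\,\cdot\,]$ applied to the $(c_r+1-i)$-th entry from the top of column $r$ of $K(\alpha)$. For a weakly increasing integer column written from bottom to top as $c_1\ge\cdots\ge c_k$, its strictification is the column $d_1>\cdots>d_k$ (bottom to top) with $d_1=c_1$, $d_i=\min\{d_{i-1}-1,c_i\}$. If the columnwise strictification $\operatorname{str}(B_+^\lambda(\alpha))$ has only positive entries (vacuously true if $\alpha=0$), it is a key tableau and $\alpha^\lambda\in\mathbb N^m$ is the unique weak composition with $K(\alpha^\lambda)=\operatorname{str}(B_+^\lambda(\alpha))$; otherwise $\alpha^\lambda$ does not exist. $\operatorname{Comp}(\lambda)=\{\alpha\in\mathbb N^n:\alpha^\lambda\text{ exists}\}$. *)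

theory Defs
  imports "HOL-Library.Poly_Mapping" "HOL-Combinatorics.Transposition"
begin

text \<open>
  Coefficients are integers throughout. A monomial is a finitely supported exponent
  function, so polynomials are instances of the ring of finitely supported functions
  on the additive monoid of exponents.
\<close>

type_synonym 'v mpoly = "('v \<Rightarrow>\<^sub>0 nat) \<Rightarrow>\<^sub>0 int"

definition var :: "'v \<Rightarrow> 'v mpoly" where
  "var v = Poly_Mapping.single (Poly_Mapping.single v 1) 1"

definition peval :: "('v \<Rightarrow> 'a::comm_ring_1) \<Rightarrow> 'v mpoly \<Rightarrow> 'a" where
  "peval \<xi> p = (\<Sum>m\<in>Poly_Mapping.keys p. of_int (Poly_Mapping.lookup p m) *
     (\<Prod>v\<in>Poly_Mapping.keys m. \<xi> v ^ Poly_Mapping.lookup m v))"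

typedef 'v mfps = "UNIV :: (('v \<Rightarrow>\<^sub>0 nat) \<Rightarrow> int) set"
  morphisms mfps_coeff Abs_mfps by simp

setup_lifting type_definition_mfps

lemma mfps_eqI: "(\<And>m. mfps_coeff f m = mfps_coeff g m) \<Longrightarrow> f = g"
  by (metis ext mfps_coeff_inject)

lemma mfps_coeff_Abs [simp]: "mfps_coeff (Abs_mfps f) = f"
  by (simp add: Abs_mfps_inverse)

lemma finite_mon_decomp: "finite {(a, b). a + b = (m :: 'v \<Rightarrow>\<^sub>0 nat)}"
proof -
  let ?F = "{f :: 'v \<Rightarrow> nat. \<forall>v. (v \<in> Poly_Mapping.keys m \<longrightarrow> f v \<in> {..Max (insert 0 (Poly_Mapping.lookup m ` Poly_Mapping.keys m))}) \<and>
    (v \<notin> Poly_Mapping.keys m \<longrightarrow> f v = 0)}"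
  have F: "finite ?F" by (rule finite_set_of_finite_funs) auto
  have inj: "inj_on (\<lambda>p. Poly_Mapping.lookup (fst p)) {(a, b). a + b = m}"
    by (auto simp: inj_on_def poly_mapping_eq_iff[symmetric])
  have "(\<lambda>p. Poly_Mapping.lookup (fst p)) ` {(a, b). a + b = m} \<subseteq> ?F"
  proof (clarsimp, intro allI conjI impI)
    fix a b :: "'v \<Rightarrow>\<^sub>0 nat" and v assume m: "m = a + b"
    { assume v: "v \<in> Poly_Mapping.keys (a + b)"
      have "Poly_Mapping.lookup a v \<le> Poly_Mapping.lookup (a + b) v"
        by (simp add: lookup_add)
      also have "\<dots> \<le> Max (insert 0 (Poly_Mapping.lookup (a + b) ` Poly_Mapping.keys (a + b)))"
        using v by (intro Max_ge) auto
      finally show "Poly_Mapping.lookup a v \<le>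
        Max (insert 0 (Poly_Mapping.lookup (a + b) ` Poly_Mapping.keys (a + b)))" . }
    { assume "v \<notin> Poly_Mapping.keys (a + b)"
      then show "Poly_Mapping.lookup a v = 0"
        by (simp add: in_keys_iff lookup_add) }
  qed
  with F inj show ?thesis
    by (meson finite_imageD finite_subset)
qed

instantiation mfps :: (type) comm_ring_1
begin

lift_definition zero_mfps :: "'a mfps" is "\<lambda>_. 0" .
lift_definition one_mfps :: "'a mfps" is "\<lambda>m. if m = 0 then 1 else 0" .
lift_definition plus_mfps :: "'a mfps \<Rightarrow> 'a mfps \<Rightarrow> 'a mfps" is "\<lambda>f g m. f m + g m" .
lift_definition uminus_mfps :: "'a mfps \<Rightarrow> 'a mfps" is "\<lambda>f m. - f m" .
lift_definition minus_mfps :: "'a mfps \<Rightarrow> 'a mfps \<Rightarrow> 'a mfps" is "\<lambda>f g m. f m - g m" .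
lift_definition times_mfps :: "'a mfps \<Rightarrow> 'a mfps \<Rightarrow> 'a mfps" is
  "\<lambda>f g m. \<Sum>(a, b)\<in>{(a, b). a + b = m}. f a * g b" .

instance
proof
  fix a b c :: "'a mfps"
  show "a + b + c = a + (b + c)" "a + b = b + a" "0 + a = a" "- a + a = 0" "a - b = a + - b"
    by (transfer; simp add: fun_eq_iff)+
  show "(0::'a mfps) \<noteq> 1" by transfer (metis zero_neq_one)
  show "a * b = b * a"
    by transfer
      (intro ext sum.reindex_bij_witness[of _ prod.swap prod.swap]; auto simp: add.commute mult.commute)
  show "(a + b) * c = a * c + b * c"
    by transfer (simp add: fun_eq_iff distrib_right sum.distrib case_prod_unfold)
  show "1 * a = a"
  proof transfer
    fix f :: "('a \<Rightarrow>\<^sub>0 nat) \<Rightarrow> int"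
    show "(\<lambda>m. \<Sum>(a, b)\<in>{(a, b). a + b = m}. (if a = 0 then 1 else 0) * f b) = f"
    proof
      fix m
      have "(\<Sum>(a, b)\<in>{(a, b). a + b = m}. (if a = 0 then 1 else 0) * f b)
        = (\<Sum>(a, b)\<in>{(0 :: 'a \<Rightarrow>\<^sub>0 nat, m)}. (if a = 0 then 1 else 0) * f b)"
        by (intro sum.mono_neutral_right finite_mon_decomp) (auto split: if_splits)
      then show "(\<Sum>(a, b)\<in>{(a, b). a + b = m}. (if a = 0 then 1 else 0) * f b) = f m"
        by simp
    qed
  qed
  show "a * b * c = a * (b * c)"
  proof transfer
    fix f g h :: "('a \<Rightarrow>\<^sub>0 nat) \<Rightarrow> int"
    show "(\<lambda>m. \<Sum>(a, b)\<in>{(a, b). a + b = m}. (\<Sum>(a, b)\<in>{(c, d). c + d = a}. f a * g b) * h b)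
      = (\<lambda>m. \<Sum>(a, b)\<in>{(a, b). a + b = m}. f a * (\<Sum>(a, b)\<in>{(c, d). c + d = b}. g a * h b))"
    proof
      fix m :: "'a \<Rightarrow>\<^sub>0 nat"
      let ?D = "\<lambda>m :: 'a \<Rightarrow>\<^sub>0 nat. {(a, b). a + b = m}"
      have "(\<Sum>(a, b)\<in>?D m. (\<Sum>(a, b)\<in>?D a. f a * g b) * h b)
        = (\<Sum>p\<in>?D m. \<Sum>q\<in>?D (fst p). f (fst q) * g (snd q) * h (snd p))"
        by (simp add: case_prod_unfold sum_distrib_right)
      also have "\<dots> = (\<Sum>(p, q)\<in>(SIGMA p:?D m. ?D (fst p)). f (fst q) * g (snd q) * h (snd p))"
        by (rule sum.Sigma) (auto simp: finite_mon_decomp)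
      also have "\<dots> = (\<Sum>(p, q)\<in>(SIGMA p:?D m. ?D (snd p)). f (fst p) * (g (fst q) * h (snd q)))"
        by (rule sum.reindex_bij_witness[of _
              "\<lambda>((a, b), (c, d)). ((a + c, d), (a, c))" "\<lambda>((a, b), (c, d)). ((c, d + b), (d, b))"])
          (auto simp: ac_simps)
      also have "\<dots> = (\<Sum>p\<in>?D m. \<Sum>q\<in>?D (snd p). f (fst p) * (g (fst q) * h (snd q)))"
        by (rule sum.Sigma[symmetric]) (auto simp: finite_mon_decomp)
      also have "\<dots> = (\<Sum>(a, b)\<in>?D m. f a * (\<Sum>(a, b)\<in>?D b. g a * h b))"
        by (simp add: case_prod_unfold sum_distrib_left)
      finally show "(\<Sum>(a, b)\<in>?D m. (\<Sum>(a, b)\<in>?D a. f a * g b) * h b) =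
        (\<Sum>(a, b)\<in>?D m. f a * (\<Sum>(a, b)\<in>?D b. g a * h b))" .
    qed
  qed
qed

end

instantiation mfps :: (type) inverse
begin

definition inverse_mfps_def:
  "inverse (f :: 'a mfps) = (if f dvd 1 then THE g. f * g = 1 else 0)"

definition divide_mfps_def:
  "divide (f :: 'a mfps) g = f * inverse g"

instance ..

end

lemma mfps_inverse_unique: "f * g = 1 \<Longrightarrow> inverse f = (g :: 'v mfps)"
proof -
  assume g: "f * g = 1"
  then have f: "f dvd 1" by (intro dvdI[of _ _ g]) simp
  have "h = g" if "f * h = 1" for h
  proof -
    have "h = h * (f * g)" using g by simp
    also have "\<dots> = (f * h) * g" by (simp only: mult.assoc mult.commute mult.left_commute)
    also have "\<dots> = g" by (simp only: that mult_1)
    finally show ?thesis .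
  qed
  with g have "(THE g. f * g = 1) = g" by (rule the_equality)
  with f show "inverse f = g" by (simp add: inverse_mfps_def)
qed

definition mfps_var :: "'v \<Rightarrow> 'v mfps" where
  "mfps_var v = Abs_mfps (\<lambda>m. if m = Poly_Mapping.single v 1 then 1 else 0)"

lemma mfps_coeff_var_mult:
  "mfps_coeff (mfps_var v * f) m =
     (if Poly_Mapping.lookup m v = 0 then 0 else mfps_coeff f (m - Poly_Mapping.single v 1))"
proof -
  let ?e = "Poly_Mapping.single v 1 :: 'a \<Rightarrow>\<^sub>0 nat"
  have "mfps_coeff (mfps_var v * f) m
      = (\<Sum>(a, b)\<in>{(a, b). a + b = m}. (if a = ?e then 1 else 0) * mfps_coeff f b)"
    by (simp add: times_mfps.rep_eq mfps_var_def)
  also have "\<dots> = (\<Sum>(a, b)\<in>{(a, b). a = ?e \<and> a + b = m}. mfps_coeff f b)"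
    by (intro sum.mono_neutral_cong_right finite_mon_decomp) (auto split: if_splits)
  also have "{(a, b). a = ?e \<and> a + b = m} =
      (if Poly_Mapping.lookup m v = 0 then {} else {(?e, m - ?e)})"
  proof (cases "Poly_Mapping.lookup m v = 0")
    case True
    then show ?thesis by (auto simp: lookup_add)
  next
    case False
    have "?e + (m - ?e) = m"
      using False
      by (intro poly_mapping_eqI) (auto simp: lookup_add lookup_minus lookup_single when_def)
    then show ?thesis using False by auto
  qed
  finally show ?thesis by simp
qed

lemma mfps_geometric:
  assumes "u \<noteq> v"
  shows "(1 - mfps_var u * mfps_var v) * (1 / (1 - mfps_var u * mfps_var v)) = 1"
proof -
  let ?s = "\<lambda>k. Poly_Mapping.single u k + Poly_Mapping.single v (k :: nat)"
  define P where "P m \<longleftrightarrow> (\<exists>k. m = ?s k)" for m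
  let ?G = "Abs_mfps (\<lambda>m. if P m then 1 else 0)"
  have step: "P (m - Poly_Mapping.single u 1 - Poly_Mapping.single v 1) \<longleftrightarrow> P m"
    if m: "Poly_Mapping.lookup m u \<noteq> 0" "Poly_Mapping.lookup m v \<noteq> 0" for m
  proof -
    define q where "q = m - Poly_Mapping.single u 1 - Poly_Mapping.single v 1"
    have e: "m = q + (Poly_Mapping.single u 1 + Poly_Mapping.single v 1)"
      using m assms unfolding q_def
      by (intro poly_mapping_eqI) (auto simp: lookup_add lookup_minus lookup_single when_def)
    have s: "?s (Suc k) = ?s k + (Poly_Mapping.single u 1 + Poly_Mapping.single v 1)" for k
      by (simp add: single_add[of _ k 1, simplified] ac_simps)
    have "q = ?s k \<longleftrightarrow> m = ?s (Suc k)" for k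
      unfolding s by (subst e) (rule add_right_cancel[symmetric])
    moreover have "(\<exists>k. m = ?s k) \<longleftrightarrow> (\<exists>k. m = ?s (Suc k))"
    proof
      assume "\<exists>k. m = ?s k"
      then obtain k where k: "m = ?s k" ..
      with m(1) assms have "k \<noteq> 0" by (auto simp: lookup_add lookup_single)
      then obtain k' where "k = Suc k'" by (cases k) auto
      with k show "\<exists>k. m = ?s (Suc k)" by blast
    qed blast
    ultimately show ?thesis unfolding P_def q_def[symmetric] by simp
  qed
  have P0: "P m \<longleftrightarrow> m = 0" if "Poly_Mapping.lookup m u = 0 \<or> Poly_Mapping.lookup m v = 0" for m
  proof
    assume "P m"
    then obtain k where k: "m = ?s k" unfolding P_def ..
    with that assms have "k = 0" by (auto simp: lookup_add lookup_single)
    with k show "m = 0" by simp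
  next
    assume "m = 0"
    then have "m = ?s 0" by simp
    then show "P m" unfolding P_def by blast
  qed
  have "(1 - mfps_var u * mfps_var v) * ?G = 1"
  proof (rule mfps_eqI)
    fix m
    have "mfps_coeff ((1 - mfps_var u * mfps_var v) * ?G) m
      = mfps_coeff ?G m - mfps_coeff (mfps_var u * (mfps_var v * ?G)) m"
      by (simp add: left_diff_distrib mult.assoc minus_mfps.rep_eq)
    also have "\<dots> = (if m = 0 then 1 else 0)"
    proof (cases "Poly_Mapping.lookup m u = 0 \<or> Poly_Mapping.lookup m v = 0")
      case True
      with P0[of m] show ?thesis
        using assms by (auto simp: mfps_coeff_var_mult lookup_minus lookup_single)
    next
      case False
      with step[of m] assms show ?thesis
        by (auto simp: mfps_coeff_var_mult lookup_minus lookup_single)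
    qed
    also have "\<dots> = mfps_coeff 1 m" by (simp add: one_mfps.rep_eq)
    finally show "mfps_coeff ((1 - mfps_var u * mfps_var v) * ?G) m = mfps_coeff 1 m" .
  qed
  then show ?thesis
    by (simp add: divide_mfps_def mfps_inverse_unique)
qed

text \<open>
  Summation of a possibly infinite family: each coefficient of the sum is a finite sum of
  coefficients of the summands, which is convergence for the product topology on the
  coefficients with the integers discrete.
\<close>

definition mfps_has_sum :: "('i \<Rightarrow> 'v mfps) \<Rightarrow> 'i set \<Rightarrow> 'v mfps \<Rightarrow> bool" where
  "mfps_has_sum f A s \<longleftrightarrow> (\<forall>m.
     finite {i \<in> A. mfps_coeff (f i) m \<noteq> 0} \<and>
     (\<Sum>i\<in>{i \<in> A. mfps_coeff (f i) m \<noteq> 0}. mfps_coeff (f i) m) = mfps_coeff s m)"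

text \<open>
  Variables, positions in compositions and entries of tableaux are numbered from 1; a weak
  composition in \<open>\<nat>\<^sup>n\<close> is a list of length \<open>n\<close>, with \<open>i\<close>-th part \<open>\<alpha> ! (i - 1)\<close>.
\<close>

definition exch :: "nat \<Rightarrow> nat mpoly \<Rightarrow> nat mpoly" where
  "exch i f = peval (\<lambda>v. var (transpose i (Suc i) v)) f"

definition pi_hat :: "nat \<Rightarrow> nat mpoly \<Rightarrow> nat mpoly" where
  "pi_hat i f = (THE g. (var i - var (Suc i)) * g = var (Suc i) * (f - exch i f))"

definition pi_op :: "nat \<Rightarrow> nat mpoly \<Rightarrow> nat mpoly" where
  "pi_op i f = pi_hat i f + f"

lemma prod_dvd_cong:
  fixes d :: "'a::comm_ring_1"
  assumes "\<And>x. x \<in> A \<Longrightarrow> d dvd f x - g x"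
  shows "d dvd prod f A - prod g A"
  using assms
proof (induction A rule: infinite_finite_induct)
  case (insert a A)
  have "prod f (insert a A) - prod g (insert a A)
    = (f a - g a) * prod f A + g a * (prod f A - prod g A)"
    using insert.hyps by (simp add: algebra_simps)
  then show ?case using insert by (simp add: dvd_add dvd_mult dvd_mult2)
qed auto

lemma single_power: "Poly_Mapping.single (Poly_Mapping.single v (1::nat)) (1::int) ^ k
    = Poly_Mapping.single (Poly_Mapping.single v k) 1"
  by (induction k) (simp_all add: mult_single single_add[symmetric])

lemma prod_single: "finite A \<Longrightarrow> (\<Prod>v\<in>A. Poly_Mapping.single (e v :: 'v \<Rightarrow>\<^sub>0 nat) (1::int))
    = Poly_Mapping.single (\<Sum>v\<in>A. e v) 1"
  by (induction A rule: finite_induct) (simp_all add: mult_single)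

lemma poly_mapping_sum_singles:
  "(\<Sum>m\<in>Poly_Mapping.keys p. Poly_Mapping.single m (Poly_Mapping.lookup p m)) = p"
proof (rule poly_mapping_eqI)
  fix k
  have "(\<Sum>m\<in>Poly_Mapping.keys p. Poly_Mapping.lookup (Poly_Mapping.single m (Poly_Mapping.lookup p m)) k)
    = (\<Sum>m\<in>Poly_Mapping.keys p. if m = k then Poly_Mapping.lookup p k else 0)"
    by (intro sum.cong) (auto simp: lookup_single)
  then show "Poly_Mapping.lookup (\<Sum>m\<in>Poly_Mapping.keys p. Poly_Mapping.single m (Poly_Mapping.lookup p m)) k
      = Poly_Mapping.lookup p k"
    by (simp add: lookup_sum in_keys_iff)
qed

lemma of_int_mult_single: "of_int c * Poly_Mapping.single m (1::int)
    = Poly_Mapping.single (m :: 'v \<Rightarrow>\<^sub>0 nat) c"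
  by (subst single_of_int[symmetric]) (simp only: mult_single, simp)

lemma peval_var: "peval var p = (p :: 'v mpoly)"
  by (simp add: peval_def var_def single_power prod_single poly_mapping_sum_singles
      of_int_mult_single del: One_nat_def)

lemma pi_hat_unique:
  assumes "(var i - var (Suc i)) * g = var (Suc i) * (f - exch i f)"
  shows "pi_hat i f = g"
proof -
  have "var i - var (Suc i) \<noteq> (0 :: nat mpoly)"
  proof
    assume "var i - var (Suc i) = (0 :: nat mpoly)"
    then have "Poly_Mapping.keys (var i :: nat mpoly) = Poly_Mapping.keys (var (Suc i) :: nat mpoly)"
      by simp
    then have "Poly_Mapping.keys (Poly_Mapping.single i (1::nat)) = Poly_Mapping.keys (Poly_Mapping.single (Suc i) (1::nat))"
      by (simp add: var_def)
    then show False by simp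
  qed
  then have "h = g" if "(var i - var (Suc i)) * h = var (Suc i) * (f - exch i f)" for h
    using that[folded assms] by (rule mult_left_cancel[THEN iffD1])
  with assms show ?thesis
    unfolding pi_hat_def by (rule the_equality)
qed

text \<open>The division defining \<open>pi_hat\<close> is exact.\<close>

lemma pi_hat_eq: "(var i - var (Suc i)) * pi_hat i f = var (Suc i) * (f - exch i f)"
proof -
  let ?d = "var i - var (Suc i) :: nat mpoly"
  have v: "?d dvd var v - var (transpose i (Suc i) v)" for v
    using dvd_minus_iff[of ?d ?d] by (auto simp: transpose_def simp del: dvd_minus_iff)
  have p: "?d dvd var v ^ k - var (transpose i (Suc i) v) ^ k" for v and k :: nat
    using prod_dvd_cong[of "{..<k}" ?d "\<lambda>_. var v" "\<lambda>_. var (transpose i (Suc i) v)"] v by simp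
  have "f - exch i f = (\<Sum>m\<in>Poly_Mapping.keys f. of_int (Poly_Mapping.lookup f m) *
     ((\<Prod>v\<in>Poly_Mapping.keys m. var v ^ Poly_Mapping.lookup m v) -
      (\<Prod>v\<in>Poly_Mapping.keys m. var (transpose i (Suc i) v) ^ Poly_Mapping.lookup m v)))"
    by (subst peval_var[of f, symmetric])
      (simp add: exch_def peval_def sum_subtractf right_diff_distrib)
  also have "?d dvd \<dots>"
    by (intro dvd_sum dvd_mult prod_dvd_cong p)
  finally have "?d dvd var (Suc i) * (f - exch i f)" by (rule dvd_mult)
  then obtain g where "var (Suc i) * (f - exch i f) = ?d * g" ..
  then show ?thesis using pi_hat_unique[of i g f] by simp
qed

definition x_power :: "nat list \<Rightarrow> nat mpoly" where
  "x_power \<alpha> = (\<Prod>i = 1..length \<alpha>. var i ^ (\<alpha> ! (i - 1)))"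

definition swap_adj :: "nat \<Rightarrow> nat list \<Rightarrow> nat list" where
  "swap_adj i \<alpha> = \<alpha>[i - 1 := \<alpha> ! i, i := \<alpha> ! (i - 1)]"

text \<open>
  The recursion may be run along any ascent. That the outcome does not depend on the choices
  is the classical consequence of the braid relations for the operators.
\<close>

inductive is_atom :: "nat list \<Rightarrow> nat mpoly \<Rightarrow> bool" where
  dominant: "sorted_wrt (\<ge>) \<alpha> \<Longrightarrow> is_atom \<alpha> (x_power \<alpha>)"
| ascent: "1 \<le> i \<Longrightarrow> i < length \<alpha> \<Longrightarrow> \<alpha> ! (i - 1) < \<alpha> ! i \<Longrightarrow>
    is_atom (swap_adj i \<alpha>) f \<Longrightarrow> is_atom \<alpha> (pi_hat i f)"

inductive is_key_poly :: "nat list \<Rightarrow> nat mpoly \<Rightarrow> bool" where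
  dominant: "sorted_wrt (\<ge>) \<alpha> \<Longrightarrow> is_key_poly \<alpha> (x_power \<alpha>)"
| ascent: "1 \<le> i \<Longrightarrow> i < length \<alpha> \<Longrightarrow> \<alpha> ! (i - 1) < \<alpha> ! i \<Longrightarrow>
    is_key_poly (swap_adj i \<alpha>) f \<Longrightarrow> is_key_poly \<alpha> (pi_op i f)"

definition atom :: "nat list \<Rightarrow> nat mpoly" where
  "atom \<alpha> = (THE f. is_atom \<alpha> f)"

definition key_poly :: "nat list \<Rightarrow> nat mpoly" where
  "key_poly \<alpha> = (THE f. is_key_poly \<alpha> f)"

text \<open>Zero parts are dropped, so that rearrangements of different lengths can be compared.\<close>

definition dec_rearr :: "nat list \<Rightarrow> nat list" where
  "dec_rearr \<alpha> = rev (sort (filter (\<lambda>a. a > 0) \<alpha>))"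

text \<open>
  A filling is the list of its columns, from left to right, each read from top to bottom.
  A key tableau is determined by its columns; that it is semistandard of shape \<open>\<alpha>\<^sup>+\<close> and
  content \<open>\<alpha>\<close> is automatic.
\<close>

definition key_tab :: "nat list \<Rightarrow> nat list list" where
  "key_tab \<alpha> = map (\<lambda>r. sorted_list_of_set {i \<in> {1..length \<alpha>}. \<alpha> ! (i - 1) \<ge> r})
     [1..<Suc (Max (insert 0 (set \<alpha>)))]"

definition tab_le :: "nat list list \<Rightarrow> nat list list \<Rightarrow> bool" where
  "tab_le = list_all2 (list_all2 (\<le>))"

definition B_plus :: "nat list \<Rightarrow> nat list \<Rightarrow> nat list list" where
  "B_plus lam \<alpha> = map (\<lambda>c. map (\<lambda>k. lam ! (k - 1)) (rev c)) (key_tab \<alpha>)"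

text \<open>\<open>strictify\<close> takes a column from bottom to top; the results may be negative.\<close>

fun strictify :: "int list \<Rightarrow> int list" where
  "strictify [] = []"
| "strictify [c] = [c]"
| "strictify (d # c # cs) = d # strictify (min (d - 1) c # cs)"

definition str :: "nat list list \<Rightarrow> int list list" where
  "str T = map (\<lambda>c. rev (strictify (map int (rev c)))) T"

definition Comp :: "nat list \<Rightarrow> nat list set" where
  "Comp lam = {\<alpha>. length \<alpha> = length lam \<and> (\<forall>c\<in>set (str (B_plus lam \<alpha>)). \<forall>e\<in>set c. e > 0)}"

text \<open>For \<open>\<alpha> \<in> Comp lam\<close> this is the composition \<open>\<alpha>\<^sup>\<lambda>\<close>, of length \<open>m = \<lambda>\<^sub>1\<close>.\<close>

definition comp_pow :: "nat list \<Rightarrow> nat list \<Rightarrow> nat list" where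
  "comp_pow lam \<alpha> = (THE \<beta>. length \<beta> = hd lam \<and>
     map (map int) (key_tab \<beta>) = str (B_plus lam \<alpha>))"

definition cells :: "nat list \<Rightarrow> (nat \<times> nat) set" where
  "cells lam = {(i, j). 1 \<le> i \<and> i \<le> length lam \<and> 1 \<le> j \<and> j \<le> lam ! (i - 1)}"

abbreviation x_var :: "nat \<Rightarrow> (nat + nat) mfps" where
  "x_var i \<equiv> mfps_var (Inl i)"

abbreviation y_var :: "nat \<Rightarrow> (nat + nat) mfps" where
  "y_var j \<equiv> mfps_var (Inr j)"

abbreviation in_x :: "nat mpoly \<Rightarrow> (nat + nat) mfps" where
  "in_x f \<equiv> peval x_var f"

abbreviation in_y :: "nat mpoly \<Rightarrow> (nat + nat) mfps" where
  "in_y f \<equiv> peval y_var f"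

end

theory Submission
  imports Defs "HOL-Library.Multiset"
begin

text \<open>
  The operator \<open>\<pi>\<close> in two adjacent variables \<open>y\<^sub>k\<close>, \<open>y\<^sub>k\<^sub>+\<^sub>1\<close> multiplies the kernel of a partition by
  \<open>1 / (1 - x\<^sub>i y\<^sub>k\<^sub>+\<^sub>1)\<close> if columns \<open>k\<close> and \<open>k + 1\<close> have lengths \<open>i\<close> and \<open>i - 1\<close>, that is, it adds a box;
  likewise for the variables \<open>x\<close> and rows. On the expansion into atoms and key polynomials both
  operators act termwise, and strictification changes in the same way. By removing boxes one
  reaches a staircase of size \<open>m\<close>, where \<open>\<alpha>\<^sup>\<lambda>\<close> is the reversal of \<open>\<alpha>\<close>.

  For the staircase, both sides satisfy \<open>\<pi>\<^sub>i P = \<pi>\<^sub>m\<^sub>-\<^sub>i P\<close> (in \<open>x\<close> on the left and in \<open>y\<close> on the right).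
  Let \<open>\<Delta> = \<Prod>\<^sub>i\<^sub><\<^sub>j (x\<^sub>j - x\<^sub>i)\<close>. A solution \<open>P\<close> of these relations is determined by the coefficients of
  \<open>\<Delta> P\<close> at the strictly increasing exponents of \<open>x\<close>. At such an exponent \<open>\<alpha> + \<rho>\<close>, \<open>\<rho> = (0, 1, \<dots>, m - 1)\<close>,
  both coefficients are the monomial of \<open>rev \<alpha>\<close> in \<open>y\<close>: for the product by a telescoping
  computation, for the expansion since \<open>\<Delta>\<close> times the atom of \<open>\<beta>\<close> has coefficient \<open>1\<close> at \<open>\<alpha> + \<rho>\<close> if
  \<open>\<alpha> = \<beta>\<close> and \<open>0\<close> otherwise.
\<close>

text \<open>Power series cannot be divided freely, so an operator enters through the relation
  \<open>pi_rel\<close>; it determines the image because a difference of two variables is not a zero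
  divisor. Infinite sums are avoided by fixing the degree in x, which both kinds of operators
  preserve and which leaves finitely many compositions. The product \<Delta> is what makes the
  relations rigid. Since \<open>\<pi>\<^sub>i P\<close> is symmetric,
  \<open>\<Delta> \<pi>\<^sub>i P\<close> is antisymmetric: its coefficients change sign when two
  adjacent exponents are exchanged. The operator in y, on the other hand, cannot produce an exponent
  of x that was absent before. Comparing the two expressions for one series moves every exponent of
  x towards strictly increasing ones. For the duality with atoms two squared distances are needed,
  from 0 (\<open>nrm\<close>) and from \<rho> (\<open>shifted_nrm\<close>): their centres on a line
  of exponents are those of the symmetric and of the antisymmetric recursion. Removing boxes may
  shorten the first row while the number of variables y has to stay fixed; hence compositions are
  padded by zeros to a common length M.\<close>

abbreviation lookup :: "('a \<Rightarrow>\<^sub>0 'b::zero) \<Rightarrow> 'a \<Rightarrow> 'b" where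
  "lookup \<equiv> Poly_Mapping.lookup"

abbreviation single :: "'a \<Rightarrow> 'b \<Rightarrow> ('a \<Rightarrow>\<^sub>0 'b::zero)" where
  "single \<equiv> Poly_Mapping.single"

abbreviation keys :: "('a \<Rightarrow>\<^sub>0 'b::zero) \<Rightarrow> 'a set" where
  "keys \<equiv> Poly_Mapping.keys"

abbreviation map_key :: "('a \<Rightarrow> 'b) \<Rightarrow> ('b \<Rightarrow>\<^sub>0 'c::zero) \<Rightarrow> ('a \<Rightarrow>\<^sub>0 'c)" where
  "map_key \<equiv> Poly_Mapping.map_key"

section \<open>Evaluation of polynomials\<close>

definition pmon :: "('v \<Rightarrow> 'a::comm_ring_1) \<Rightarrow> ('v \<Rightarrow>\<^sub>0 nat) \<Rightarrow> 'a" where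
  "pmon \<xi> m = (\<Prod>v\<in>keys m. \<xi> v ^ lookup m v)"

lemma pmon_superset:
  assumes "finite U" "keys m \<subseteq> U"
  shows "pmon \<xi> m = (\<Prod>v\<in>U. \<xi> v ^ lookup m v)"
  unfolding pmon_def using assms
  by (intro prod.mono_neutral_left) (auto simp: in_keys_iff)

lemma pmon_0 [simp]: "pmon \<xi> 0 = 1"
  by (simp add: pmon_def)

lemma pmon_add: "pmon \<xi> (a + b) = pmon \<xi> a * pmon \<xi> b"
proof -
  let ?U = "keys a \<union> keys b"
  have "keys (a + b) \<subseteq> ?U" by (rule keys_add)
  then show ?thesis
    by (subst (1 2 3) pmon_superset[of ?U]) (auto simp: lookup_add power_add prod.distrib)
qed

lemma pmon_single: "pmon \<xi> (single v k) = \<xi> v ^ k"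
  by (subst pmon_superset[of "{v}"]) auto

lemma peval_pmon: "peval \<xi> p = (\<Sum>m\<in>keys p. of_int (lookup p m) * pmon \<xi> m)"
  by (simp add: peval_def pmon_def)

lemma peval_superset:
  assumes "finite K" "keys p \<subseteq> K"
  shows "peval \<xi> p = (\<Sum>m\<in>K. of_int (lookup p m) * pmon \<xi> m)"
  unfolding peval_pmon using assms
  by (intro sum.mono_neutral_left) (auto simp: in_keys_iff)

lemma peval_0 [simp]: "peval \<xi> 0 = 0"
  by (simp add: peval_def)

lemma peval_single: "peval \<xi> (single m c) = of_int c * pmon \<xi> m"
  by (subst peval_superset[of "{m}"]) auto

lemma peval_1 [simp]: "peval \<xi> 1 = 1"
  using peval_single[of \<xi> 0 1] by simp

lemma peval_add: "peval \<xi> (p + q) = peval \<xi> p + peval \<xi> q"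
proof -
  let ?U = "keys p \<union> keys q"
  have "keys (p + q) \<subseteq> ?U" by (rule keys_add)
  then show ?thesis
    by (subst (1 2 3) peval_superset[of ?U])
      (auto simp: lookup_add distrib_right sum.distrib)
qed

lemma peval_uminus: "peval \<xi> (- p) = - peval \<xi> p"
  using peval_add[of \<xi> p "- p"] by (simp add: eq_neg_iff_add_eq_0 add.commute)

lemma peval_diff: "peval \<xi> (p - q) = peval \<xi> p - peval \<xi> q"
  using peval_add[of \<xi> p "- q"] by (simp add: peval_uminus)

lemma peval_sum: "peval \<xi> (sum f A) = (\<Sum>a\<in>A. peval \<xi> (f a))"
  by (induction A rule: infinite_finite_induct) (auto simp: peval_add)

lemma peval_mult: "peval \<xi> (p * q) = peval \<xi> p * peval \<xi> q"
proof -
  have s: "peval \<xi> (single a c * single b d)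
      = peval \<xi> (single a c) * peval \<xi> (single b d)" for a b c d
    by (simp add: peval_single mult_single pmon_add mult_ac)
  have "peval \<xi> ((\<Sum>a\<in>A. single a (f a)) * (\<Sum>b\<in>B. single b (g b)))
      = peval \<xi> (\<Sum>a\<in>A. single a (f a)) * peval \<xi> (\<Sum>b\<in>B. single b (g b))"
    for A B f g
    by (simp add: sum_product peval_sum s)
  from this[of "lookup p" "keys p" "lookup q" "keys q"]
  show ?thesis by (simp only: poly_mapping_sum_singles)
qed

lemma peval_var_apply: "peval \<xi> (var v) = \<xi> v"
  by (simp add: var_def peval_single pmon_single)

lemma peval_prod: "peval \<xi> (prod f A) = (\<Prod>a\<in>A. peval \<xi> (f a))"
  by (induction A rule: infinite_finite_induct) (auto simp: peval_mult)

lemma peval_power: "peval \<xi> (p ^ k) = peval \<xi> p ^ k"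
  by (induction k) (auto simp: peval_mult)

lemmas peval_simps = peval_add peval_diff peval_mult peval_var_apply peval_uminus

text \<open>Serves both for substituting polynomials into a polynomial and for exchanging variables
  in a series, since each is a ring homomorphism.\<close>

lemma hom_peval:
  fixes h :: "'a::comm_ring_1 \<Rightarrow> 'b::comm_ring_1"
  assumes h: "\<And>a b. h (a + b) = h a + h b" "\<And>a b. h (a * b) = h a * h b" "h 1 = 1"
  shows "h (peval \<xi> p) = peval (\<lambda>v. h (\<xi> v)) p"
proof -
  have h0: "h 0 = 0" using h(1)[of 0 0] by simp
  have hm: "h (- a) = - h a" for a using h(1)[of a "- a"] h0 by (simp add: eq_neg_iff_add_eq_0 add.commute)
  have hn: "h (of_nat k) = of_nat k" for k by (induction k) (auto simp: h0 h)
  have hi: "h (of_int k) = of_int k" for k by (cases k rule: int_cases2) (simp_all add: hn hm)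
  have hs: "h (sum f A) = (\<Sum>a\<in>A. h (f a))" for f :: "('c \<Rightarrow>\<^sub>0 nat) \<Rightarrow> 'a" and A
    by (induction A rule: infinite_finite_induct) (auto simp: h0 h)
  have hp: "h (prod f A) = (\<Prod>a\<in>A. h (f a))" for f :: "'c \<Rightarrow> 'a" and A
    by (induction A rule: infinite_finite_induct) (auto simp: h)
  have hq: "h (a ^ k) = h a ^ k" for a k by (induction k) (auto simp: h)
  show ?thesis by (simp add: peval_def hs hp hq hi h)
qed

lemma peval_peval: "peval \<xi> (peval \<eta> p) = peval (\<lambda>v. peval \<xi> (\<eta> v)) p"
  by (rule hom_peval) (auto simp: peval_simps)

section \<open>Power series in several variables\<close>

lemma mfps_coeff_0 [simp]: "mfps_coeff 0 m = 0" by (simp add: zero_mfps.rep_eq)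
lemma mfps_coeff_1: "mfps_coeff 1 m = (if m = 0 then 1 else 0)" by (simp add: one_mfps.rep_eq)
lemma mfps_coeff_add [simp]: "mfps_coeff (f + g) m = mfps_coeff f m + mfps_coeff g m" by (simp add: plus_mfps.rep_eq minus_mfps.rep_eq)
lemma mfps_coeff_diff [simp]: "mfps_coeff (f - g) m = mfps_coeff f m - mfps_coeff g m" by (simp add: plus_mfps.rep_eq minus_mfps.rep_eq)
lemma mfps_coeff_uminus [simp]: "mfps_coeff (- f) m = - mfps_coeff f m" by (simp add: uminus_mfps.rep_eq)
lemma mfps_coeff_mult:
  "mfps_coeff (f * g) m = (\<Sum>(a, b)\<in>{(a, b). a + b = m}. mfps_coeff f a * mfps_coeff g b)"
  by (simp add: times_mfps.rep_eq)
lemma mfps_coeff_sum: "mfps_coeff (sum f A) m = (\<Sum>a\<in>A. mfps_coeff (f a) m)"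
  by (induction A rule: infinite_finite_induct) auto
lemma mfps_coeff_var: "mfps_coeff (mfps_var v) m = (if m = single v 1 then 1 else 0)"
  by (simp add: mfps_var_def)

lemma mfps_coeff_mult_nonzero:
  assumes "mfps_coeff (f * g) m \<noteq> 0"
  obtains a b where "m = a + b" "mfps_coeff f a \<noteq> 0" "mfps_coeff g b \<noteq> 0"
proof -
  from assms obtain p where "p \<in> {(a, b). a + b = m}"
      "(\<lambda>(a, b). mfps_coeff f a * mfps_coeff g b) p \<noteq> 0"
    unfolding mfps_coeff_mult by (rule sum.not_neutral_contains_not_neutral)
  then show ?thesis by (cases p) (auto intro!: that)
qed

section \<open>Exchange of two variables in a series\<close>

definition vswap :: "'v \<Rightarrow> 'v \<Rightarrow> 'v mfps \<Rightarrow> 'v mfps" where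
  "vswap u v f = Abs_mfps (\<lambda>m. mfps_coeff f (map_key (transpose u v) m))"

lemma lookup_map_key_transpose [simp]:
  "lookup (map_key (transpose u v) m) w
    = lookup m (transpose u v w)"
  by (simp add: map_key.rep_eq)

lemma map_key_transpose_involutory [simp]:
  "map_key (transpose u v) (map_key (transpose u v) m) = m"
  by (intro poly_mapping_eqI) simp

lemma map_key_transpose_add:
  "map_key (transpose u v) (a + b)
    = map_key (transpose u v) a + map_key (transpose u v) b"
  by (intro poly_mapping_eqI) (simp add: lookup_add)

lemma map_key_transpose_eq_iff:
  "map_key (transpose u v) m = n \<longleftrightarrow> m = map_key (transpose u v) n"
  by (metis map_key_transpose_involutory)

lemma map_key_transpose_single:
  "map_key (transpose u v) (single w k) = single (transpose u v w) k"
proof (intro poly_mapping_eqI)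
  fix z
  have "w = transpose u v z \<longleftrightarrow> transpose u v w = z"
    by (metis transpose_involutory)
  then show "lookup (map_key (transpose u v) (single w k)) z
    = lookup (single (transpose u v w) k) z"
    by (simp add: lookup_single when_def)
qed

lemma map_key_transpose_0 [simp]: "map_key (transpose u v) 0 = 0"
  by (intro poly_mapping_eqI) simp

lemma coeff_vswap: "mfps_coeff (vswap u v f) m = mfps_coeff f (map_key (transpose u v) m)"
  by (simp add: vswap_def)

lemma vswap_add: "vswap u v (f + g) = vswap u v f + vswap u v g"
  by (rule mfps_eqI) (simp add: coeff_vswap)
lemma vswap_diff: "vswap u v (f - g) = vswap u v f - vswap u v g"
  by (rule mfps_eqI) (simp add: coeff_vswap)
lemma vswap_0 [simp]: "vswap u v 0 = 0"
  by (rule mfps_eqI) (simp add: coeff_vswap)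
lemma vswap_1 [simp]: "vswap u v 1 = 1"
  by (rule mfps_eqI) (simp add: coeff_vswap mfps_coeff_1 map_key_transpose_eq_iff)
lemma vswap_mult: "vswap u v (f * g) = vswap u v f * vswap u v g"
proof (rule mfps_eqI)
  fix m :: "'a \<Rightarrow>\<^sub>0 nat"
  let ?s = "map_key (transpose u v) :: ('a \<Rightarrow>\<^sub>0 nat) \<Rightarrow> _"
  have [simp]: "a + b = ?s m \<longleftrightarrow> ?s a + ?s b = m" for a b
    by (metis map_key_transpose_add map_key_transpose_eq_iff)
  show "mfps_coeff (vswap u v (f * g)) m = mfps_coeff (vswap u v f * vswap u v g) m"
    unfolding coeff_vswap mfps_coeff_mult
    by (rule sum.reindex_bij_witness[of _ "\<lambda>(a, b). (?s a, ?s b)" "\<lambda>(a, b). (?s a, ?s b)"]) auto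
qed
lemma vswap_var: "vswap u v (mfps_var w) = mfps_var (transpose u v w)"
  by (rule mfps_eqI) (simp add: coeff_vswap mfps_coeff_var map_key_transpose_eq_iff map_key_transpose_single)
lemma vswap_vswap [simp]: "vswap u v (vswap u v f) = f"
  by (rule mfps_eqI) (simp add: coeff_vswap)
lemma vswap_prod: "vswap u v (prod f A) = (\<Prod>a\<in>A. vswap u v (f a))"
  by (induction A rule: infinite_finite_induct) (auto simp: vswap_mult)

lemmas vswap_simps = vswap_add vswap_diff vswap_mult vswap_var

text \<open>If the product vanishes, the coefficients of f do not change when one v is traded for
  one u, and they are 0 where no v is left to trade; repeated trading reaches that case.\<close>

lemma var_diff_cancel:
  assumes "u \<noteq> v" and 0: "(mfps_var u - mfps_var v) * f = 0"
  shows "f = 0"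
proof (rule mfps_eqI)
  fix m
  have *: "mfps_coeff f m = (if lookup m v = 0 then 0
     else mfps_coeff f (m + single u 1 - single v 1))" for m
  proof -
    have "mfps_coeff ((mfps_var u - mfps_var v) * f) (m + single u 1) = 0"
      using 0 by simp
    then show ?thesis using assms(1)
      by (auto simp: left_diff_distrib mfps_coeff_var_mult lookup_add lookup_single split: if_splits)
  qed
  show "mfps_coeff f m = mfps_coeff 0 m"
  proof (induction "lookup m v" arbitrary: m)
    case 0
    then show ?case by (subst *) simp
  next
    case (Suc k)
    have "mfps_coeff f (m + single u 1 - single v 1) = 0"
      using Suc(1)[of "m + single u 1 - single v 1"] Suc(2) assms(1)
      by (simp add: lookup_add lookup_minus lookup_single)
    then show ?case by (subst *) simp
  qed
qed

lemma var_diff_cancel_eq: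
  assumes "u \<noteq> v" "(mfps_var u - mfps_var v) * f = (mfps_var u - mfps_var v) * g"
  shows "f = g"
  using var_diff_cancel[of u v "f - g"] assms by (simp add: right_diff_distrib)

section \<open>Cutting a series down to a set of exponents\<close>

definition restr :: "(('v \<Rightarrow>\<^sub>0 nat) \<Rightarrow> bool) \<Rightarrow> 'v mfps \<Rightarrow> 'v mfps" where
  "restr Z f = Abs_mfps (\<lambda>m. if Z m then mfps_coeff f m else 0)"

lemma coeff_restr [simp]: "mfps_coeff (restr Z f) m = (if Z m then mfps_coeff f m else 0)"
  by (simp add: restr_def)

lemma restr_add: "restr Z (f + g) = restr Z f + restr Z g" by (rule mfps_eqI) simp
lemma restr_diff: "restr Z (f - g) = restr Z f - restr Z g" by (rule mfps_eqI) simp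

lemma restr_mult:
  assumes "\<And>a b. mfps_coeff h b \<noteq> 0 \<Longrightarrow> Z' (b + a) \<longleftrightarrow> Z a"
  shows "restr Z' (h * f) = h * restr Z f"
proof (rule mfps_eqI)
  fix m
  show "mfps_coeff (restr Z' (h * f)) m = mfps_coeff (h * restr Z f) m"
  proof (cases "Z' m")
    case True
    have "mfps_coeff h a * mfps_coeff f b = mfps_coeff h a * mfps_coeff (restr Z f) b"
      if "a + b = m" for a b
      using that True assms[of a b] by (cases "mfps_coeff h a = 0") auto
    then show ?thesis using True
      by (auto simp: mfps_coeff_mult intro!: sum.cong)
  next
    case False
    then have "mfps_coeff (h * restr Z f) m = 0"
      unfolding mfps_coeff_mult using assms by (intro sum.neutral) auto
    with False show ?thesis by simp
  qed
qed

lemma restr_var_mult: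
  assumes "\<And>a. Z' (single v 1 + a) \<longleftrightarrow> Z a"
  shows "restr Z' (mfps_var v * f) = mfps_var v * restr Z f"
  using assms by (intro restr_mult) (auto simp: mfps_coeff_var split: if_splits)

lemma restr_vswap:
  assumes "\<And>m. Z (map_key (transpose u v) m) \<longleftrightarrow> Z m"
  shows "restr Z (vswap u v f) = vswap u v (restr Z f)"
  using assms by (intro mfps_eqI) (simp add: coeff_vswap)

text \<open>The graph of the operator \<open>\<pi>\<close>: stated without division, it makes sense for power series.\<close>

definition pi_rel :: "'v \<Rightarrow> 'v \<Rightarrow> 'v mfps \<Rightarrow> 'v mfps \<Rightarrow> bool" where
  "pi_rel u v f g \<longleftrightarrow> (mfps_var u - mfps_var v) * g = mfps_var u * f - mfps_var v * vswap u v f"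

lemma pi_rel_unique: "u \<noteq> v \<Longrightarrow> pi_rel u v f g \<Longrightarrow> pi_rel u v f h \<Longrightarrow> g = h"
  using var_diff_cancel_eq[of u v g h] by (simp add: pi_rel_def)

lemma pi_rel_0: "pi_rel u v 0 0"
  by (simp add: pi_rel_def)

lemma pi_rel_add: "pi_rel u v f g \<Longrightarrow> pi_rel u v f' g' \<Longrightarrow> pi_rel u v (f + f') (g + g')"
  by (simp add: pi_rel_def vswap_simps algebra_simps)

lemma pi_rel_diff: "pi_rel u v f g \<Longrightarrow> pi_rel u v f' g' \<Longrightarrow> pi_rel u v (f - f') (g - g')"
  by (simp add: pi_rel_def vswap_simps algebra_simps)

lemma pi_rel_sum: "(\<And>a. a \<in> A \<Longrightarrow> pi_rel u v (f a) (g a)) \<Longrightarrow> pi_rel u v (sum f A) (sum g A)"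
  by (induction A rule: infinite_finite_induct) (auto simp: pi_rel_0 pi_rel_add)

lemma pi_rel_mult:
  assumes "vswap u v h = h" "pi_rel u v f g"
  shows "pi_rel u v (f * h) (g * h)"
proof -
  have "(mfps_var u - mfps_var v) * (g * h) = ((mfps_var u - mfps_var v) * g) * h"
    by (simp add: mult.assoc)
  also have "\<dots> = mfps_var u * (f * h) - mfps_var v * vswap u v (f * h)"
    using assms by (simp add: pi_rel_def vswap_mult left_diff_distrib mult.assoc)
  finally show ?thesis by (simp add: pi_rel_def)
qed

text \<open>The exchange negates the right side of the defining relation and also the factor u - v
  on the left, which is then cancelled.\<close>

lemma pi_rel_sym:
  assumes "u \<noteq> v" "pi_rel u v f g"
  shows "vswap u v g = g"
proof (rule var_diff_cancel_eq[OF assms(1)])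
  have "vswap u v ((mfps_var u - mfps_var v) * g) = vswap u v (mfps_var u * f - mfps_var v * vswap u v f)"
    using assms(2) by (simp add: pi_rel_def)
  then have "(mfps_var v - mfps_var u) * vswap u v g = mfps_var v * vswap u v f - mfps_var u * f"
    by (simp add: vswap_simps)
  then have "(mfps_var u - mfps_var v) * vswap u v g = mfps_var u * f - mfps_var v * vswap u v f"
    by (simp add: algebra_simps)
  then show "(mfps_var u - mfps_var v) * vswap u v g = (mfps_var u - mfps_var v) * g"
    using assms(2) by (simp add: pi_rel_def)
qed

text \<open>\<open>Z'\<close> is \<open>Z\<close> moved up by one degree: multiplication by u and
  multiplication by v must both carry \<open>Z\<close> to \<open>Z'\<close>. This applies to a fixed
  degree in x, and to fixed exponents of x when u and v are variables y.\<close>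

lemma pi_rel_restr:
  assumes "pi_rel u v f g"
    and "\<And>m. Z (map_key (transpose u v) m) \<longleftrightarrow> Z m"
    and "\<And>a. Z' (single u 1 + a) \<longleftrightarrow> Z a"
    and "\<And>a. Z' (single v 1 + a) \<longleftrightarrow> Z a"
  shows "pi_rel u v (restr Z f) (restr Z g)"
proof -
  have "restr Z' ((mfps_var u - mfps_var v) * g) = restr Z' (mfps_var u * f - mfps_var v * vswap u v f)"
    using assms(1) by (simp add: pi_rel_def)
  then show ?thesis
    using assms(2-4) unfolding pi_rel_def
    by (simp add: restr_diff left_diff_distrib restr_var_mult[of Z' _ Z] restr_vswap[of Z])
qed

section \<open>Demazure operators\<close>

lemma exch_add: "exch i (f + g) = exch i f + exch i g"
  and exch_diff: "exch i (f - g) = exch i f - exch i g"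
  and exch_uminus: "exch i (- f) = - exch i f"
  and exch_mult: "exch i (f * g) = exch i f * exch i g"
  and exch_var: "exch i (var v) = var (transpose i (Suc i) v)"
  and exch_0 [simp]: "exch i 0 = 0"
  by (simp_all add: exch_def peval_simps)

lemmas exch_simps = exch_add exch_diff exch_uminus exch_mult exch_var

lemma exch_exch [simp]: "exch i (exch i f) = f"
  by (simp add: exch_def peval_peval peval_var_apply peval_var)

lemma exch_braid: "exch i (exch (Suc i) (exch i f)) = exch (Suc i) (exch i (exch (Suc i) f))"
  unfolding exch_def peval_peval peval_var_apply
  by (rule arg_cong[where f = "\<lambda>\<xi>. peval \<xi> f"]) (auto simp: transpose_def fun_eq_iff)

lemma exch_commute:
  assumes "Suc i < j"
  shows "exch i (exch j f) = exch j (exch i f)"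
  unfolding exch_def peval_peval peval_var_apply
  by (rule arg_cong[where f = "\<lambda>\<xi>. peval \<xi> f"]) (use assms in \<open>auto simp: transpose_def fun_eq_iff\<close>)

lemma var_neq: "u \<noteq> v \<Longrightarrow> var u - var v \<noteq> (0 :: nat mpoly)"
proof
  assume uv: "u \<noteq> v" and "var u - var v = (0 :: nat mpoly)"
  then have "keys (var u :: nat mpoly) = keys (var v :: nat mpoly)"
    by simp
  then have "keys (single u (1::nat)) = keys (single v (1::nat))"
    by (simp add: var_def)
  then show False using uv by simp
qed

lemma var_neq_0: "var v \<noteq> (0 :: nat mpoly)"
  by (simp add: var_def)

lemma pi_hat_add: "pi_hat i (f + g) = pi_hat i f + pi_hat i g"
  by (rule pi_hat_unique) (simp only: distrib_left pi_hat_eq exch_simps, simp add: algebra_simps)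

lemma pi_hat_0 [simp]: "pi_hat i 0 = 0"
  by (rule pi_hat_unique) simp

lemma pi_hat_sum: "pi_hat i (sum f A) = (\<Sum>a\<in>A. pi_hat i (f a))"
  by (induction A rule: infinite_finite_induct) (auto simp: pi_hat_add)

lemma pi_op_sum: "pi_op i (sum f A) = (\<Sum>a\<in>A. pi_op i (f a))"
  by (simp add: pi_op_def pi_hat_sum sum.distrib)

lemma pi_op_eq: "(var i - var (Suc i)) * pi_op i f = var i * f - var (Suc i) * exch i f"
  unfolding pi_op_def distrib_left pi_hat_eq by (simp add: algebra_simps)

lemma pi_hat_eq_0_iff: "pi_hat i f = 0 \<longleftrightarrow> exch i f = f"
proof
  assume "pi_hat i f = 0"
  then have "var (Suc i) * (f - exch i f) = 0" by (simp add: pi_hat_eq[symmetric])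
  then show "exch i f = f" using var_neq_0[of "Suc i"] by simp
qed (auto intro: pi_hat_unique)

lemma exch_pi_op: "exch i (pi_op i f) = pi_op i f"
proof -
  let ?d = "var i - var (Suc i) :: nat mpoly"
  have "exch i (?d * pi_op i f) = exch i (var i * f - var (Suc i) * exch i f)"
    by (simp add: pi_op_eq)
  then have "- ?d * exch i (pi_op i f) = var (Suc i) * exch i f - var i * f"
    by (simp add: exch_simps)
  then have "?d * exch i (pi_op i f) = ?d * pi_op i f"
    unfolding pi_op_eq by (simp add: algebra_simps)
  then show ?thesis using var_neq[of i "Suc i"] by simp
qed

text \<open>\<open>pi_op i f\<close> is symmetric and so killed by \<open>pi_hat i\<close>. As
  \<open>pi_op\<close> is \<open>pi_hat\<close> plus the identity, this means that
  \<open>pi_hat i\<close> is idempotent up to sign.\<close>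

lemma pi_hat_idem: "pi_op i (pi_hat i f) = 0"
proof -
  have "pi_hat i (pi_op i f) = 0" by (simp add: pi_hat_eq_0_iff exch_pi_op)
  then show ?thesis by (simp add: pi_op_def pi_hat_add)
qed

lemma pi_hat_commute:
  assumes ij: "Suc i < j"
  shows "pi_hat i (pi_hat j f) = pi_hat j (pi_hat i f)"
proof (rule pi_hat_unique)
  let ?d = "var j - var (Suc j) :: nat mpoly"
  have "?d * ((var i - var (Suc i)) * pi_hat j (pi_hat i f)) =
     (var i - var (Suc i)) * (?d * pi_hat j (pi_hat i f))" by (simp add: mult_ac)
  also have "\<dots> = var (Suc j) * ((var i - var (Suc i)) * pi_hat i f - exch j ((var i - var (Suc i)) * pi_hat i f))"
    unfolding pi_hat_eq[of j] using ij by (simp add: exch_simps algebra_simps)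
  also have "\<dots> = var (Suc i) * (?d * pi_hat j f - exch i (?d * pi_hat j f))"
    unfolding pi_hat_eq using ij exch_commute[OF ij, of f] by (simp add: exch_simps algebra_simps)
  also have "\<dots> = ?d * (var (Suc i) * (pi_hat j f - exch i (pi_hat j f)))"
    using ij by (simp add: exch_simps algebra_simps)
  finally show "(var i - var (Suc i)) * pi_hat j (pi_hat i f) = var (Suc i) * (pi_hat j f - exch i (pi_hat j f))"
    using var_neq[of j "Suc j"] by simp
qed

text \<open>Clearing denominators turns the threefold product into an alternating sum over the six
  permutations of a, b, c, which no longer depends on the word. With s and t the two exchanges, f1,
  f2, f12, f21, f121 stand for \<open>s f\<close>, \<open>t f\<close>, \<open>s (t f)\<close>,
  \<open>t (s f)\<close>, \<open>s (t (s f))\<close>, and g1', h, h', g2' for \<open>s g1\<close>,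
  \<open>t g1\<close>, \<open>s (t g1)\<close>, \<open>s g2\<close>.\<close>

lemma braid_aux:
  fixes a b c :: "nat mpoly"
  assumes g1: "(a - b) * g1 = b * (f - f1)"
    and g1': "(a - b) * g1' = a * (f - f1)"
    and h: "(a - c) * h = c * (f2 - f21)"
    and h': "(b - c) * h' = c * (f12 - f121)"
    and g2: "(b - c) * g2 = c * (g1 - h)"
    and g2': "(a - c) * g2' = c * (g1' - h')"
    and g3: "(a - b) * g3 = b * (g2 - g2')"
    and ab: "a - b \<noteq> 0"
  shows "(a - b) * (a - c) * (b - c) * g3 = b * c * c * (f - f1 - f2 + f12 + f21 - f121)"
proof -
  \<comment> \<open>The denominator a - b of the inner operator cancels in this combination of g1
    and its image.\<close>
  have "(a - b) * ((a - c) * g1 - (b - c) * g1') = (a - c) * ((a - b) * g1) - (b - c) * ((a - b) * g1')"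
    by (simp add: algebra_simps)
  also have "\<dots> = (a - b) * (c * (f - f1))"
    unfolding g1 g1' by (simp add: algebra_simps)
  finally have *: "(a - c) * g1 - (b - c) * g1' = c * (f - f1)" using ab by simp
  have "(a - b) * (a - c) * (b - c) * g3 = (a - c) * (b - c) * ((a - b) * g3)"
    by (simp add: mult_ac)
  also have "\<dots> = b * ((a - c) * ((b - c) * g2) - (b - c) * ((a - c) * g2'))"
    unfolding g3 by (simp add: algebra_simps)
  also have "\<dots> = b * c * (((a - c) * g1 - (b - c) * g1') - (a - c) * h + (b - c) * h')"
    unfolding g2 g2' by (simp add: algebra_simps)
  also have "\<dots> = b * c * c * (f - f1 - f2 + f12 + f21 - f121)"
    unfolding * h h' by (simp add: algebra_simps)
  finally show ?thesis .
qed

lemma pi_hat_braid_left: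
  fixes i :: nat
  defines "a \<equiv> var i" and "b \<equiv> var (Suc i)" and "c \<equiv> var (Suc (Suc i))"
  defines "s \<equiv> exch i" and "t \<equiv> exch (Suc i)"
  shows "(a - b) * (a - c) * (b - c) * pi_hat i (pi_hat (Suc i) (pi_hat i f))
    = b * c * c * (f - s f - t f + s (t f) + t (s f) - s (t (s f)))"
proof (rule braid_aux)
  have s [simp]: "s a = b" "s b = a" "s c = c" "t a = a" "t b = c" "t c = b"
    by (simp_all add: s_def t_def a_def b_def c_def exch_var transpose_def)
  have hs: "s (x - y) = s x - s y" "s (x * y) = s x * s y" "t (x - y) = t x - t y" "t (x * y) = t x * t y"
    "s (s x) = x" for x y
    by (simp_all add: s_def t_def exch_simps)
  let ?g1 = "pi_hat i f" and ?g2 = "pi_hat (Suc i) (pi_hat i f)"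
  show 1: "(a - b) * ?g1 = b * (f - s f)" and 2: "(b - c) * ?g2 = c * (?g1 - t ?g1)"
    and "(a - b) * pi_hat i ?g2 = b * (?g2 - s ?g2)"
    unfolding a_def b_def c_def s_def t_def by (rule pi_hat_eq)+
  have "s ((a - b) * ?g1) = s (b * (f - s f))" by (simp only: 1)
  then have "(b - a) * s ?g1 = a * (s f - f)" by (simp add: hs)
  then show "(a - b) * s ?g1 = a * (f - s f)" by (simp add: algebra_simps)
  have "t ((a - b) * ?g1) = t (b * (f - s f))" by (simp only: 1)
  then show 3: "(a - c) * t ?g1 = c * (t f - t (s f))" by (simp add: hs)
  have "s ((a - c) * t ?g1) = s (c * (t f - t (s f)))" by (simp only: 3)
  then show "(b - c) * s (t ?g1) = c * (s (t f) - s (t (s f)))" by (simp add: hs)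
  have "s ((b - c) * ?g2) = s (c * (?g1 - t ?g1))" by (simp only: 2)
  then show "(a - c) * s ?g2 = c * (s ?g1 - s (t ?g1))" by (simp add: hs)
  show "a - b \<noteq> 0" by (simp add: a_def b_def var_neq del: right_minus_eq)
qed

text \<open>The same alternating sum reached from the other word. Here g1', h, h', g2' are
  \<open>t g1\<close>, \<open>s g1\<close>, \<open>t (s g1)\<close>, \<open>t g2\<close>, and f121
  is \<open>t (s (t f))\<close>, which agrees with the former one by
  \<open>exch_braid\<close>.\<close>

lemma braid_aux':
  fixes a b c :: "nat mpoly"
  assumes g1: "(b - c) * g1 = c * (f - f2)"
    and g1': "(b - c) * g1' = b * (f - f2)"
    and h: "(a - c) * h = c * (f1 - f12)"
    and h': "(a - b) * h' = b * (f21 - f121)"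
    and g2: "(a - b) * g2 = b * (g1 - h)"
    and g2': "(a - c) * g2' = c * (g1' - h')"
    and g3: "(b - c) * g3 = c * (g2 - g2')"
    and bc: "b - c \<noteq> 0"
  shows "(a - b) * (a - c) * (b - c) * g3 = b * c * c * (f - f1 - f2 + f12 + f21 - f121)"
proof -
  have "(b - c) * ((a - c) * b * g1 - (a - b) * c * g1') = (a - c) * b * ((b - c) * g1) - (a - b) * c * ((b - c) * g1')"
    by (simp add: algebra_simps)
  also have "\<dots> = (b - c) * (b * c * (f - f2))"
    unfolding g1 g1' by (simp add: algebra_simps)
  finally have *: "(a - c) * b * g1 - (a - b) * c * g1' = b * c * (f - f2)" using bc by simp
  have "(a - b) * (a - c) * (b - c) * g3 = (a - b) * (a - c) * ((b - c) * g3)"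
    by (simp add: mult_ac)
  also have "\<dots> = c * ((a - c) * ((a - b) * g2) - (a - b) * ((a - c) * g2'))"
    unfolding g3 by (simp add: algebra_simps)
  also have "\<dots> = c * (((a - c) * b * g1 - (a - b) * c * g1') - b * ((a - c) * h) + c * ((a - b) * h'))"
    unfolding g2 g2' by (simp add: algebra_simps)
  also have "\<dots> = b * c * c * (f - f1 - f2 + f12 + f21 - f121)"
    unfolding * h h' by (simp add: algebra_simps)
  finally show ?thesis .
qed

lemma pi_hat_braid_right:
  fixes i :: nat
  defines "a \<equiv> var i" and "b \<equiv> var (Suc i)" and "c \<equiv> var (Suc (Suc i))"
  defines "s \<equiv> exch i" and "t \<equiv> exch (Suc i)"
  shows "(a - b) * (a - c) * (b - c) * pi_hat (Suc i) (pi_hat i (pi_hat (Suc i) f))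
    = b * c * c * (f - s f - t f + s (t f) + t (s f) - t (s (t f)))"
proof (rule braid_aux')
  have s [simp]: "s a = b" "s b = a" "s c = c" "t a = a" "t b = c" "t c = b"
    by (simp_all add: s_def t_def a_def b_def c_def exch_var transpose_def)
  have hs: "s (x - y) = s x - s y" "s (x * y) = s x * s y" "t (x - y) = t x - t y" "t (x * y) = t x * t y"
    "t (t x) = x" for x y
    by (simp_all add: s_def t_def exch_simps)
  let ?g1 = "pi_hat (Suc i) f" and ?g2 = "pi_hat i (pi_hat (Suc i) f)"
  show 1: "(b - c) * ?g1 = c * (f - t f)" and 2: "(a - b) * ?g2 = b * (?g1 - s ?g1)"
    and "(b - c) * pi_hat (Suc i) ?g2 = c * (?g2 - t ?g2)"
    unfolding a_def b_def c_def s_def t_def by (rule pi_hat_eq)+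
  have "t ((b - c) * ?g1) = t (c * (f - t f))" by (simp only: 1)
  then have "(c - b) * t ?g1 = b * (t f - f)" by (simp add: hs)
  then show "(b - c) * t ?g1 = b * (f - t f)" by (simp add: algebra_simps)
  have "s ((b - c) * ?g1) = s (c * (f - t f))" by (simp only: 1)
  then show 3: "(a - c) * s ?g1 = c * (s f - s (t f))" by (simp add: hs)
  have "t ((a - c) * s ?g1) = t (c * (s f - s (t f)))" by (simp only: 3)
  then show "(a - b) * t (s ?g1) = b * (t (s f) - t (s (t f)))" by (simp add: hs)
  have "t ((a - b) * ?g2) = t (b * (?g1 - s ?g1))" by (simp only: 2)
  then show "(a - c) * t ?g2 = c * (t ?g1 - t (s ?g1))" by (simp add: hs)
  show "b - c \<noteq> 0" by (simp add: b_def c_def var_neq del: right_minus_eq)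
qed

lemma pi_hat_braid:
  "pi_hat i (pi_hat (Suc i) (pi_hat i f)) = pi_hat (Suc i) (pi_hat i (pi_hat (Suc i) f))"
proof -
  let ?d = "(var i - var (Suc i)) * (var i - var (Suc (Suc i))) * (var (Suc i) - var (Suc (Suc i))) :: nat mpoly"
  have "?d \<noteq> 0"
    using var_neq[of i "Suc i"] var_neq[of i "Suc (Suc i)"] var_neq[of "Suc i" "Suc (Suc i)"] by simp
  moreover have "?d * pi_hat i (pi_hat (Suc i) (pi_hat i f)) = ?d * pi_hat (Suc i) (pi_hat i (pi_hat (Suc i) f))"
    by (simp only: pi_hat_braid_left pi_hat_braid_right exch_braid)
  ultimately show ?thesis by simp
qed

section \<open>Exchanging adjacent parts\<close>

lemma length_swap_adj [simp]: "length (swap_adj i \<alpha>) = length \<alpha>"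
  by (simp add: swap_adj_def)

lemma nth_swap_adj:
  assumes "1 \<le> i" "i < length \<alpha>" "j < length \<alpha>"
  shows "swap_adj i \<alpha> ! j = \<alpha> ! transpose (i - 1) i j"
  using assms by (auto simp: swap_adj_def nth_list_update transpose_def)

lemma nth_swap_adj' [simp]:
  assumes "1 \<le> i" "i < length \<alpha>"
  shows "swap_adj i \<alpha> ! (i - 1) = \<alpha> ! i" "swap_adj i \<alpha> ! i = \<alpha> ! (i - 1)"
    "swap_adj i \<alpha> ! (i - Suc 0) = \<alpha> ! i"
  using assms by (auto simp: nth_swap_adj)

lemma nth_swap_adj_Suc [simp]:
  "Suc i < length \<alpha> \<Longrightarrow> swap_adj (Suc i) \<alpha> ! i = \<alpha> ! Suc i"
  "Suc i < length \<alpha> \<Longrightarrow> swap_adj (Suc i) \<alpha> ! Suc i = \<alpha> ! i"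
  by (auto simp: swap_adj_def nth_list_update)

lemma nth_swap_adj_other [simp]:
  assumes "j \<noteq> i - 1" "j \<noteq> i"
  shows "swap_adj i \<alpha> ! j = \<alpha> ! j"
  using assms by (auto simp: swap_adj_def nth_list_update)

lemma swap_adj_swap_adj [simp]:
  assumes "1 \<le> i" "i < length \<alpha>"
  shows "swap_adj i (swap_adj i \<alpha>) = \<alpha>"
  using assms by (intro nth_equalityI) (auto simp: swap_adj_def nth_list_update)

lemma swap_adj_eq:
  assumes "1 \<le> i" "i < length \<alpha>" "\<alpha> ! (i - 1) = \<alpha> ! i"
  shows "swap_adj i \<alpha> = \<alpha>"
  using assms by (intro nth_equalityI) (auto simp: swap_adj_def nth_list_update)

lemma swap_adj_commute:
  assumes "1 \<le> i" "Suc i < j" "j < length \<alpha>"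
  shows "swap_adj i (swap_adj j \<alpha>) = swap_adj j (swap_adj i \<alpha>)"
  using assms by (intro nth_equalityI) (auto simp: swap_adj_def nth_list_update)

lemma swap_adj_braid:
  assumes "1 \<le> i" "Suc i < length \<alpha>"
  shows "swap_adj i (swap_adj (Suc i) (swap_adj i \<alpha>)) = swap_adj (Suc i) (swap_adj i (swap_adj (Suc i) \<alpha>))"
  using assms by (intro nth_equalityI) (auto simp: swap_adj_def nth_list_update)

lemma sum_list_swap_adj:
  assumes "1 \<le> i" "i < length \<alpha>"
  shows "sum_list (swap_adj i \<alpha>) = sum_list \<alpha>"
proof -
  have "sum_list (swap_adj i \<alpha>) = (\<Sum>j<length \<alpha>. \<alpha> ! transpose (i - 1) i j)"
    using assms by (simp add: sum_list_sum_nth atLeast0LessThan nth_swap_adj)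
  also have "\<dots> = (\<Sum>j<length \<alpha>. \<alpha> ! j)"
    using assms by (intro sum.reindex_bij_witness[of _ "transpose (i - 1) i" "transpose (i - 1) i"])
      (auto simp: transpose_def)
  finally show ?thesis by (simp add: sum_list_sum_nth atLeast0LessThan)
qed

text \<open>The termination measure of the recursion along ascents: moving the larger of two
  adjacent parts to the front decreases it.\<close>

definition wsum :: "nat list \<Rightarrow> nat" where
  "wsum \<alpha> = (\<Sum>j<length \<alpha>. j * \<alpha> ! j)"

lemma wsum_swap_adj:
  assumes "1 \<le> i" "i < length \<alpha>" "\<alpha> ! (i - 1) < \<alpha> ! i"
  shows "wsum (swap_adj i \<alpha>) < wsum \<alpha>"
proof -
  let ?A = "{..<length \<alpha>} - {i - 1, i}"
  have A: "{..<length \<alpha>} = insert (i - 1) (insert i ?A)" using assms by auto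
  have *: "(\<Sum>j<length \<alpha>. j * \<beta> ! j) = (i - 1) * \<beta> ! (i - 1) + i * \<beta> ! i + (\<Sum>j\<in>?A. j * \<beta> ! j)" for \<beta>
    using assms by (subst A) (simp add: add.assoc)
  have "(\<Sum>j\<in>?A. j * swap_adj i \<alpha> ! j) = (\<Sum>j\<in>?A. j * \<alpha> ! j)"
    by (rule sum.cong) auto
  moreover have "(i - 1) * \<alpha> ! i + i * \<alpha> ! (i - 1) < (i - 1) * \<alpha> ! (i - 1) + i * \<alpha> ! i"
    using assms by (cases i) auto
  ultimately show ?thesis using assms unfolding wsum_def length_swap_adj
    by (simp only: * nth_swap_adj')
qed

lemma sorted_wrt_no_ascent:
  assumes "sorted_wrt (\<ge>) \<alpha>" "1 \<le> i" "i < length \<alpha>"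
  shows "\<alpha> ! i \<le> \<alpha> ! (i - 1)"
  using sorted_wrt_nth_less[OF assms(1), of "i - 1" i] assms by simp

lemma ascent_exists:
  fixes \<alpha> :: "nat list"
  assumes "\<not> sorted_wrt (\<ge>) \<alpha>"
  obtains i where "1 \<le> i" "i < length \<alpha>" "\<alpha> ! (i - 1) < \<alpha> ! i"
proof -
  have "\<exists>i. Suc i < length \<alpha> \<and> \<alpha> ! i < \<alpha> ! Suc i"
  proof (rule ccontr)
    assume "\<not> (\<exists>i. Suc i < length \<alpha> \<and> \<alpha> ! i < \<alpha> ! Suc i)"
    then have "\<alpha> ! Suc i \<le> \<alpha> ! i" if "Suc i < length \<alpha>" for i
      using that by (meson not_less)
    then have "sorted_wrt (\<ge>) \<alpha>"
      by (subst sorted_wrt_iff_nth_Suc_transp) (auto intro: transpI)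
    with assms show False ..
  qed
  then show ?thesis using that by fastforce
qed

section \<open>Demazure atoms\<close>

lemma is_atom_exists: "\<exists>f. is_atom \<alpha> f"
proof (induction "wsum \<alpha>" arbitrary: \<alpha> rule: less_induct)
  case less
  show ?case
  proof (cases "sorted_wrt (\<ge>) \<alpha>")
    case True
    then show ?thesis by (blast intro: is_atom.dominant)
  next
    case False
    then obtain i where i: "1 \<le> i" "i < length \<alpha>" "\<alpha> ! (i - 1) < \<alpha> ! i" by (rule ascent_exists)
    then obtain f where "is_atom (swap_adj i \<alpha>) f" using less wsum_swap_adj by blast
    with i show ?thesis by (blast intro: is_atom.ascent)
  qed
qed

lemma is_atom_cases:
  assumes "is_atom \<alpha> f"
  obtains "sorted_wrt (\<ge>) \<alpha>" "f = x_power \<alpha>"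
  | i g where "1 \<le> i" "i < length \<alpha>" "\<alpha> ! (i - 1) < \<alpha> ! i" "is_atom (swap_adj i \<alpha>) g" "f = pi_hat i g"
  using assms by cases auto

text \<open>Local confluence. Two distant ascents can be swapped in either order, and two
  neighbouring ones meet after three swaps, where the braid relation applies; uniqueness below
  \<open>\<alpha>\<close> is the induction hypothesis \<open>IH\<close>.\<close>

lemma is_atom_confluent:
  assumes IH: "\<And>\<beta> f g. wsum \<beta> < wsum \<alpha> \<Longrightarrow> is_atom \<beta> f \<Longrightarrow> is_atom \<beta> g \<Longrightarrow> f = g"
    and i: "1 \<le> i" "i < length \<alpha>" "\<alpha> ! (i - 1) < \<alpha> ! i" "is_atom (swap_adj i \<alpha>) f"
    and j: "1 \<le> j" "j < length \<alpha>" "\<alpha> ! (j - 1) < \<alpha> ! j" "is_atom (swap_adj j \<alpha>) g"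
    and "i \<le> j"
  shows "pi_hat i f = pi_hat j g"
proof -
  have wi: "wsum (swap_adj i \<alpha>) < wsum \<alpha>" and wj: "wsum (swap_adj j \<alpha>) < wsum \<alpha>"
    using i j by (auto intro: wsum_swap_adj)
  consider "i = j" | "j = Suc i" | "Suc i < j" using \<open>i \<le> j\<close> by linarith
  then show ?thesis
  proof cases
    case 1
    then show ?thesis using IH[OF wi] i j by blast
  next
    case 2
    let ?\<beta> = "swap_adj i (swap_adj (Suc i) (swap_adj i \<alpha>))"
    obtain h where h: "is_atom ?\<beta> h" using is_atom_exists by blast
    have 1: "is_atom (swap_adj (Suc i) (swap_adj i \<alpha>)) (pi_hat i h)"
      by (rule is_atom.ascent) (use i j 2 h in auto)
    have "is_atom (swap_adj i \<alpha>) (pi_hat (Suc i) (pi_hat i h))"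
      by (rule is_atom.ascent) (use i j 2 1 in auto)
    then have f: "f = pi_hat (Suc i) (pi_hat i h)" using IH[OF wi] i by blast
    have h': "is_atom (swap_adj (Suc i) (swap_adj i (swap_adj (Suc i) \<alpha>))) h"
      using h i j 2 by (simp add: swap_adj_braid)
    have 3: "is_atom (swap_adj i (swap_adj (Suc i) \<alpha>)) (pi_hat (Suc i) h)"
      by (rule is_atom.ascent) (use i j 2 h' in auto)
    have "is_atom (swap_adj (Suc i) \<alpha>) (pi_hat i (pi_hat (Suc i) h))"
      by (rule is_atom.ascent) (use i j 2 3 in auto)
    then have g: "g = pi_hat i (pi_hat (Suc i) h)" using IH[OF wj] j 2 by blast
    show ?thesis unfolding f g 2 by (rule pi_hat_braid)
  next
    case 3
    obtain h where h: "is_atom (swap_adj j (swap_adj i \<alpha>)) h" using is_atom_exists by blast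
    have "is_atom (swap_adj i \<alpha>) (pi_hat j h)"
      by (rule is_atom.ascent) (use i j 3 h in auto)
    then have f: "f = pi_hat j h" using IH[OF wi] i by blast
    have h': "is_atom (swap_adj i (swap_adj j \<alpha>)) h" using h swap_adj_commute[OF i(1) 3 j(2)] by simp
    have "is_atom (swap_adj j \<alpha>) (pi_hat i h)"
      by (rule is_atom.ascent) (use i j 3 h' in auto)
    then have g: "g = pi_hat i h" using IH[OF wj] j by blast
    show ?thesis unfolding f g using pi_hat_commute[OF 3] .
  qed
qed

lemma is_atom_unique: "is_atom \<alpha> f \<Longrightarrow> is_atom \<alpha> g \<Longrightarrow> f = g"
proof (induction "wsum \<alpha>" arbitrary: \<alpha> f g rule: less_induct)
  case less
  from less.prems(1) show ?case
  proof (cases rule: is_atom_cases)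
    case 1
    with less.prems(2) show ?thesis
      by (cases rule: is_atom_cases) (auto dest: sorted_wrt_no_ascent)
  next
    case i: (2 i f')
    from less.prems(2) show ?thesis
    proof (cases rule: is_atom_cases)
      case 1
      with i show ?thesis by (auto dest: sorted_wrt_no_ascent)
    next
      case j: (2 j g')
      show ?thesis
      proof (cases "i \<le> j")
        case True
        have "pi_hat i f' = pi_hat j g'"
          by (rule is_atom_confluent[where \<alpha> = \<alpha>]) (fact less.hyps i j True)+
        with i j show ?thesis by simp
      next
        case False
        then have "j \<le> i" by simp
        have "pi_hat j g' = pi_hat i f'"
          by (rule is_atom_confluent[where \<alpha> = \<alpha>]) (fact less.hyps i j \<open>j \<le> i\<close>)+
        with i j show ?thesis by simp
      qed
    qed
  qed
qed

lemma atom_eqI: "is_atom \<alpha> f \<Longrightarrow> atom \<alpha> = f"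
  unfolding atom_def by (blast intro: is_atom_unique)

lemma is_atom_atom: "is_atom \<alpha> (atom \<alpha>)"
  using is_atom_exists atom_eqI by metis

lemma atom_dominant: "sorted_wrt (\<ge>) \<alpha> \<Longrightarrow> atom \<alpha> = x_power \<alpha>"
  by (intro atom_eqI is_atom.dominant)

lemma atom_ascent:
  "1 \<le> i \<Longrightarrow> i < length \<alpha> \<Longrightarrow> \<alpha> ! (i - 1) < \<alpha> ! i \<Longrightarrow> atom \<alpha> = pi_hat i (atom (swap_adj i \<alpha>))"
  by (intro atom_eqI is_atom.ascent is_atom_atom)

lemma atom_induct [case_names dominant ascent]:
  assumes "\<And>\<alpha>. sorted_wrt (\<ge>) \<alpha> \<Longrightarrow> P \<alpha>"
    and "\<And>\<alpha> i. 1 \<le> i \<Longrightarrow> i < length \<alpha> \<Longrightarrow> \<alpha> ! (i - 1) < \<alpha> ! i \<Longrightarrow> P (swap_adj i \<alpha>) \<Longrightarrow> P \<alpha>"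
  shows "P (\<alpha> :: nat list)"
proof (induction "wsum \<alpha>" arbitrary: \<alpha> rule: less_induct)
  case less
  show ?case
    using assms ascent_exists less wsum_swap_adj by metis
qed

lemma exch_x_power:
  assumes "1 \<le> i" "i < length \<alpha>"
  shows "exch i (x_power \<alpha>) = x_power (swap_adj i \<alpha>)"
proof -
  have "exch i (x_power \<alpha>) = (\<Prod>j = 1..length \<alpha>. var (transpose i (Suc i) j) ^ (\<alpha> ! (j - 1)))"
    by (simp add: x_power_def exch_def peval_prod peval_power peval_var_apply)
  also have "\<dots> = (\<Prod>j = 1..length \<alpha>. var j ^ (swap_adj i \<alpha> ! (j - 1)))"
    using assms
    by (intro prod.reindex_bij_witness[of _ "transpose i (Suc i)" "transpose i (Suc i)"])
      (auto simp: transpose_def swap_adj_def nth_list_update)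
  finally show ?thesis by (simp add: x_power_def)
qed

text \<open>A distant ascent j commutes past i. At a neighbouring ascent j, swapping first at j and
  then at i brings the equal pair to place j, and the braid relation moves an operator
  \<open>pi_hat j\<close> inside, where it kills the atom by induction.\<close>

lemma pi_hat_atom_eq:
  assumes "1 \<le> i" "i < length \<alpha>" "\<alpha> ! (i - 1) = \<alpha> ! i"
  shows "pi_hat i (atom \<alpha>) = 0"
  using assms
proof (induction "wsum \<alpha>" arbitrary: \<alpha> i rule: less_induct)
  case less
  show ?case
  proof (cases "sorted_wrt (\<ge>) \<alpha>")
    case True
    then show ?thesis using less.prems by (simp add: atom_dominant pi_hat_eq_0_iff exch_x_power swap_adj_eq)
  next
    case False
    then obtain j where j: "1 \<le> j" "j < length \<alpha>" "\<alpha> ! (j - 1) < \<alpha> ! j" by (rule ascent_exists)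
    let ?b = "swap_adj j \<alpha>"
    have w: "wsum ?b < wsum \<alpha>" using j by (rule wsum_swap_adj)
    have a: "atom \<alpha> = pi_hat j (atom ?b)" using j by (rule atom_ascent)
    consider "Suc i < j" | "Suc j < i" | "j = Suc i" | "i = Suc j" | "i = j" by linarith
    then show ?thesis
    proof cases
      case 1
      then have "pi_hat i (atom ?b) = 0" using less.hyps[OF w] less.prems by auto
      then show ?thesis by (simp add: a pi_hat_commute[OF 1])
    next
      case 2
      then have "pi_hat i (atom ?b) = 0" using less.hyps[OF w] less.prems by auto
      then show ?thesis by (simp add: a pi_hat_commute[OF 2, symmetric])
    next
      case 3
      let ?c = "swap_adj i ?b"
      have asc: "?b ! (i - 1) < ?b ! i" using less.prems j 3 by auto
      have w': "wsum ?c < wsum \<alpha>" using wsum_swap_adj[of i ?b] asc less.prems w by auto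
      have b: "atom ?b = pi_hat i (atom ?c)" using asc less.prems by (intro atom_ascent) auto
      have "pi_hat (Suc i) (atom ?c) = 0" using less.prems j 3 by (intro less.hyps[OF w']) auto
      then show ?thesis unfolding a b by (simp add: 3 pi_hat_braid)
    next
      case 4
      let ?c = "swap_adj i ?b"
      have asc: "?b ! (i - 1) < ?b ! i" using less.prems j 4 by auto
      have w': "wsum ?c < wsum \<alpha>" using wsum_swap_adj[of i ?b] asc less.prems w by auto
      have b: "atom ?b = pi_hat i (atom ?c)" using asc less.prems by (intro atom_ascent) auto
      have "pi_hat j (atom ?c) = 0" using less.prems j 4 by (intro less.hyps[OF w']) auto
      then show ?thesis unfolding a b by (simp add: 4 pi_hat_braid[symmetric])
    next
      case 5
      with j less.prems show ?thesis by simp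
    qed
  qed
qed

lemma pi_op_atom:
  assumes "1 \<le> i" "i < length \<alpha>"
  shows "pi_op i (atom \<alpha>) = (if \<alpha> ! i < \<alpha> ! (i - 1) then atom \<alpha> + atom (swap_adj i \<alpha>)
    else if \<alpha> ! (i - 1) = \<alpha> ! i then atom \<alpha> else 0)"
proof -
  consider "\<alpha> ! i < \<alpha> ! (i - 1)" | "\<alpha> ! (i - 1) = \<alpha> ! i" | "\<alpha> ! (i - 1) < \<alpha> ! i" by linarith
  then show ?thesis
  proof cases
    case 1
    then have "atom (swap_adj i \<alpha>) = pi_hat i (atom \<alpha>)"
      using assms by (subst atom_ascent[of i]) auto
    with 1 show ?thesis by (simp add: pi_op_def)
  next
    case 2
    then show ?thesis using assms by (simp add: pi_op_def pi_hat_atom_eq)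
  next
    case 3
    then show ?thesis using assms by (simp add: atom_ascent[of i] pi_hat_idem)
  qed
qed

section \<open>Sorting two adjacent parts\<close>

definition lower :: "nat \<Rightarrow> nat list \<Rightarrow> nat list" where
  "lower i \<alpha> = (if \<alpha> ! (i - 1) < \<alpha> ! i then swap_adj i \<alpha> else \<alpha>)"

definition upper :: "nat \<Rightarrow> nat list \<Rightarrow> nat list" where
  "upper i \<alpha> = (if \<alpha> ! i < \<alpha> ! (i - 1) then swap_adj i \<alpha> else \<alpha>)"

lemma length_lower [simp]: "length (lower i \<alpha>) = length \<alpha>"
  by (simp add: lower_def)

lemma length_upper [simp]: "length (upper i \<alpha>) = length \<alpha>"
  by (simp add: upper_def)

lemma sum_list_lower: "1 \<le> i \<Longrightarrow> i < length \<alpha> \<Longrightarrow> sum_list (lower i \<alpha>) = sum_list \<alpha>"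
  by (simp add: lower_def sum_list_swap_adj)

text \<open>The summed form of \<open>pi_op_atom\<close>: a strict descent contributes itself and
  its swap, an equal pair only itself, an ascent nothing, so each composition that is sorted into C
  occurs exactly once. The second argument of t is a label that stays attached to the original
  term.\<close>

lemma sum_lower:
  fixes t :: "nat list \<Rightarrow> nat list \<Rightarrow> 'a::comm_monoid_add"
  assumes C: "finite C" "\<And>\<alpha>. \<alpha> \<in> C \<Longrightarrow> length \<alpha> = n" and i: "1 \<le> i" "i < n"
  shows "(\<Sum>\<alpha>\<in>C. if \<alpha> ! i < \<alpha> ! (i - 1) then t \<alpha> \<alpha> + t (swap_adj i \<alpha>) \<alpha>
      else if \<alpha> ! (i - 1) = \<alpha> ! i then t \<alpha> \<alpha> else 0)
    = (\<Sum>\<alpha>\<in>{\<alpha>. length \<alpha> = n \<and> lower i \<alpha> \<in> C}. t \<alpha> (lower i \<alpha>))"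
proof -
  let ?ge = "{\<alpha>\<in>C. \<alpha> ! i \<le> \<alpha> ! (i - 1)}" and ?gt = "{\<alpha>\<in>C. \<alpha> ! i < \<alpha> ! (i - 1)}"
  have "(\<Sum>\<alpha>\<in>C. if \<alpha> ! i < \<alpha> ! (i - 1) then t \<alpha> \<alpha> + t (swap_adj i \<alpha>) \<alpha>
      else if \<alpha> ! (i - 1) = \<alpha> ! i then t \<alpha> \<alpha> else 0)
    = (\<Sum>\<alpha>\<in>C. (if \<alpha> ! i \<le> \<alpha> ! (i - 1) then t \<alpha> \<alpha> else 0)
        + (if \<alpha> ! i < \<alpha> ! (i - 1) then t (swap_adj i \<alpha>) \<alpha> else 0))"
    by (rule sum.cong) auto
  also have "\<dots> = (\<Sum>\<alpha>\<in>?ge. t \<alpha> \<alpha>) + (\<Sum>\<alpha>\<in>?gt. t (swap_adj i \<alpha>) \<alpha>)"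
    using C(1) by (simp add: sum.distrib sum.inter_filter)
  also have "(\<Sum>\<alpha>\<in>?gt. t (swap_adj i \<alpha>) \<alpha>) = (\<Sum>\<alpha>\<in>swap_adj i ` ?gt. t \<alpha> (lower i \<alpha>))"
    using C(2) i by (intro sum.reindex_bij_witness[of _ "swap_adj i" "swap_adj i"]) (auto simp: lower_def)
  also have "(\<Sum>\<alpha>\<in>?ge. t \<alpha> \<alpha>) = (\<Sum>\<alpha>\<in>?ge. t \<alpha> (lower i \<alpha>))"
    by (rule sum.cong) (auto simp: lower_def)
  also have "(\<Sum>\<alpha>\<in>?ge. t \<alpha> (lower i \<alpha>)) + (\<Sum>\<alpha>\<in>swap_adj i ` ?gt. t \<alpha> (lower i \<alpha>))
    = (\<Sum>\<alpha>\<in>?ge \<union> swap_adj i ` ?gt. t \<alpha> (lower i \<alpha>))"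
    using C i by (intro sum.union_disjoint[symmetric]) force+
  also have "?ge \<union> swap_adj i ` ?gt = {\<alpha>. length \<alpha> = n \<and> lower i \<alpha> \<in> C}"
  proof (intro equalityI subsetI)
    fix \<alpha> assume "\<alpha> \<in> ?ge \<union> swap_adj i ` ?gt"
    then show "\<alpha> \<in> {\<alpha>. length \<alpha> = n \<and> lower i \<alpha> \<in> C}"
      using C(2) i by (auto simp: lower_def)
  next
    fix \<alpha> assume a: "\<alpha> \<in> {\<alpha>. length \<alpha> = n \<and> lower i \<alpha> \<in> C}"
    show "\<alpha> \<in> ?ge \<union> swap_adj i ` ?gt"
    proof (cases "\<alpha> ! (i - 1) < \<alpha> ! i")
      case True
      then have "swap_adj i \<alpha> \<in> ?gt" using a i by (auto simp: lower_def)
      moreover have "\<alpha> = swap_adj i (swap_adj i \<alpha>)" using a i by simp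
      ultimately show ?thesis by blast
    qed (use a in \<open>auto simp: lower_def\<close>)
  qed
  finally show ?thesis .
qed

section \<open>Key polynomials\<close>

text \<open>Comparing increasing columns amounts to comparing their counting functions in the
  opposite direction; unlike the entries, the counts change at one place only when two adjacent
  values are exchanged.\<close>

lemma list_all2_le_iff_count:
  fixes xs ys :: "nat list"
  assumes "sorted_wrt (<) xs" "sorted_wrt (<) ys"
  shows "list_all2 (\<le>) xs ys \<longleftrightarrow> length xs = length ys \<and>
    (\<forall>j. length (filter (\<lambda>x. x \<le> j) ys) \<le> length (filter (\<lambda>x. x \<le> j) xs))"
  using assms
proof (induction xs arbitrary: ys)
  case (Cons x xs)
  show ?case
  proof (cases ys)
    case (Cons y ys')
    note IH = Cons.IH[of ys'] and ys = Cons
    have s: "sorted_wrt (<) xs" "sorted_wrt (<) ys'" "\<forall>z\<in>set xs. x < z" "\<forall>z\<in>set ys'. y < z"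
      using Cons.prems ys by auto
    let ?c = "\<lambda>j zs. length (filter (\<lambda>x. x \<le> j) (zs :: nat list))"
    have lo: "?c j ys' = 0" if "j < y" for j using s(4) that by (auto simp: filter_empty_conv)
    show ?thesis
    proof
      assume "list_all2 (\<le>) (x # xs) ys"
      then have le: "x \<le> y" and a: "list_all2 (\<le>) xs ys'" using ys by auto
      with IH s have "length xs = length ys'" "\<And>j. ?c j ys' \<le> ?c j xs" by auto
      then show "length (x # xs) = length ys \<and> (\<forall>j. ?c j ys \<le> ?c j (x # xs))"
        using le ys by (auto intro: le_SucI)
    next
      assume a: "length (x # xs) = length ys \<and> (\<forall>j. ?c j ys \<le> ?c j (x # xs))"
      have le: "x \<le> y"
      proof (rule ccontr)
        assume "\<not> x \<le> y"
        then have "filter (\<lambda>z. z \<le> y) (x # xs) = []" using s(3) by (auto simp: filter_empty_conv)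
        moreover have "?c y ys \<le> ?c y (x # xs)" using a by blast
        ultimately show False using ys by simp
      qed
      have "?c j ys' \<le> ?c j xs" for j
      proof (cases "j < y")
        case False
        have "?c j ys \<le> ?c j (x # xs)" using a by blast
        with False le ys show ?thesis by simp
      qed (simp add: lo)
      then show "list_all2 (\<le>) (x # xs) ys" using IH s a ys le by auto
    qed
  qed simp
qed auto

definition col :: "nat list \<Rightarrow> nat \<Rightarrow> nat set" where
  "col \<alpha> r = {i \<in> {1..length \<alpha>}. r \<le> \<alpha> ! (i - 1)}"

definition cnt :: "nat list \<Rightarrow> nat \<Rightarrow> nat \<Rightarrow> nat" where
  "cnt \<alpha> r j = card {i \<in> col \<alpha> r. i \<le> j}"

abbreviation max_part :: "nat list \<Rightarrow> nat" where
  "max_part \<alpha> \<equiv> Max (insert 0 (set \<alpha>))"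

lemma finite_col [simp]: "finite (col \<alpha> r)"
  by (simp add: col_def)

lemma col_empty_iff: "1 \<le> r \<Longrightarrow> col \<alpha> r = {} \<longleftrightarrow> max_part \<alpha> < r"
proof -
  assume r: "1 \<le> r"
  have "col \<alpha> r = {} \<longleftrightarrow> (\<forall>a\<in>set \<alpha>. a < r)"
  proof
    assume e: "col \<alpha> r = {}"
    show "\<forall>a\<in>set \<alpha>. a < r"
    proof (rule ballI)
      fix a assume "a \<in> set \<alpha>"
      then obtain i where "i < length \<alpha>" "a = \<alpha> ! i" by (auto simp: in_set_conv_nth)
      moreover have "Suc i \<notin> col \<alpha> r" using e by simp
      ultimately show "a < r" by (auto simp: col_def)
    qed
  next
    assume a: "\<forall>a\<in>set \<alpha>. a < r"
    have "i \<notin> col \<alpha> r" for i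
    proof
      assume i: "i \<in> col \<alpha> r"
      then have "\<alpha> ! (i - 1) \<in> set \<alpha>" by (intro nth_mem) (auto simp: col_def)
      with a i show False by (auto simp: col_def)
    qed
    then show "col \<alpha> r = {}" by blast
  qed
  with r show ?thesis by auto
qed

lemma key_tab_col: "key_tab \<alpha> = map (\<lambda>r. sorted_list_of_set (col \<alpha> r)) [1..<Suc (max_part \<alpha>)]"
  by (simp add: key_tab_def col_def)

lemma length_filter_sorted_list_of_set:
  "finite A \<Longrightarrow> length (filter P (sorted_list_of_set A)) = card {x \<in> A. P x}"
  using distinct_card[of "filter P (sorted_list_of_set A)"] by simp

lemma tab_le_iff:
  assumes "length \<gamma> = length \<beta>"
  shows "tab_le (key_tab \<gamma>) (key_tab \<beta>) \<longleftrightarrow>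
    (\<forall>r\<ge>1. card (col \<gamma> r) = card (col \<beta> r)) \<and> (\<forall>r\<ge>1. \<forall>j. cnt \<beta> r j \<le> cnt \<gamma> r j)"
proof -
  have all2: "list_all2 (\<le>) (sorted_list_of_set (col \<gamma> r)) (sorted_list_of_set (col \<beta> r)) \<longleftrightarrow>
      card (col \<gamma> r) = card (col \<beta> r) \<and> (\<forall>j. cnt \<beta> r j \<le> cnt \<gamma> r j)" for r
    by (subst list_all2_le_iff_count) (auto simp: length_filter_sorted_list_of_set cnt_def)
  have "tab_le (key_tab \<gamma>) (key_tab \<beta>) \<longleftrightarrow> max_part \<gamma> = max_part \<beta> \<and> (\<forall>r\<in>{1..max_part \<beta>}.
      list_all2 (\<le>) (sorted_list_of_set (col \<gamma> r)) (sorted_list_of_set (col \<beta> r)))"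
  proof (cases "max_part \<gamma> = max_part \<beta>")
    case True
    then show ?thesis
      unfolding tab_le_def key_tab_col list_all2_map1 list_all2_map2 True list_all2_same
      by (auto simp: less_Suc_eq_le simp del: upt_Suc)
  next
    case False
    then have "length (key_tab \<gamma>) \<noteq> length (key_tab \<beta>)" by (simp add: key_tab_col)
    then show ?thesis using False by (auto simp: tab_le_def dest: list_all2_lengthD)
  qed
  also have "\<dots> \<longleftrightarrow> (\<forall>r\<ge>1. card (col \<gamma> r) = card (col \<beta> r)) \<and> (\<forall>r\<ge>1. \<forall>j. cnt \<beta> r j \<le> cnt \<gamma> r j)"
    (is "?L \<longleftrightarrow> ?R")
  proof
    assume L: ?L
    have "card (col \<gamma> r) = card (col \<beta> r) \<and> (\<forall>j. cnt \<beta> r j \<le> cnt \<gamma> r j)" if "1 \<le> r" for r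
    proof (cases "r \<le> max_part \<beta>")
      case True
      then show ?thesis using L all2 that by auto
    next
      case False
      then have "max_part \<gamma> < r" "max_part \<beta> < r" using L by linarith+
      then have "col \<gamma> r = {}" "col \<beta> r = {}" using that col_empty_iff by blast+
      then show ?thesis by (simp add: cnt_def)
    qed
    then show ?R by blast
  next
    assume R: ?R
    have "max_part \<gamma> < r \<longleftrightarrow> max_part \<beta> < r" if "1 \<le> r" for r
      using R that by (metis col_empty_iff card_0_eq finite_col)
    from this[of "Suc (max_part \<gamma>)"] this[of "Suc (max_part \<beta>)"] have "max_part \<gamma> = max_part \<beta>"
      by linarith
    with R show ?L by (auto simp: all2)
  qed
  finally show ?thesis .
qed

lemma col_swap_adj:
  assumes "1 \<le> i" "i < length \<alpha>"
  shows "col (swap_adj i \<alpha>) r = transpose i (Suc i) ` col \<alpha> r"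
proof -
  have "j \<in> col (swap_adj i \<alpha>) r \<longleftrightarrow> transpose i (Suc i) j \<in> col \<alpha> r" for j
    using assms by (auto simp: col_def swap_adj_def nth_list_update transpose_def)
  then show ?thesis by (simp add: set_eq_iff in_transpose_image_iff)
qed

lemma card_col_swap_adj:
  assumes "1 \<le> i" "i < length \<alpha>"
  shows "card (col (swap_adj i \<alpha>) r) = card (col \<alpha> r)"
  using assms by (simp add: col_swap_adj card_image)

lemma cnt_swap_adj_other:
  assumes "1 \<le> i" "i < length \<alpha>" "j \<noteq> i"
  shows "cnt (swap_adj i \<alpha>) r j = cnt \<alpha> r j"
proof -
  have "{x \<in> col (swap_adj i \<alpha>) r. x \<le> j} = transpose i (Suc i) ` {x \<in> col \<alpha> r. x \<le> j}"
    using assms by (auto simp: col_swap_adj transpose_def split: if_splits)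
  then show ?thesis by (simp add: cnt_def card_image)
qed

lemma cnt_Suc: "cnt \<alpha> r (Suc j) = cnt \<alpha> r j + (if Suc j \<in> col \<alpha> r then 1 else 0)"
proof -
  have "{x \<in> col \<alpha> r. x \<le> Suc j} = (if Suc j \<in> col \<alpha> r then insert (Suc j) else id) {x \<in> col \<alpha> r. x \<le> j}"
    by (auto simp: le_Suc_eq)
  then show ?thesis by (auto simp: cnt_def)
qed

text \<open>A descent at \<open>i\<close> maximises the number of entries at most \<open>i\<close> in each column among the two
  compositions obtained by exchanging \<open>i\<close> and \<open>i + 1\<close>, an ascent minimises it.\<close>

lemma cnt_descent:
  assumes "1 \<le> i" "i < length \<alpha>" "\<alpha> ! i \<le> \<alpha> ! (i - 1)"
  shows "cnt \<alpha> r i = min (cnt \<alpha> r (i - 1) + 1) (cnt \<alpha> r (Suc i))"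
proof -
  have "Suc i \<in> col \<alpha> r \<longrightarrow> i \<in> col \<alpha> r" using assms by (auto simp: col_def)
  moreover have "cnt \<alpha> r i = cnt \<alpha> r (i - 1) + (if i \<in> col \<alpha> r then 1 else 0)"
    using cnt_Suc[of \<alpha> r "i - 1"] assms by simp
  ultimately show ?thesis using cnt_Suc[of \<alpha> r i] by auto
qed

lemma cnt_ascent:
  assumes "1 \<le> i" "i < length \<alpha>" "\<alpha> ! (i - 1) \<le> \<alpha> ! i"
  shows "cnt \<alpha> r i = max (cnt \<alpha> r (i - 1)) (cnt \<alpha> r (Suc i) - 1)"
proof -
  have "i \<in> col \<alpha> r \<longrightarrow> Suc i \<in> col \<alpha> r" using assms by (auto simp: col_def)
  moreover have "cnt \<alpha> r i = cnt \<alpha> r (i - 1) + (if i \<in> col \<alpha> r then 1 else 0)"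
    using cnt_Suc[of \<alpha> r "i - 1"] assms by simp
  ultimately show ?thesis using cnt_Suc[of \<alpha> r i] by auto
qed

text \<open>The index set of the expansion of a key polynomial into atoms, see
  \<open>key_poly_Low\<close>.\<close>

definition Low :: "nat list \<Rightarrow> nat list set" where
  "Low \<beta> = {\<gamma>. length \<gamma> = length \<beta> \<and> tab_le (key_tab \<gamma>) (key_tab \<beta>)}"

lemma Low_iff:
  "\<gamma> \<in> Low \<beta> \<longleftrightarrow> length \<gamma> = length \<beta> \<and>
    (\<forall>r\<ge>1. card (col \<gamma> r) = card (col \<beta> r)) \<and> (\<forall>r\<ge>1. \<forall>j. cnt \<beta> r j \<le> cnt \<gamma> r j)"
  unfolding Low_def using tab_le_iff by auto

text \<open>Apart from equal column lengths, both sides say that the counts of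
  \<open>\<beta>\<close> are at most those of \<open>\<gamma>\<close> at all places other than i.
  The inequality at i is then automatic: given the neighbouring counts, the count at i is as large
  as possible for \<open>lower i \<gamma>\<close> and as small as possible for
  \<open>upper i \<beta>\<close>.\<close>

lemma lower_Low_iff:
  assumes i: "1 \<le> i" "i < length \<beta>" and len: "length \<gamma> = length \<beta>"
  shows "lower i \<gamma> \<in> Low \<beta> \<longleftrightarrow> \<gamma> \<in> Low (upper i \<beta>)"
proof -
  let ?l = "lower i \<gamma>" and ?u = "upper i \<beta>"
  have cl: "cnt ?l r j = cnt \<gamma> r j" if "j \<noteq> i" for r j
    using i len that by (simp add: lower_def cnt_swap_adj_other)
  have cu: "cnt ?u r j = cnt \<beta> r j" if "j \<noteq> i" for r j
    using i that by (simp add: upper_def cnt_swap_adj_other)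
  have "cnt ?l r i = min (cnt ?l r (i - 1) + 1) (cnt ?l r (Suc i))" for r
    using i len by (intro cnt_descent) (auto simp: lower_def)
  then have li: "cnt ?l r i = min (cnt \<gamma> r (i - 1) + 1) (cnt \<gamma> r (Suc i))" for r
    using i by (simp add: cl)
  have "cnt ?u r i = max (cnt ?u r (i - 1)) (cnt ?u r (Suc i) - 1)" for r
    using i by (intro cnt_ascent) (auto simp: upper_def)
  then have ui: "cnt ?u r i = max (cnt \<beta> r (i - 1)) (cnt \<beta> r (Suc i) - 1)" for r
    using i by (simp add: cu)
  have m: "cnt \<alpha> r i \<le> cnt \<alpha> r (Suc i)" "cnt \<alpha> r (Suc i) \<le> cnt \<alpha> r i + 1"
     "cnt \<alpha> r (i - 1) \<le> cnt \<alpha> r i" "cnt \<alpha> r i \<le> cnt \<alpha> r (i - 1) + 1" for \<alpha> r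
    using cnt_Suc[of \<alpha> r i] cnt_Suc[of \<alpha> r "i - 1"] i by auto
  have "(\<forall>j. cnt \<beta> r j \<le> cnt ?l r j) \<longleftrightarrow> (\<forall>j. j \<noteq> i \<longrightarrow> cnt \<beta> r j \<le> cnt \<gamma> r j)" for r
  proof
    assume a: "\<forall>j. j \<noteq> i \<longrightarrow> cnt \<beta> r j \<le> cnt \<gamma> r j"
    show "\<forall>j. cnt \<beta> r j \<le> cnt ?l r j"
    proof
      fix j
      show "cnt \<beta> r j \<le> cnt ?l r j"
      proof (cases "j = i")
        case True
        have "cnt \<beta> r (i - 1) \<le> cnt \<gamma> r (i - 1)" "cnt \<beta> r (Suc i) \<le> cnt \<gamma> r (Suc i)" using a i by auto
        then show ?thesis using m[of \<beta> r] unfolding True li by linarith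
      qed (use a cl in auto)
    qed
  qed (metis cl)
  moreover have "(\<forall>j. cnt ?u r j \<le> cnt \<gamma> r j) \<longleftrightarrow> (\<forall>j. j \<noteq> i \<longrightarrow> cnt \<beta> r j \<le> cnt \<gamma> r j)" for r
  proof
    assume a: "\<forall>j. j \<noteq> i \<longrightarrow> cnt \<beta> r j \<le> cnt \<gamma> r j"
    show "\<forall>j. cnt ?u r j \<le> cnt \<gamma> r j"
    proof
      fix j
      show "cnt ?u r j \<le> cnt \<gamma> r j"
      proof (cases "j = i")
        case True
        have "cnt \<beta> r (i - 1) \<le> cnt \<gamma> r (i - 1)" "cnt \<beta> r (Suc i) \<le> cnt \<gamma> r (Suc i)" using a i by auto
        then show ?thesis using m[of \<gamma> r] unfolding True ui by linarith
      qed (use a cu in auto)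
    qed
  qed (metis cu)
  moreover have "card (col ?l r) = card (col \<gamma> r)" "card (col ?u r) = card (col \<beta> r)" for r
    using i len by (auto simp: lower_def upper_def card_col_swap_adj)
  ultimately show ?thesis using len by (simp add: Low_iff)
qed

lemma nth_eq_card_col:
  assumes "i \<in> {1..length \<alpha>}"
  shows "\<alpha> ! (i - 1) = card {r. 1 \<le> r \<and> i \<in> col \<alpha> r}"
proof -
  have "{r. 1 \<le> r \<and> i \<in> col \<alpha> r} = {1..\<alpha> ! (i - 1)}" using assms by (auto simp: col_def)
  then show ?thesis by simp
qed

lemma col_inject:
  assumes "length \<alpha> = length \<beta>" "\<And>r. 1 \<le> r \<Longrightarrow> col \<alpha> r = col \<beta> r"
  shows "\<alpha> = \<beta>"
proof (rule nth_equalityI)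
  fix i assume "i < length \<alpha>"
  then have "\<alpha> ! (Suc i - 1) = \<beta> ! (Suc i - 1)"
    using assms by (subst (1 2) nth_eq_card_col) (auto intro!: arg_cong[where f = card])
  then show "\<alpha> ! i = \<beta> ! i" by simp
qed fact

lemma cnt_inject:
  assumes "length \<alpha> = length \<beta>" "\<And>r j. 1 \<le> r \<Longrightarrow> cnt \<alpha> r j = cnt \<beta> r j"
  shows "\<alpha> = \<beta>"
proof (rule col_inject)
  fix r :: nat assume r: "1 \<le> r"
  have "i \<in> col \<alpha> r \<longleftrightarrow> i \<in> col \<beta> r" if "i \<noteq> 0" for i
  proof -
    obtain k where k: "i = Suc k" using \<open>i \<noteq> 0\<close> by (cases i) auto
    have "(if i \<in> col \<alpha> r then 1 else 0) = (if i \<in> col \<beta> r then 1 else (0::nat))"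
      using assms(2)[OF r, of k] assms(2)[OF r, of i] cnt_Suc[of \<alpha> r k] cnt_Suc[of \<beta> r k]
      unfolding k by linarith
    then show ?thesis by (simp split: if_splits)
  qed
  moreover have "0 \<notin> col \<alpha> r" "0 \<notin> col \<beta> r" by (auto simp: col_def)
  ultimately show "col \<alpha> r = col \<beta> r" by (metis subsetI subset_antisym)
qed fact

lemma cnt_le: "cnt \<alpha> r j \<le> j" "cnt \<alpha> r j \<le> card (col \<alpha> r)"
proof -
  have "{i \<in> col \<alpha> r. i \<le> j} \<subseteq> {1..j}" by (auto simp: col_def)
  from card_mono[OF _ this] show "cnt \<alpha> r j \<le> j" by (simp add: cnt_def)
  show "cnt \<alpha> r j \<le> card (col \<alpha> r)" unfolding cnt_def by (rule card_mono) auto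
qed

text \<open>The parts of size at least r fill an initial segment, so both bounds of
  \<open>cnt_le\<close> are as sharp as they can be; hence nothing else lies below a dominant
  composition.\<close>

lemma cnt_dominant:
  assumes "sorted_wrt (\<ge>) \<alpha>"
  shows "cnt \<alpha> r j = min j (card (col \<alpha> r))"
proof (induction j)
  case 0
  have "{i \<in> col \<alpha> r. i \<le> 0} = {}" by (auto simp: col_def)
  then show ?case by (simp add: cnt_def)
next
  case (Suc j)
  show ?case
  proof (cases "Suc j \<in> col \<alpha> r")
    case True
    have "i \<in> col \<alpha> r" if "i \<in> {1..Suc j}" for i
    proof -
      have "\<alpha> ! j \<le> \<alpha> ! (i - 1)"
        using sorted_wrt_nth_less[OF assms, of "i - 1" j] that True
        by (cases "i - 1 = j") (auto simp: col_def)
      then show ?thesis using that True by (auto simp: col_def)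
    qed
    then have "{1..Suc j} \<subseteq> col \<alpha> r" by blast
    from card_mono[OF finite_col this] have "Suc j \<le> card (col \<alpha> r)" by simp
    then show ?thesis using Suc True by (simp add: cnt_Suc)
  next
    case False
    have "col \<alpha> r = {i \<in> col \<alpha> r. i \<le> j}"
    proof (intro equalityI subsetI CollectI conjI)
      fix i assume i: "i \<in> col \<alpha> r"
      show "i \<le> j"
      proof (rule ccontr)
        assume "\<not> i \<le> j"
        then have "\<alpha> ! (i - 1) \<le> \<alpha> ! j" 
          using sorted_wrt_nth_less[OF assms, of j "i - 1"] i
          by (cases "j = i - 1") (auto simp: col_def)
        then show False using i False \<open>\<not> i \<le> j\<close> by (auto simp: col_def)
      qed
    qed auto
    then have "card (col \<alpha> r) = cnt \<alpha> r j" by (simp add: cnt_def)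
    then show ?thesis using Suc False cnt_le(1)[of \<alpha> r j] by (simp add: cnt_Suc)
  qed
qed

lemma Low_dominant:
  assumes "sorted_wrt (\<ge>) \<alpha>"
  shows "Low \<alpha> = {\<alpha>}"
proof (intro equalityI subsetI)
  fix \<gamma> assume "\<gamma> \<in> Low \<alpha>"
  then have g: "length \<gamma> = length \<alpha>" "\<And>r. 1 \<le> r \<Longrightarrow> card (col \<gamma> r) = card (col \<alpha> r)"
      "\<And>r j. 1 \<le> r \<Longrightarrow> cnt \<alpha> r j \<le> cnt \<gamma> r j" by (auto simp: Low_iff)
  have "\<gamma> = \<alpha>"
  proof (rule cnt_inject[OF g(1)])
    fix r j :: nat assume r: "1 \<le> r"
    show "cnt \<gamma> r j = cnt \<alpha> r j"
      using g(3)[OF r, of j] g(2)[OF r] cnt_le[of \<gamma> r j] unfolding cnt_dominant[OF assms] by simp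
  qed
  then show "\<gamma> \<in> {\<alpha>}" by simp
qed (simp add: Low_iff)

lemma finite_Low: "finite (Low \<beta>)"
proof -
  have "\<gamma> \<in> {xs. set xs \<subseteq> {..max_part \<beta>} \<and> length xs = length \<beta>}" if "\<gamma> \<in> Low \<beta>" for \<gamma>
  proof -
    from that have g: "length \<gamma> = length \<beta>" "\<And>r. 1 \<le> r \<Longrightarrow> card (col \<gamma> r) = card (col \<beta> r)"
      by (auto simp: Low_iff)
    have "col \<beta> (Suc (max_part \<beta>)) = {}" by (simp add: col_empty_iff del: Max_insert)
    then have "col \<gamma> (Suc (max_part \<beta>)) = {}" using g(2)[of "Suc (max_part \<beta>)"] by (simp del: Max_insert)
    then have "max_part \<gamma> \<le> max_part \<beta>" by (simp add: col_empty_iff less_Suc_eq_le del: Max_insert)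
    then show ?thesis using g(1) Max_ge[of "insert 0 (set \<gamma>)"] by force
  qed
  then show ?thesis using finite_lists_length_eq[of "{..max_part \<beta>}" "length \<beta>"]
    by (meson finite_atMost finite_subset subsetI)
qed

lemma pi_op_Low:
  assumes "1 \<le> i" "i < length \<beta>"
  shows "pi_op i (\<Sum>\<gamma>\<in>Low \<beta>. atom \<gamma>) = (\<Sum>\<gamma>\<in>Low (upper i \<beta>). atom \<gamma>)"
proof -
  have "pi_op i (\<Sum>\<gamma>\<in>Low \<beta>. atom \<gamma>) = (\<Sum>\<gamma>\<in>Low \<beta>. if \<gamma> ! i < \<gamma> ! (i - 1) then atom \<gamma> + atom (swap_adj i \<gamma>)
    else if \<gamma> ! (i - 1) = \<gamma> ! i then atom \<gamma> else 0)"
    unfolding pi_op_sum using assms by (intro sum.cong pi_op_atom) (auto simp: Low_iff)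
  also have "\<dots> = (\<Sum>\<gamma>\<in>{\<gamma>. length \<gamma> = length \<beta> \<and> lower i \<gamma> \<in> Low \<beta>}. atom \<gamma>)"
    using assms by (intro sum_lower[where t = "\<lambda>\<gamma> _. atom \<gamma>"] finite_Low) (auto simp: Low_iff)
  also have "{\<gamma>. length \<gamma> = length \<beta> \<and> lower i \<gamma> \<in> Low \<beta>} = Low (upper i \<beta>)"
    using assms lower_Low_iff by (auto simp: Low_iff[of _ "upper i \<beta>"])
  finally show ?thesis .
qed

text \<open>The sum on the right does not involve the chosen ascents, so this also shows that the
  recursion for key polynomials is well defined.\<close>

lemma is_key_poly_Low: "is_key_poly \<beta> f \<Longrightarrow> f = (\<Sum>\<gamma>\<in>Low \<beta>. atom \<gamma>)"
proof (induction rule: is_key_poly.induct)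
  case (dominant \<alpha>)
  then show ?case by (simp add: Low_dominant atom_dominant)
next
  case (ascent i \<alpha> f)
  have "upper i (swap_adj i \<alpha>) = \<alpha>" using ascent by (simp add: upper_def)
  with ascent pi_op_Low[of i "swap_adj i \<alpha>"] show ?case by simp
qed

lemma is_key_poly_exists: "\<exists>f. is_key_poly \<alpha> f"
  by (induction \<alpha> rule: atom_induct) (blast intro: is_key_poly.intros)+

lemma key_poly_eqI: "is_key_poly \<beta> f \<Longrightarrow> key_poly \<beta> = f"
  unfolding key_poly_def using is_key_poly_Low by (intro the_equality) metis+

lemma is_key_poly_key_poly: "is_key_poly \<beta> (key_poly \<beta>)"
  using is_key_poly_exists key_poly_eqI by metis

lemma key_poly_Low: "key_poly \<beta> = (\<Sum>\<gamma>\<in>Low \<beta>. atom \<gamma>)"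
  by (intro is_key_poly_Low is_key_poly_key_poly)

lemma key_poly_dominant: "sorted_wrt (\<ge>) \<beta> \<Longrightarrow> key_poly \<beta> = x_power \<beta>"
  by (intro key_poly_eqI is_key_poly.dominant)

lemma pi_op_key_poly:
  "1 \<le> i \<Longrightarrow> i < length \<beta> \<Longrightarrow> pi_op i (key_poly \<beta>) = key_poly (upper i \<beta>)"
  by (simp add: key_poly_Low pi_op_Low)

section \<open>Series in two sets of variables\<close>

text \<open>Stated for an arbitrary injection so as to serve the embeddings of both sets of
  variables.\<close>

lemma peval_var_exch:
  assumes "inj \<iota>"
  shows "peval (\<lambda>v. mfps_var (\<iota> v)) (exch i f) = vswap (\<iota> i) (\<iota> (Suc i)) (peval (\<lambda>v. mfps_var (\<iota> v)) f)"
proof -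
  have "vswap (\<iota> i) (\<iota> (Suc i)) (peval (\<lambda>v. mfps_var (\<iota> v)) f)
      = peval (\<lambda>v. vswap (\<iota> i) (\<iota> (Suc i)) (mfps_var (\<iota> v))) f"
    by (rule hom_peval) (simp_all add: vswap_simps)
  also have "(\<lambda>v. vswap (\<iota> i) (\<iota> (Suc i)) (mfps_var (\<iota> v))) = (\<lambda>v. mfps_var (\<iota> (transpose i (Suc i) v)))"
    using assms by (auto simp: vswap_var transpose_def inj_eq)
  finally show ?thesis by (simp add: exch_def peval_peval peval_var_apply)
qed

lemma in_x_exch: "in_x (exch i f) = vswap (Inl i) (Inl (Suc i)) (in_x f)"
  by (rule peval_var_exch) simp

lemma in_y_exch: "in_y (exch i f) = vswap (Inr i) (Inr (Suc i)) (in_y f)"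
  by (rule peval_var_exch) simp

lemma vswap_x_in_y: "vswap (Inl i) (Inl j) (in_y f) = in_y f"
proof -
  have "vswap (Inl i) (Inl j) (in_y f) = peval (\<lambda>v. vswap (Inl i) (Inl j) (y_var v)) f"
    by (rule hom_peval) (simp_all add: vswap_simps)
  then show ?thesis by (simp add: vswap_var transpose_def)
qed

lemma vswap_y_in_x: "vswap (Inr i) (Inr j) (in_x f) = in_x f"
proof -
  have "vswap (Inr i) (Inr j) (in_x f) = peval (\<lambda>v. vswap (Inr i) (Inr j) (x_var v)) f"
    by (rule hom_peval) (simp_all add: vswap_simps)
  then show ?thesis by (simp add: vswap_var transpose_def)
qed

lemma pi_rel_in_x: "pi_rel (Inl i) (Inl (Suc i)) (in_x f) (in_x (pi_op i f))"
  using arg_cong[OF pi_op_eq[of i f], of in_x] by (simp add: pi_rel_def peval_simps in_x_exch)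

lemma pi_rel_in_y: "pi_rel (Inr i) (Inr (Suc i)) (in_y f) (in_y (pi_op i f))"
  using arg_cong[OF pi_op_eq[of i f], of in_y] by (simp add: pi_rel_def peval_simps in_y_exch)

lemma pi_rel_x_term: "pi_rel (Inl i) (Inl (Suc i)) (in_x f * in_y g) (in_x (pi_op i f) * in_y g)"
  by (intro pi_rel_mult pi_rel_in_x vswap_x_in_y)

lemma pi_rel_y_term: "pi_rel (Inr i) (Inr (Suc i)) (in_x f * in_y g) (in_x f * in_y (pi_op i g))"
  using pi_rel_mult[OF vswap_y_in_x pi_rel_in_y] by (simp add: mult.commute)

section \<open>Series in a restricted set of variables\<close>

definition only_vars :: "'v set \<Rightarrow> 'v mfps \<Rightarrow> bool" where
  "only_vars X f \<longleftrightarrow> (\<forall>m. mfps_coeff f m \<noteq> 0 \<longrightarrow> keys m \<subseteq> X)"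

lemma only_vars_0 [simp]: "only_vars X 0" by (simp add: only_vars_def)
lemma only_vars_1 [simp]: "only_vars X 1" by (simp add: only_vars_def mfps_coeff_1)
lemma only_vars_var [simp]: "v \<in> X \<Longrightarrow> only_vars X (mfps_var v)"
  by (simp add: only_vars_def mfps_coeff_var)
lemma only_vars_add: "only_vars X f \<Longrightarrow> only_vars X g \<Longrightarrow> only_vars X (f + g)"
  by (force simp: only_vars_def)
lemma only_vars_diff: "only_vars X f \<Longrightarrow> only_vars X g \<Longrightarrow> only_vars X (f - g)"
  by (force simp: only_vars_def)
lemma only_vars_mult: "only_vars X f \<Longrightarrow> only_vars X g \<Longrightarrow> only_vars X (f * g)"
proof -
  assume f: "only_vars X f" and g: "only_vars X g"
  have "keys m \<subseteq> X" if "mfps_coeff (f * g) m \<noteq> 0" for m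
  proof -
    from that obtain a b where "m = a + b" "mfps_coeff f a \<noteq> 0" "mfps_coeff g b \<noteq> 0"
      by (rule mfps_coeff_mult_nonzero)
    then show ?thesis using f g keys_add[of a b] unfolding only_vars_def by blast
  qed
  then show ?thesis by (simp add: only_vars_def)
qed
lemma only_vars_sum: "(\<And>a. a \<in> A \<Longrightarrow> only_vars X (f a)) \<Longrightarrow> only_vars X (sum f A)"
  by (induction A rule: infinite_finite_induct) (auto simp: only_vars_add)
lemma only_vars_prod: "(\<And>a. a \<in> A \<Longrightarrow> only_vars X (f a)) \<Longrightarrow> only_vars X (prod f A)"
  by (induction A rule: infinite_finite_induct) (auto simp: only_vars_mult)
lemma only_vars_power: "only_vars X f \<Longrightarrow> only_vars X (f ^ k)"
  by (induction k) (auto simp: only_vars_mult)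
lemma only_vars_of_int: "only_vars X (of_int k)"
proof -
  have n: "only_vars X (of_nat k)" for k by (induction k) (auto simp: only_vars_add)
  then show ?thesis using only_vars_diff[OF only_vars_0 n] by (cases k rule: int_cases2) auto
qed
lemma only_vars_peval: "(\<And>v. only_vars X (\<xi> v)) \<Longrightarrow> only_vars X (peval \<xi> p)"
  unfolding peval_def by (intro only_vars_sum only_vars_mult only_vars_of_int only_vars_prod only_vars_power)

text \<open>With separated variables the exponent p + q splits between the two factors in one way
  only.\<close>

lemma coeff_mult_disjoint:
  assumes "only_vars X f" "only_vars Y g" "X \<inter> Y = {}" "keys p \<subseteq> X" "keys q \<subseteq> Y"
  shows "mfps_coeff (f * g) (p + q) = mfps_coeff f p * mfps_coeff g q"
proof -
  have "a = p \<and> b = q" if "a + b = p + q" "mfps_coeff f a \<noteq> 0" "mfps_coeff g b \<noteq> 0" for a b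
  proof -
    have k: "keys a \<subseteq> X" "keys b \<subseteq> Y"
      using that assms by (auto simp: only_vars_def)
    have "lookup a v = lookup p v \<and> lookup b v = lookup q v" for v
    proof -
      have s: "lookup a v + lookup b v = lookup p v + lookup q v"
        using arg_cong[OF that(1), of "\<lambda>m. lookup m v"] by (simp add: lookup_add)
      have x: "v \<notin> X \<Longrightarrow> lookup a v = 0 \<and> lookup p v = 0"
        using k assms by (auto simp: in_keys_iff subset_iff)
      have y: "v \<notin> Y \<Longrightarrow> lookup b v = 0 \<and> lookup q v = 0"
        using k assms by (auto simp: in_keys_iff subset_iff)
      have "v \<notin> X \<or> v \<notin> Y" using assms(3) by blast
      then show ?thesis using s x y by auto
    qed
    then show ?thesis by (auto intro: poly_mapping_eqI)
  qed
  then have "mfps_coeff (f * g) (p + q) = (\<Sum>(a, b)\<in>{(p, q)}. mfps_coeff f a * mfps_coeff g b)"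
    unfolding mfps_coeff_mult by (intro sum.mono_neutral_right finite_mon_decomp) auto
  then show ?thesis by simp
qed

lemma poly_mapping_split:
  fixes e :: "'a + 'b \<Rightarrow>\<^sub>0 nat"
  obtains p q where "e = p + q" "keys p \<subseteq> range Inl" "keys q \<subseteq> range Inr"
proof -
  let ?s = "\<lambda>A. \<Sum>v\<in>A. single v (lookup e v)"
  let ?K = "keys e"
  have l: "lookup (?s A) w = (if w \<in> A then lookup e w else 0)" if "finite A" for A w
    using that by (simp add: lookup_sum lookup_single when_def)
  have "e = ?s (?K \<inter> range Inl) + ?s (?K \<inter> range Inr)"
  proof (rule poly_mapping_eqI)
    fix w show "lookup e w = lookup (?s (?K \<inter> range Inl) + ?s (?K \<inter> range Inr)) w"
      by (cases w) (auto simp: lookup_add l in_keys_iff)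
  qed
  moreover have "keys (?s (?K \<inter> range Inl)) \<subseteq> range Inl"
    "keys (?s (?K \<inter> range Inr)) \<subseteq> range Inr"
    by (auto simp: in_keys_iff l split: if_splits)
  ultimately show ?thesis by (rule that)
qed

section \<open>Grading by the degree in the variables x\<close>

definition xdeg :: "('a + 'b \<Rightarrow>\<^sub>0 nat) \<Rightarrow> nat" where
  "xdeg m = (\<Sum>v\<in>keys m. if isl v then lookup m v else 0)"

lemma xdeg_superset:
  assumes "finite U" "keys m \<subseteq> U"
  shows "xdeg m = (\<Sum>v\<in>U. if isl v then lookup m v else 0)"
  unfolding xdeg_def using assms
  by (intro sum.mono_neutral_left) (auto simp: in_keys_iff)

lemma xdeg_add: "xdeg (a + b) = xdeg a + xdeg b"
proof -
  let ?U = "keys a \<union> keys b"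
  have "keys (a + b) \<subseteq> ?U" by (rule keys_add)
  then show ?thesis
    by (subst (1 2 3) xdeg_superset[of ?U])
      (auto simp: lookup_add sum.distrib[symmetric] intro!: sum.cong)
qed

lemma xdeg_single: "xdeg (single v k) = (if isl v then k else 0)"
  by (subst xdeg_superset[of "{v}"]) auto

lemma xdeg_0 [simp]: "xdeg 0 = 0"
  by (simp add: xdeg_def)

lemma xdeg_sum: "xdeg (sum f A) = (\<Sum>a\<in>A. xdeg (f a))"
  by (induction A rule: infinite_finite_induct) (auto simp: xdeg_add)

lemma xdeg_map_key:
  assumes "isl u \<longleftrightarrow> isl v"
  shows "xdeg (map_key (transpose u v) m) = xdeg m"
  unfolding xdeg_def using assms
  by (intro sum.reindex_bij_witness[of _ "transpose u v" "transpose u v"])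
    (auto simp: in_keys_iff transpose_def)

definition xc :: "nat \<Rightarrow> ('a + 'b) mfps \<Rightarrow> ('a + 'b) mfps" where
  "xc d = restr (\<lambda>m. xdeg m = d)"

lemma coeff_xc: "mfps_coeff (xc d f) m = (if xdeg m = d then mfps_coeff f m else 0)"
  by (simp add: xc_def)

lemma xc_diff: "xc d (f - g) = xc d f - xc d g"
  by (simp add: xc_def restr_diff)

definition xhom :: "nat \<Rightarrow> ('a + 'b) mfps \<Rightarrow> bool" where
  "xhom d f \<longleftrightarrow> (\<forall>m. mfps_coeff f m \<noteq> 0 \<longrightarrow> xdeg m = d)"

lemma xhom_iff: "xhom d f \<longleftrightarrow> (\<forall>e. e \<noteq> d \<longrightarrow> xc e f = 0)"
proof
  assume "\<forall>e. e \<noteq> d \<longrightarrow> xc e f = 0"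
  then have "mfps_coeff (xc (xdeg m) f) m = 0" if "xdeg m \<noteq> d" for m using that by simp
  then show "xhom d f" by (auto simp: xhom_def coeff_xc)
qed (auto simp: xhom_def coeff_xc intro!: mfps_eqI)

lemma xhom_1 [simp]: "xhom 0 1" by (simp add: xhom_def mfps_coeff_1)
lemma xhom_var: "xhom (if isl v then 1 else 0) (mfps_var v)"
  by (simp add: xhom_def mfps_coeff_var xdeg_single)
lemma xhom_mult: "xhom c f \<Longrightarrow> xhom d g \<Longrightarrow> xhom (c + d) (f * g)"
proof -
  assume f: "xhom c f" and g: "xhom d g"
  have "xdeg m = c + d" if "mfps_coeff (f * g) m \<noteq> 0" for m
  proof -
    from that obtain a b where "m = a + b" "mfps_coeff f a \<noteq> 0" "mfps_coeff g b \<noteq> 0"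
      by (rule mfps_coeff_mult_nonzero)
    then show ?thesis using f g by (simp add: xhom_def xdeg_add)
  qed
  then show ?thesis by (simp add: xhom_def)
qed
lemma xhom_diff: "xhom d f \<Longrightarrow> xhom d g \<Longrightarrow> xhom d (f - g)"
  by (auto simp: xhom_iff xc_diff)
lemma xhom_power: "xhom d f \<Longrightarrow> xhom (k * d) (f ^ k)"
  by (induction k) (auto simp: xhom_mult)
lemma xhom_prod: "(\<And>a. a \<in> A \<Longrightarrow> xhom (d a) (f a)) \<Longrightarrow> xhom (sum d A) (prod f A)"
  by (induction A rule: infinite_finite_induct) (auto simp: xhom_mult)

lemma xc_mult_xhom: "xhom c h \<Longrightarrow> h * xc d f = xc (c + d) (h * f)"
  unfolding xc_def by (rule restr_mult[symmetric]) (auto simp: xhom_def xdeg_add)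

lemma pi_rel_xc:
  assumes "pi_rel u v f g" "isl u \<longleftrightarrow> isl v"
  shows "pi_rel u v (xc d f) (xc d g)"
  unfolding xc_def using assms(1)
  \<comment> \<open>Multiplication by u or v raises the degree only if these are variables
    x.\<close>
  by (rule pi_rel_restr[where Z' = "\<lambda>m. xdeg m = (if isl u then 1 else 0) + d"])
    (use assms(2) in \<open>auto simp: xdeg_map_key xdeg_add xdeg_single\<close>)

lemma xhom_x_power: "xhom (sum_list \<alpha>) (in_x (x_power \<alpha>))"
proof -
  have "xhom (\<Sum>i = 1..length \<alpha>. \<alpha> ! (i - 1) * 1) (in_x (x_power \<alpha>))"
    unfolding x_power_def peval_prod peval_power peval_var_apply
    by (intro xhom_prod xhom_power) (use xhom_var[of "Inl _"] in auto)
  moreover have "(\<Sum>i = 1..length \<alpha>. \<alpha> ! (i - 1)) = sum_list \<alpha>"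
    unfolding sum_list_sum_nth by (rule sum.reindex_bij_witness[of _ Suc "\<lambda>i. i - 1"]) auto
  ultimately show ?thesis by simp
qed

text \<open>The operator acts on each homogeneous component separately, and the only image of a
  vanishing component is 0.\<close>

lemma xhom_atom: "xhom (sum_list \<alpha>) (in_x (atom \<alpha>))"
proof (induction \<alpha> rule: atom_induct)
  case (dominant \<alpha>)
  then show ?case by (simp add: atom_dominant xhom_x_power)
next
  case (ascent \<alpha> i)
  let ?g = "atom (swap_adj i \<alpha>)"
  have "xc e (in_x (atom \<alpha>)) = 0" if "e \<noteq> sum_list \<alpha>" for e
  proof -
    have g: "xc e (in_x ?g) = 0"
      using ascent that by (simp add: xhom_iff sum_list_swap_adj)
    have "pi_rel (Inl i) (Inl (Suc i)) (xc e (in_x ?g)) (xc e (in_x (pi_op i ?g)))"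
      by (intro pi_rel_xc pi_rel_in_x) auto
    then have "pi_rel (Inl i) (Inl (Suc i)) 0 (xc e (in_x (pi_op i ?g)))" by (simp only: g)
    then have "xc e (in_x (pi_op i ?g)) = 0"
      by (rule pi_rel_unique[OF _ _ pi_rel_0, rotated]) simp
    moreover have "in_x (atom \<alpha>) = in_x (pi_op i ?g) - in_x ?g"
      using ascent by (simp add: atom_ascent[of i] pi_op_def peval_simps)
    ultimately show ?thesis using g by (simp add: xc_diff)
  qed
  then show ?case by (simp add: xhom_iff)
qed

lemma only_vars_in_x: "only_vars (range Inl) (in_x f)"
  by (rule only_vars_peval) auto

lemma only_vars_in_y: "only_vars (range Inr) (in_y f)"
  by (rule only_vars_peval) auto

lemma xhom_in_y: "xhom 0 (in_y f)"
proof -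
  have "xdeg m = 0" if "keys m \<subseteq> range Inr" for m :: "nat + nat \<Rightarrow>\<^sub>0 nat"
    unfolding xdeg_def using that by (intro sum.neutral) auto
  then show ?thesis using only_vars_in_y[of f] by (simp add: xhom_def only_vars_def)
qed

lemma xhom_term: "xhom (sum_list \<alpha>) (in_x (atom \<alpha>) * in_y f)"
  using xhom_mult[OF xhom_atom xhom_in_y] by simp

section \<open>The factors of the kernel\<close>

definition geo :: "nat \<Rightarrow> nat \<Rightarrow> (nat + nat) mfps" where
  "geo i j = 1 / (1 - x_var i * y_var j)"

lemma geo_eq: "(1 - x_var i * y_var j) * geo i j = 1"
  unfolding geo_def by (rule mfps_geometric) simp

lemma geo_cancel:
  assumes "(1 - x_var i * y_var j) * f = (1 - x_var i * y_var j) * g"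
  shows "f = g"
proof -
  have "h = geo i j * ((1 - x_var i * y_var j) * h)" for h
  proof -
    have "geo i j * ((1 - x_var i * y_var j) * h) = ((1 - x_var i * y_var j) * geo i j) * h"
      by (simp only: mult_ac)
    then show ?thesis by (simp add: geo_eq)
  qed
  then show ?thesis using assms by metis
qed

lemma geo_unique: "(1 - x_var i * y_var j) * f = 1 \<Longrightarrow> f = geo i j"
  by (rule geo_cancel[of i j]) (simp only: geo_eq)

lemma vswap_x_geo: "vswap (Inl a) (Inl b) (geo i j) = geo (transpose a b i) j"
proof (rule geo_unique)
  have "vswap (Inl a) (Inl b) ((1 - x_var i * y_var j) * geo i j) = 1" by (simp only: geo_eq vswap_1)
  moreover have "transpose (Inl a) (Inl b) (Inl i) = (Inl (transpose a b i) :: nat + nat)"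
    "transpose (Inl a) (Inl b) (Inr j) = (Inr j :: nat + nat)"
    by (auto simp: transpose_def)
  ultimately show "(1 - x_var (transpose a b i) * y_var j) * vswap (Inl a) (Inl b) (geo i j) = 1"
    by (simp add: vswap_simps)
qed

lemma vswap_y_geo: "vswap (Inr a) (Inr b) (geo i j) = geo i (transpose a b j)"
proof (rule geo_unique)
  have "vswap (Inr a) (Inr b) ((1 - x_var i * y_var j) * geo i j) = 1" by (simp only: geo_eq vswap_1)
  moreover have "transpose (Inr a) (Inr b) (Inr j) = (Inr (transpose a b j) :: nat + nat)"
    "transpose (Inr a) (Inr b) (Inl i) = (Inl i :: nat + nat)"
    by (auto simp: transpose_def)
  ultimately show "(1 - x_var i * y_var (transpose a b j)) * vswap (Inr a) (Inr b) (geo i j) = 1"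
    by (simp add: vswap_simps)
qed

definition kern :: "(nat \<times> nat) set \<Rightarrow> (nat + nat) mfps" where
  "kern C = (\<Prod>(i, j)\<in>C. geo i j)"

lemma kern_insert: "finite C \<Longrightarrow> (i, j) \<notin> C \<Longrightarrow> kern (insert (i, j) C) = kern C * geo i j"
  by (simp add: kern_def mult.commute)

lemma vswap_x_kern:
  assumes "\<And>i j. (i, j) \<in> C \<Longrightarrow> (transpose a b i, j) \<in> C"
  shows "vswap (Inl a) (Inl b) (kern C) = kern C"
proof -
  have "vswap (Inl a) (Inl b) (kern C) = (\<Prod>(i, j)\<in>C. geo (transpose a b i) j)"
    by (simp add: kern_def vswap_prod vswap_x_geo case_prod_unfold)
  also have "\<dots> = (\<Prod>(i, j)\<in>C. geo i j)"
    using assms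
    by (intro prod.reindex_bij_witness[of _ "\<lambda>(i, j). (transpose a b i, j)" "\<lambda>(i, j). (transpose a b i, j)"]) auto
  finally show ?thesis by (simp add: kern_def)
qed

lemma vswap_y_kern:
  assumes "\<And>i j. (i, j) \<in> C \<Longrightarrow> (i, transpose a b j) \<in> C"
  shows "vswap (Inr a) (Inr b) (kern C) = kern C"
proof -
  have "vswap (Inr a) (Inr b) (kern C) = (\<Prod>(i, j)\<in>C. geo i (transpose a b j))"
    by (simp add: kern_def vswap_prod vswap_y_geo case_prod_unfold)
  also have "\<dots> = (\<Prod>(i, j)\<in>C. geo i j)"
    using assms
    by (intro prod.reindex_bij_witness[of _ "\<lambda>(i, j). (i, transpose a b j)" "\<lambda>(i, j). (i, transpose a b j)"]) auto
  finally show ?thesis by (simp add: kern_def)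
qed

text \<open>To be read with a = 1 - u y and b = 1 - v y, or with x in place of y: the operator then
  turns 1 / a into 1 / (a b).\<close>

lemma inverse_pi_aux:
  fixes a b g h u v :: "'a::comm_ring_1"
  assumes "a * g = 1" "b * h = 1" "u * b - v * a = u - v"
  shows "(u - v) * (g * h) = u * g - v * h"
proof -
  have "u * g - v * h = u * g * (b * h) - v * h * (a * g)" by (simp add: assms(1,2))
  also have "\<dots> = (u * b - v * a) * (g * h)" by (simp add: algebra_simps)
  finally show ?thesis by (simp add: assms(3))
qed

lemma pi_rel_x_geo: "pi_rel (Inl i) (Inl (Suc i)) (geo i j) (geo i j * geo (Suc i) j)"
  unfolding pi_rel_def vswap_x_geo transpose_apply_first
  by (rule inverse_pi_aux[OF geo_eq geo_eq]) (simp add: algebra_simps)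

lemma pi_rel_y_geo: "pi_rel (Inr j) (Inr (Suc j)) (geo i j) (geo i j * geo i (Suc j))"
  unfolding pi_rel_def vswap_y_geo transpose_apply_first
  by (rule inverse_pi_aux[OF geo_eq geo_eq]) (simp add: algebra_simps)

text \<open>The exchange of rows i and i + 1 permutes all boxes other than (i, j), so the operator
  acts on the factor of this one box alone.\<close>

lemma pi_rel_x_kern:
  assumes "finite C" "(i, j) \<in> C" "(Suc i, j) \<notin> C"
    and "\<And>a b. (a, b) \<in> C - {(i, j)} \<Longrightarrow> (transpose i (Suc i) a, b) \<in> C - {(i, j)}"
  shows "pi_rel (Inl i) (Inl (Suc i)) (kern C) (kern (insert (Suc i, j) C))"
proof -
  let ?C = "C - {(i, j)}"
  have "vswap (Inl i) (Inl (Suc i)) (kern ?C) = kern ?C"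
    by (rule vswap_x_kern) (rule assms(4))
  then have "pi_rel (Inl i) (Inl (Suc i)) (geo i j * kern ?C) (geo i j * geo (Suc i) j * kern ?C)"
    by (rule pi_rel_mult) (rule pi_rel_x_geo)
  moreover have "kern C = kern ?C * geo i j"
    using kern_insert[of ?C i j] assms by (simp add: insert_absorb)
  ultimately show ?thesis using assms by (simp add: kern_insert mult_ac)
qed

lemma pi_rel_y_kern:
  assumes "finite C" "(i, j) \<in> C" "(i, Suc j) \<notin> C"
    and "\<And>a b. (a, b) \<in> C - {(i, j)} \<Longrightarrow> (a, transpose j (Suc j) b) \<in> C - {(i, j)}"
  shows "pi_rel (Inr j) (Inr (Suc j)) (kern C) (kern (insert (i, Suc j) C))"
proof -
  let ?C = "C - {(i, j)}"
  have "vswap (Inr j) (Inr (Suc j)) (kern ?C) = kern ?C"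
    by (rule vswap_y_kern) (rule assms(4))
  then have "pi_rel (Inr j) (Inr (Suc j)) (geo i j * kern ?C) (geo i j * geo i (Suc j) * kern ?C)"
    by (rule pi_rel_mult) (rule pi_rel_y_geo)
  moreover have "kern C = kern ?C * geo i j"
    using kern_insert[of ?C i j] assms by (simp add: insert_absorb)
  ultimately show ?thesis using assms by (simp add: kern_insert mult_ac)
qed

lemma pi_rel_x_sum:
  assumes "finite C" "\<And>\<alpha>. \<alpha> \<in> C \<Longrightarrow> length \<alpha> = n" "1 \<le> i" "i < n"
  shows "pi_rel (Inl i) (Inl (Suc i)) (\<Sum>\<alpha>\<in>C. in_x (atom \<alpha>) * in_y (G \<alpha>))
    (\<Sum>\<alpha>\<in>{\<alpha>. length \<alpha> = n \<and> lower i \<alpha> \<in> C}. in_x (atom \<alpha>) * in_y (G (lower i \<alpha>)))"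
proof -
  have "(\<Sum>\<alpha>\<in>C. in_x (pi_op i (atom \<alpha>)) * in_y (G \<alpha>))
    = (\<Sum>\<alpha>\<in>C. if \<alpha> ! i < \<alpha> ! (i - 1)
        then in_x (atom \<alpha>) * in_y (G \<alpha>) + in_x (atom (swap_adj i \<alpha>)) * in_y (G \<alpha>)
        else if \<alpha> ! (i - 1) = \<alpha> ! i then in_x (atom \<alpha>) * in_y (G \<alpha>) else 0)"
    using assms by (intro sum.cong) (auto simp: pi_op_atom peval_simps distrib_right)
  also have "\<dots> = (\<Sum>\<alpha>\<in>{\<alpha>. length \<alpha> = n \<and> lower i \<alpha> \<in> C}. in_x (atom \<alpha>) * in_y (G (lower i \<alpha>)))"
    using assms by (intro sum_lower[where t = "\<lambda>\<alpha> \<gamma>. in_x (atom \<alpha>) * in_y (G \<gamma>)"]) auto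
  finally have "(\<Sum>\<alpha>\<in>C. in_x (pi_op i (atom \<alpha>)) * in_y (G \<alpha>))
    = (\<Sum>\<alpha>\<in>{\<alpha>. length \<alpha> = n \<and> lower i \<alpha> \<in> C}. in_x (atom \<alpha>) * in_y (G (lower i \<alpha>)))" .
  moreover have "pi_rel (Inl i) (Inl (Suc i)) (\<Sum>\<alpha>\<in>C. in_x (atom \<alpha>) * in_y (G \<alpha>))
    (\<Sum>\<alpha>\<in>C. in_x (pi_op i (atom \<alpha>)) * in_y (G \<alpha>))"
    by (intro pi_rel_sum pi_rel_x_term)
  ultimately show ?thesis by (simp only:)
qed

lemma pi_rel_y_sum:
  assumes "\<And>\<alpha>. \<alpha> \<in> C \<Longrightarrow> length (c \<alpha>) = n" "1 \<le> i" "i < n"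
  shows "pi_rel (Inr i) (Inr (Suc i)) (\<Sum>\<alpha>\<in>C. in_x (atom \<alpha>) * in_y (key_poly (c \<alpha>)))
    (\<Sum>\<alpha>\<in>C. in_x (atom \<alpha>) * in_y (key_poly (upper i (c \<alpha>))))"
proof (rule pi_rel_sum)
  fix \<alpha> assume "\<alpha> \<in> C"
  then have "pi_op i (key_poly (c \<alpha>)) = key_poly (upper i (c \<alpha>))"
    using assms by (intro pi_op_key_poly) auto
  then show "pi_rel (Inr i) (Inr (Suc i)) (in_x (atom \<alpha>) * in_y (key_poly (c \<alpha>)))
     (in_x (atom \<alpha>) * in_y (key_poly (upper i (c \<alpha>))))"
    using pi_rel_y_term[of i "atom \<alpha>" "key_poly (c \<alpha>)"] by (simp only:)
qed

section \<open>Coefficients along a line\<close>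

text \<open>For \<open>\<eta>\<close> free of u and v, these are the exponents of joint degree s in
  u and v that agree with \<open>\<eta>\<close> elsewhere. An operator in u and v relates
  coefficients along such a line only, which reduces it to a statement about sequences indexed by
  t.\<close>

definition line :: "'v \<Rightarrow> 'v \<Rightarrow> ('v \<Rightarrow>\<^sub>0 nat) \<Rightarrow> nat \<Rightarrow> nat \<Rightarrow> ('v \<Rightarrow>\<^sub>0 nat)" where
  "line u v \<eta> s t = \<eta> + single u t + single v (s - t)"

lemma lookup_line:
  "lookup (line u v \<eta> s t) w
    = lookup \<eta> w + (if w = u then t else 0) + (if w = v then s - t else 0)"
  by (auto simp: line_def lookup_add lookup_single when_def)

lemma line_cases:
  assumes "u \<noteq> v"
  obtains \<eta> s t where "e = line u v \<eta> s t" "lookup \<eta> u = 0" "lookup \<eta> v = 0"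
    "t \<le> s" "lookup e u = t" "lookup e v = s - t"
proof
  let ?u = "lookup e u" and ?v = "lookup e v"
  let ?\<eta> = "e - single u ?u - single v ?v"
  show "e = line u v ?\<eta> (?u + ?v) ?u"
    using assms by (intro poly_mapping_eqI) (auto simp: lookup_line lookup_minus lookup_single when_def)
qed (use assms in \<open>auto simp: lookup_minus lookup_single\<close>)

lemma map_key_line:
  assumes "u \<noteq> v" "lookup \<eta> u = 0" "lookup \<eta> v = 0" "t \<le> s"
  shows "map_key (transpose u v) (line u v \<eta> s t) = line u v \<eta> s (s - t)"
  using assms by (intro poly_mapping_eqI) (auto simp: lookup_line transpose_def)

text \<open>Coefficients are compared at \<open>line u v \<eta> (Suc s) (Suc t)\<close>, one degree
  above the line. Having both E and E' covers the symmetric and the antisymmetric situation at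
  once.\<close>

lemma line_rel:
  assumes uv: "u \<noteq> v" and eta: "lookup \<eta> u = 0" "lookup \<eta> v = 0"
    and rel: "(mfps_var u - mfps_var v) * Q = mfps_var u * E + vswap u v (mfps_var u * E')"
  shows "t < s \<Longrightarrow> mfps_coeff Q (line u v \<eta> s t) - mfps_coeff Q (line u v \<eta> s (Suc t))
      = mfps_coeff E (line u v \<eta> s t) + mfps_coeff E' (line u v \<eta> s (s - Suc t))"
    and "mfps_coeff Q (line u v \<eta> s s) = mfps_coeff E (line u v \<eta> s s)"
proof -
  have m: "line u v \<eta> (Suc s) (Suc t) - single u 1 = line u v \<eta> s t"
     for t using uv by (intro poly_mapping_eqI) (auto simp: lookup_line lookup_minus lookup_single when_def)
  have m': "line u v \<eta> (Suc s) (Suc t) - single v 1 = line u v \<eta> s (Suc t)" if "t < s"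
     for t using uv that by (intro poly_mapping_eqI) (auto simp: lookup_line lookup_minus lookup_single when_def)
  have c: "mfps_coeff ((mfps_var u - mfps_var v) * Q) (line u v \<eta> (Suc s) (Suc t))
      = mfps_coeff (mfps_var u * E + vswap u v (mfps_var u * E')) (line u v \<eta> (Suc s) (Suc t))" for t
    using rel by simp
  { assume t: "t < s"
    then have w: "map_key (transpose u v) (line u v \<eta> (Suc s) (Suc t)) = line u v \<eta> (Suc s) (Suc (s - Suc t))"
      using uv eta by (simp add: map_key_line Suc_diff_Suc)
    show "mfps_coeff Q (line u v \<eta> s t) - mfps_coeff Q (line u v \<eta> s (Suc t))
      = mfps_coeff E (line u v \<eta> s t) + mfps_coeff E' (line u v \<eta> s (s - Suc t))"
      using c[of t] t uv eta m[of t] m[of "s - Suc t"] m'[of t]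
      by (simp add: left_diff_distrib mfps_coeff_var_mult coeff_vswap w) (simp add: lookup_line) }
  have w: "map_key (transpose u v) (line u v \<eta> (Suc s) (Suc s)) = line u v \<eta> (Suc s) 0"
    using uv eta by (simp add: map_key_line)
  show "mfps_coeff Q (line u v \<eta> s s) = mfps_coeff E (line u v \<eta> s s)"
    using c[of s] uv eta m[of s]
    by (simp add: left_diff_distrib mfps_coeff_var_mult coeff_vswap w) (simp add: lookup_line)
qed

lemma pi_rel_line:
  assumes "u \<noteq> v" "lookup \<eta> u = 0" "lookup \<eta> v = 0" "pi_rel u v f P"
  shows "t < s \<Longrightarrow> mfps_coeff P (line u v \<eta> s t) - mfps_coeff P (line u v \<eta> s (Suc t))
      = mfps_coeff f (line u v \<eta> s t) - mfps_coeff f (line u v \<eta> s (s - Suc t))"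
    and "mfps_coeff P (line u v \<eta> s s) = mfps_coeff f (line u v \<eta> s s)"
    and "t \<le> s \<Longrightarrow> mfps_coeff P (line u v \<eta> s (s - t)) = mfps_coeff P (line u v \<eta> s t)"
proof -
  have r: "(mfps_var u - mfps_var v) * P = mfps_var u * f + vswap u v (mfps_var u * (- f))"
    using assms(4) vswap_mult[of u v "mfps_var u" "- f"] vswap_diff[of u v 0 f]
    by (simp add: pi_rel_def vswap_var)
  note l = line_rel[OF assms(1-3) r]
  show "t < s \<Longrightarrow> mfps_coeff P (line u v \<eta> s t) - mfps_coeff P (line u v \<eta> s (Suc t))
      = mfps_coeff f (line u v \<eta> s t) - mfps_coeff f (line u v \<eta> s (s - Suc t))"
    using l(1) by simp
  show "mfps_coeff P (line u v \<eta> s s) = mfps_coeff f (line u v \<eta> s s)" by (rule l(2))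
  assume "t \<le> s"
  then show "mfps_coeff P (line u v \<eta> s (s - t)) = mfps_coeff P (line u v \<eta> s t)"
    using pi_rel_sym[OF assms(1,4)] assms(1-3) by (metis coeff_vswap map_key_line)
qed

text \<open>An antisymmetric factor reverses the sign of the reflected term: compared with
  \<open>pi_rel_line\<close>, a difference of coefficients of f becomes a sum, and symmetry becomes
  antisymmetry.\<close>

lemma pi_rel_antisym_line:
  assumes "u \<noteq> v" "lookup \<eta> u = 0" "lookup \<eta> v = 0" "pi_rel u v f P"
    and V: "vswap u v V = - V"
  shows "t < s \<Longrightarrow> mfps_coeff (V * P) (line u v \<eta> s t) - mfps_coeff (V * P) (line u v \<eta> s (Suc t))
      = mfps_coeff (V * f) (line u v \<eta> s t) + mfps_coeff (V * f) (line u v \<eta> s (s - Suc t))"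
    and "mfps_coeff (V * P) (line u v \<eta> s s) = mfps_coeff (V * f) (line u v \<eta> s s)"
    and "t \<le> s \<Longrightarrow> mfps_coeff (V * P) (line u v \<eta> s (s - t)) = - mfps_coeff (V * P) (line u v \<eta> s t)"
proof -
  have "(mfps_var u - mfps_var v) * (V * P) = V * ((mfps_var u - mfps_var v) * P)" by (simp only: mult_ac)
  also have "\<dots> = V * (mfps_var u * f - mfps_var v * vswap u v f)"
    using assms(4) by (simp only: pi_rel_def)
  also have "\<dots> = mfps_var u * (V * f) + vswap u v (mfps_var u * (V * f))"
    by (simp add: vswap_mult vswap_var V algebra_simps)
  finally have r: "(mfps_var u - mfps_var v) * (V * P) = mfps_var u * (V * f) + vswap u v (mfps_var u * (V * f))" .
  note l = line_rel[OF assms(1-3) r]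
  show "t < s \<Longrightarrow> mfps_coeff (V * P) (line u v \<eta> s t) - mfps_coeff (V * P) (line u v \<eta> s (Suc t))
      = mfps_coeff (V * f) (line u v \<eta> s t) + mfps_coeff (V * f) (line u v \<eta> s (s - Suc t))"
    by (rule l(1))
  show "mfps_coeff (V * P) (line u v \<eta> s s) = mfps_coeff (V * f) (line u v \<eta> s s)" by (rule l(2))
  assume "t \<le> s"
  then have "mfps_coeff (V * P) (line u v \<eta> s (s - t)) = mfps_coeff (vswap u v (V * P)) (line u v \<eta> s t)"
    using assms(1-3) by (simp add: coeff_vswap map_key_line)
  also have "vswap u v (V * P) = - (V * P)"
    using pi_rel_sym[OF assms(1,4)] V by (simp add: vswap_mult)
  finally show "mfps_coeff (V * P) (line u v \<eta> s (s - t)) = - mfps_coeff (V * P) (line u v \<eta> s t)" by simp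
qed

text \<open>f vanishes farther from the centre s / 2 than t0. Descending from t = s, P therefore
  agrees with f down to the outer one of t0 and s - t0, and symmetry carries the value to
  t0.\<close>

lemma pi_extremal:
  fixes P f :: "nat \<Rightarrow> int"
  assumes rel: "\<And>t. t < s \<Longrightarrow> P t - P (Suc t) = f t - f (s - Suc t)" and top: "P s = f s"
    and sym: "\<And>t. t \<le> s \<Longrightarrow> P (s - t) = P t" and t: "t0 \<le> s"
    and vanish: "\<And>t. t \<le> s \<Longrightarrow> \<bar>2 * int t0 - int s\<bar> < \<bar>2 * int t - int s\<bar> \<Longrightarrow> f t = 0"
  shows "P t0 = f (if s \<le> 2 * t0 then t0 else s - t0)"
proof -
  define b where "b = (if s \<le> 2 * t0 then t0 else s - t0)"
  have b: "b \<le> s" "s \<le> 2 * b" "\<bar>2 * int t0 - int s\<bar> = 2 * int b - int s"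
    using t by (auto simp: b_def of_nat_diff)
  have "P t = f t" if "b \<le> t" "t \<le> s" for t
    using \<open>t \<le> s\<close> \<open>b \<le> t\<close>
  proof (induction rule: inc_induct)
    case (step t)
    then have "P (Suc t) = f (Suc t)" by simp
    moreover have "f (Suc t) = 0" "f (s - Suc t) = 0"
      using step b by (auto intro!: vanish simp: of_nat_diff)
    ultimately show ?case using rel[of t] step by simp
  qed (rule top)
  with b have "P b = f b" by simp
  moreover have "P t0 = P b" using sym[OF t] by (simp add: b_def)
  ultimately show ?thesis by (simp add: b_def)
qed

text \<open>Every step of Q between t0 and s - t0 vanishes, so Q has the same value at both ends,
  and antisymmetry makes it 0. Distances are measured from (s - 1) / 2, the centre of the reflection
  that pairs the two values of E.\<close>

lemma antisym_vanish:
  fixes Q E :: "nat \<Rightarrow> int"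
  assumes rel: "\<And>t. t < s \<Longrightarrow> Q t - Q (Suc t) = E t + E (s - Suc t)"
    and anti: "\<And>t. t \<le> s \<Longrightarrow> Q (s - t) = - Q t" and t: "t0 \<le> s"
    and vanish: "\<And>t. t \<le> s \<Longrightarrow> \<bar>2 * int t - int s + 1\<bar> \<le> \<bar>2 * int t0 - int s + 1\<bar> \<Longrightarrow> E t = 0"
  shows "Q t0 = 0"
proof -
  define a b where "a = min t0 (s - t0)" and "b = max t0 (s - t0)"
  have eq: "Q t = Q (Suc t)" if "a \<le> t" "t < b" for t
  proof -
    have "t < s" using that t by (auto simp: b_def)
    moreover have "E t = 0" "E (s - Suc t) = 0"
      using that t \<open>t < s\<close> by (auto intro!: vanish simp: of_nat_diff a_def b_def)
    ultimately show ?thesis using rel[of t] by simp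
  qed
  have "Q a = Q t" if "a \<le> t" "t \<le> b" for t
    using that
  proof (induction rule: dec_induct)
    case (step t)
    then show ?case using eq[of t] by simp
  qed simp
  then have "Q a = Q b" by (simp add: a_def b_def)
  then have "Q t0 = Q (s - t0)" by (auto simp: a_def b_def min_def max_def split: if_splits)
  then show ?thesis using anti[OF t] by simp
qed

section \<open>Extremal monomials of atoms\<close>

definition nrm :: "('v \<Rightarrow>\<^sub>0 nat) \<Rightarrow> int" where
  "nrm e = (\<Sum>w\<in>keys e. (int (lookup e w))\<^sup>2)"

lemma nrm_superset:
  assumes "finite U" "keys e \<subseteq> U"
  shows "nrm e = (\<Sum>w\<in>U. (int (lookup e w))\<^sup>2)"
  unfolding nrm_def using assms by (intro sum.mono_neutral_left) (auto simp: in_keys_iff)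

lemma nrm_ge_sum:
  assumes "finite U"
  shows "(\<Sum>w\<in>U. (int (lookup e w))\<^sup>2) \<le> nrm e"
proof -
  have "(\<Sum>w\<in>U. (int (lookup e w))\<^sup>2) \<le> (\<Sum>w\<in>U \<union> keys e. (int (lookup e w))\<^sup>2)"
    using assms by (intro sum_mono2) auto
  then show ?thesis using assms nrm_superset[of "U \<union> keys e" e] by simp
qed

lemma nrm_add_disjoint:
  assumes "keys a \<inter> keys b = {}"
  shows "nrm (a + b) = nrm a + nrm b"
proof -
  let ?U = "keys a \<union> keys b"
  have "(int (lookup a w + lookup b w))\<^sup>2
     = (int (lookup a w))\<^sup>2 + (int (lookup b w))\<^sup>2" for w
  proof -
    have "lookup a w = 0 \<or> lookup b w = 0"
      using assms by (auto simp: in_keys_iff disjoint_iff)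
    then show ?thesis by auto
  qed
  then have "(\<Sum>w\<in>?U. (int (lookup (a + b) w))\<^sup>2)
     = (\<Sum>w\<in>?U. (int (lookup a w))\<^sup>2) + (\<Sum>w\<in>?U. (int (lookup b w))\<^sup>2)"
    by (simp add: lookup_add sum.distrib)
  then show ?thesis
    using nrm_superset[of ?U "a + b"] nrm_superset[of ?U a] nrm_superset[of ?U b] keys_add[of a b] by simp
qed

lemma nrm_single: "nrm (single v k) = (int k)\<^sup>2"
  using nrm_superset[of "{v}" "single v k"] by simp

text \<open>Along a line the norm grows with the distance from the centre s / 2, which is the
  quantity in \<open>pi_extremal\<close>.\<close>

lemma nrm_line:
  assumes "u \<noteq> v" "lookup \<eta> u = 0" "lookup \<eta> v = 0" "t \<le> s"
  shows "2 * nrm (line u v \<eta> s t) = 2 * nrm \<eta> + (int s)\<^sup>2 + (2 * int t - int s)\<^sup>2"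
proof -
  have "nrm (line u v \<eta> s t) = nrm \<eta> + (int t)\<^sup>2 + (int (s - t))\<^sup>2"
    unfolding line_def using assms
    by (subst nrm_add_disjoint, (auto simp: in_keys_iff lookup_add lookup_single when_def split: if_splits)[1])+
      (simp add: nrm_single)
  then show ?thesis using assms(4) by (simp add: of_nat_diff power2_eq_square algebra_simps)
qed

lemma nrm_map_key: "nrm (map_key (transpose u v) e) = nrm e"
  unfolding nrm_def
  by (rule sum.reindex_bij_witness[of _ "transpose u v" "transpose u v"]) (auto simp: in_keys_iff)

definition mfps_monom :: "('v \<Rightarrow>\<^sub>0 nat) \<Rightarrow> 'v mfps" where
  "mfps_monom r = Abs_mfps (\<lambda>m. if m = r then 1 else 0)"

lemma coeff_monom: "mfps_coeff (mfps_monom r) m = (if m = r then 1 else 0)"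
  by (simp add: mfps_monom_def)

lemma coeff_monom_mult: "mfps_coeff (mfps_monom r * f) (r + e) = mfps_coeff f e"
proof -
  have "mfps_coeff (mfps_monom r * f) (r + e) = (\<Sum>(a, b)\<in>{(r, e)}. mfps_coeff (mfps_monom r) a * mfps_coeff f b)"
    unfolding mfps_coeff_mult
    by (intro sum.mono_neutral_right finite_mon_decomp) (auto simp: coeff_monom split: if_splits)
  then show ?thesis by (simp add: coeff_monom)
qed

lemma monom_add: "mfps_monom (r + s) = mfps_monom r * mfps_monom s"
proof (rule mfps_eqI)
  fix m
  show "mfps_coeff (mfps_monom (r + s)) m = mfps_coeff (mfps_monom r * mfps_monom s) m"
  proof (cases "m = r + s")
    case True
    then show ?thesis by (simp add: coeff_monom_mult) (simp add: coeff_monom)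
  next
    case False
    have "mfps_coeff (mfps_monom r * mfps_monom s) m = 0"
      unfolding mfps_coeff_mult using False by (intro sum.neutral) (auto simp: coeff_monom)
    with False show ?thesis by (simp add: coeff_monom)
  qed
qed

lemma monom_0 [simp]: "mfps_monom 0 = 1"
  by (rule mfps_eqI) (simp add: coeff_monom mfps_coeff_1)

lemma var_power_monom: "mfps_var v ^ k = mfps_monom (single v k)"
proof (induction k)
  case (Suc k)
  have "mfps_var v = mfps_monom (single v 1)"
    by (rule mfps_eqI) (simp add: coeff_monom mfps_coeff_var)
  with Suc show ?case by (simp add: monom_add[symmetric] single_add[symmetric])
qed simp

lemma prod_monom: "(\<Prod>a\<in>A. mfps_monom (f a)) = mfps_monom (\<Sum>a\<in>A. f a)"
  by (induction A rule: infinite_finite_induct) (auto simp: monom_add)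

definition expo :: "nat list \<Rightarrow> nat + nat \<Rightarrow>\<^sub>0 nat" where
  "expo \<alpha> = (\<Sum>j = 1..length \<alpha>. single (Inl j) (\<alpha> ! (j - 1)))"

lemma lookup_expo [simp]:
  "lookup (expo \<alpha>) (Inl j) = (if 1 \<le> j \<and> j \<le> length \<alpha> then \<alpha> ! (j - 1) else 0)"
  "lookup (expo \<alpha>) (Inr j) = 0"
  by (auto simp: expo_def lookup_sum lookup_single when_def)

lemma in_x_x_power: "in_x (x_power \<alpha>) = mfps_monom (expo \<alpha>)"
  by (simp add: x_power_def expo_def peval_prod peval_power peval_var_apply var_power_monom prod_monom)

lemma expo_swap_adj:
  assumes "1 \<le> i" "i < length \<alpha>"
  shows "expo (swap_adj i \<alpha>) = map_key (transpose (Inl i) (Inl (Suc i))) (expo \<alpha>)"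
proof (rule poly_mapping_eqI)
  fix w
  show "lookup (expo (swap_adj i \<alpha>)) w
    = lookup (map_key (transpose (Inl i) (Inl (Suc i))) (expo \<alpha>)) w"
    using assms by (cases w) (auto simp: transpose_def swap_adj_def nth_list_update)
qed

lemma nrm_expo: "nrm (expo \<alpha>) = (\<Sum>j = 1..length \<alpha>. (int (\<alpha> ! (j - 1)))\<^sup>2)"
proof -
  have "keys (expo \<alpha>) \<subseteq> Inl ` {1..length \<alpha>}"
  proof
    fix w assume "w \<in> keys (expo \<alpha>)"
    then show "w \<in> Inl ` {1..length \<alpha>}" by (cases w) (auto simp: in_keys_iff split: if_splits)
  qed
  then show ?thesis by (subst nrm_superset[of "Inl ` {1..length \<alpha>}"]) (auto simp: sum.reindex)
qed

text \<open>No monomial of an atom exceeds the norm of \<open>expo \<alpha>\<close>, and only this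
  one attains it: the operator fills in exponents between a descent and its reflection, which have
  smaller norm, and \<open>pi_hat\<close> drops the descent itself.\<close>

lemma coeff_atom:
  assumes "nrm (expo \<alpha>) \<le> nrm e"
  shows "mfps_coeff (in_x (atom \<alpha>)) e = (if e = expo \<alpha> then 1 else 0)"
  using assms
proof (induction \<alpha> arbitrary: e rule: atom_induct)
  case (dominant \<alpha>)
  then show ?case by (simp add: atom_dominant in_x_x_power coeff_monom)
next
  case (ascent \<alpha> i)
  let ?u = "Inl i :: nat + nat" and ?v = "Inl (Suc i) :: nat + nat"
  let ?f = "in_x (atom (swap_adj i \<alpha>))" and ?P = "in_x (pi_op i (atom (swap_adj i \<alpha>)))"
  let ?sw = "map_key (transpose ?u ?v)"
  have sw: "expo (swap_adj i \<alpha>) = ?sw (expo \<alpha>)" using ascent by (simp add: expo_swap_adj)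
  have uv: "?u \<noteq> ?v" by simp
  obtain \<eta> s t where e: "e = line ?u ?v \<eta> s t" "lookup \<eta> ?u = 0" "lookup \<eta> ?v = 0"
    "t \<le> s" "lookup e ?u = t" "lookup e ?v = s - t"
    using uv by (rule line_cases)
  note lin = pi_rel_line[OF uv e(2,3) pi_rel_in_x]
  have "mfps_coeff ?P (line ?u ?v \<eta> s t) = mfps_coeff ?f (line ?u ?v \<eta> s (if s \<le> 2 * t then t else s - t))"
  proof (rule pi_extremal[where P = "\<lambda>t. mfps_coeff ?P (line ?u ?v \<eta> s t)" and f = "\<lambda>t. mfps_coeff ?f (line ?u ?v \<eta> s t)"])
    fix t' assume t': "t' \<le> s" "\<bar>2 * int t - int s\<bar> < \<bar>2 * int t' - int s\<bar>"
    then have "(2 * int t - int s)\<^sup>2 < (2 * int t' - int s)\<^sup>2"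
      by (metis abs_ge_zero power2_abs power_strict_mono zero_less_numeral)
    then have lt: "nrm e < nrm (line ?u ?v \<eta> s t')"
      using nrm_line[OF uv e(2,3) t'(1)] nrm_line[OF uv e(2,3) e(4)] e(1) by simp
    then have "nrm (expo (swap_adj i \<alpha>)) < nrm (line ?u ?v \<eta> s t')"
      using ascent.prems by (simp add: sw nrm_map_key)
    then show "mfps_coeff ?f (line ?u ?v \<eta> s t') = 0"
      using ascent.IH by auto
  qed (use lin e in auto)
  then have P: "mfps_coeff ?P e = mfps_coeff ?f (if s \<le> 2 * t then e else ?sw e)"
    using e uv by (simp add: map_key_line)
  have a: "mfps_coeff (in_x (atom \<alpha>)) e = mfps_coeff ?P e - mfps_coeff ?f e"
    using ascent.hyps by (simp add: atom_ascent[of i] pi_op_def peval_simps)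
  show ?case
  proof (cases "s \<le> 2 * t")
    case True
    \<comment> \<open>At a weak descent the images under \<open>pi_op\<close> and the identity have
      the same coefficient, so nothing remains for \<open>pi_hat\<close>.\<close>
    then have "e \<noteq> expo \<alpha>" using e(4-6) ascent.hyps by auto
    with True show ?thesis by (simp add: a P)
  next
    case False
    then have lt: "lookup e ?u < lookup e ?v" using e by simp
    have "nrm (expo (swap_adj i \<alpha>)) \<le> nrm e" "nrm (expo (swap_adj i \<alpha>)) \<le> nrm (?sw e)"
      using ascent.prems by (simp_all add: sw nrm_map_key)
    then have "mfps_coeff ?f e = (if e = expo (swap_adj i \<alpha>) then 1 else 0)"
      "mfps_coeff ?f (?sw e) = (if ?sw e = expo (swap_adj i \<alpha>) then 1 else 0)"
      using ascent.IH by blast+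
    moreover have "e \<noteq> expo (swap_adj i \<alpha>)" using lt ascent.hyps by auto
    moreover have "?sw e = expo (swap_adj i \<alpha>) \<longleftrightarrow> e = expo \<alpha>"
      unfolding sw by (simp add: map_key_transpose_eq_iff)
    ultimately show ?thesis using False by (simp add: a P)
  qed
qed

section \<open>The Vandermonde product\<close>

definition pairs :: "nat \<Rightarrow> (nat \<times> nat) set" where
  "pairs m = (SIGMA b:{1..m}. {1..<b})"

definition vdm :: "nat \<Rightarrow> (nat + nat) mfps" where
  "vdm m = (\<Prod>(b, a)\<in>pairs m. x_var b - x_var a)"

definition rho :: "nat \<Rightarrow> nat + nat \<Rightarrow>\<^sub>0 nat" where
  "rho m = (\<Sum>(b, a)\<in>pairs m. single (Inl b) 1)"

lemma finite_pairs [simp]: "finite (pairs m)"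
  by (simp add: pairs_def)

lemma pairs_iff: "(b, a) \<in> pairs m \<longleftrightarrow> 1 \<le> a \<and> a < b \<and> b \<le> m"
  by (auto simp: pairs_def)

lemma sum_pairs: "(\<Sum>(b, a)\<in>pairs m. f b) = (\<Sum>b = 1..m. \<Sum>a = 1..<b. f b)"
  unfolding pairs_def by (rule sum.Sigma[symmetric]) auto

lemma lookup_rho [simp]:
  "lookup (rho m) (Inl j) = (if 1 \<le> j \<and> j \<le> m then j - 1 else 0)"
  "lookup (rho m) (Inr j) = 0"
  by (auto simp: rho_def sum_pairs lookup_sum lookup_single when_def if_distrib[of "\<lambda>x. _ * x"] cong: if_cong)

lemma weight_single:
  "b \<in> {1..m} \<Longrightarrow> (\<Sum>j = 1..m. w j * int (lookup (single (Inl b :: nat + nat) 1) (Inl j))) = (w b :: int)"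
  by (simp add: lookup_single when_def if_distrib[of "\<lambda>x. _ * int x"] cong: if_cong)

text \<open>Each factor contributes one of its two variables, and the weight of
  \<open>x_var b\<close> is the larger one. Used for all monotone weights, this says that the
  exponents of the Vandermonde product are dominated by \<open>rho\<close>.\<close>

lemma prod_diff_weight:
  fixes w :: "nat \<Rightarrow> int"
  assumes "finite I" "\<And>b a. (b, a) \<in> I \<Longrightarrow> w a \<le> w b \<and> a \<in> {1..m} \<and> b \<in> {1..m}"
    and "mfps_coeff (\<Prod>(b, a)\<in>I. x_var b - x_var a) \<kappa> \<noteq> 0"
  shows "(\<Sum>j = 1..m. w j * int (lookup \<kappa> (Inl j))) \<le> (\<Sum>(b, a)\<in>I. w b)"
  using assms
proof (induction I arbitrary: \<kappa> rule: finite_induct)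
  case empty
  then have "\<kappa> = 0" by (simp add: mfps_coeff_1 split: if_splits)
  then show ?case by simp
next
  case (insert p I)
  obtain b a where p: "p = (b, a)" by (cases p)
  have "mfps_coeff ((x_var b - x_var a) * (\<Prod>(b, a)\<in>I. x_var b - x_var a)) \<kappa> \<noteq> 0"
    using insert p by simp
  then obtain q r where qr: "\<kappa> = q + r" "mfps_coeff (x_var b - x_var a) q \<noteq> 0"
    "mfps_coeff (\<Prod>(b, a)\<in>I. x_var b - x_var a) r \<noteq> 0"
    by (rule mfps_coeff_mult_nonzero)
  have ab: "w a \<le> w b" "a \<in> {1..m}" "b \<in> {1..m}" using insert.prems(1)[of b a] p by auto
  have "q = single (Inl b) 1 \<or> q = single (Inl a) 1"
    using qr(2) by (auto simp: mfps_coeff_var split: if_splits)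
  then have "(\<Sum>j = 1..m. w j * int (lookup q (Inl j))) \<le> w b"
    using ab weight_single[of b m w] weight_single[of a m w] by auto
  moreover have "(\<Sum>j = 1..m. w j * int (lookup r (Inl j))) \<le> (\<Sum>(b, a)\<in>I. w b)"
    using insert.prems(1) qr(3) by (intro insert.IH) auto
  ultimately show ?case
    using insert.hyps p by (simp add: qr(1) lookup_add distrib_left sum.distrib)
qed

lemma minus_single_add:
  assumes "lookup e v \<noteq> (0 :: nat)"
  shows "e - single v 1 + single v 1 = e"
  using assms by (intro poly_mapping_eqI) (auto simp: lookup_add lookup_minus lookup_single when_def)

text \<open>Choosing the smaller index in any factor lowers the sum of all chosen indices, so the
  exponent of the larger choices arises in one way only.\<close>

lemma prod_diff_lead:
  assumes "finite I" "\<And>b a. (b, a) \<in> I \<Longrightarrow> a < b \<and> a \<in> {1..m} \<and> b \<in> {1..m}"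
  shows "mfps_coeff (\<Prod>(b, a)\<in>I. x_var b - x_var a) (\<Sum>(b, a)\<in>I. single (Inl b) 1) = 1"
  using assms
proof (induction I rule: finite_induct)
  case empty
  then show ?case by (simp add: mfps_coeff_1)
next
  case (insert p I)
  obtain b a where p: "p = (b, a)" by (cases p)
  let ?R = "\<Prod>(b, a)\<in>I. x_var b - x_var a"
  let ?r = "\<Sum>(b, a)\<in>I. single (Inl b) 1 :: nat + nat \<Rightarrow>\<^sub>0 nat"
  let ?W = "\<lambda>\<kappa> :: nat + nat \<Rightarrow>\<^sub>0 nat. \<Sum>j = 1..m. int j * int (lookup \<kappa> (Inl j))"
  let ?e = "single (Inl b) 1 + ?r"
  have ab: "a < b" "a \<in> {1..m}" "b \<in> {1..m}" using insert.prems[of b a] p by auto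
  have W_add: "?W (x + y) = ?W x + ?W y" for x y
    by (simp add: lookup_add distrib_left sum.distrib)
  have Wr: "?W (\<Sum>(b, a)\<in>J. single (Inl b) 1) = (\<Sum>(b, a)\<in>J. int b)"
    if "J \<subseteq> I" for J
    using finite_subset[OF that insert.hyps(1)] that
  proof (induction J rule: finite_induct)
    case (insert q J)
    obtain d c where q: "q = (d, c)" by (cases q)
    have "d \<in> {1..m}" using insert q insert.prems \<open>\<And>b a. (b, a) \<in> Set.insert p I \<Longrightarrow> _\<close> by blast
    then show ?case using insert q by (simp add: W_add weight_single del: One_nat_def)
  qed simp
  have "mfps_coeff (x_var a * ?R) ?e = 0"
  proof (cases "lookup ?e (Inl a) = 0")
    case False
    define r' where "r' = ?e - single (Inl a) 1"
    have e: "?e = r' + single (Inl a) 1"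
      using minus_single_add[OF False] unfolding r'_def by simp
    have "?W ?e = ?W r' + int a" unfolding e W_add using weight_single[of a m int] ab by simp
    moreover have "?W ?e = int b + (\<Sum>(b, a)\<in>I. int b)"
      unfolding W_add using weight_single[of b m int] Wr[of I] ab by simp
    ultimately have "?W r' > (\<Sum>(b, a)\<in>I. int b)" using ab by simp
    then have "mfps_coeff ?R r' = 0"
      using prod_diff_weight[of I int m r'] insert by fastforce
    then show ?thesis by (simp add: mfps_coeff_var_mult r'_def)
  qed (simp add: mfps_coeff_var_mult)
  moreover have "mfps_coeff (x_var b * ?R) ?e = mfps_coeff ?R ?r"
    by (simp add: mfps_coeff_var_mult lookup_add)
  moreover have "mfps_coeff ?R ?r = 1" using insert.prems by (intro insert.IH) auto
  ultimately show ?case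
    using insert.hyps p by (simp add: left_diff_distrib)
qed

lemma vdm_weight:
  fixes w :: "nat \<Rightarrow> int"
  assumes "\<And>a b. 1 \<le> a \<Longrightarrow> a < b \<Longrightarrow> b \<le> m \<Longrightarrow> w a \<le> w b" "mfps_coeff (vdm m) \<kappa> \<noteq> 0"
  shows "(\<Sum>j = 1..m. w j * (int (lookup \<kappa> (Inl j)) - (int j - 1))) \<le> 0"
proof -
  have "(\<Sum>j = 1..m. w j * int (lookup \<kappa> (Inl j))) \<le> (\<Sum>(b, a)\<in>pairs m. w b)"
    using assms by (intro prod_diff_weight) (auto simp: pairs_iff vdm_def)
  also have "\<dots> = (\<Sum>j = 1..m. w j * (int j - 1))"
    unfolding sum_pairs by (intro sum.cong) (auto simp: of_nat_diff)
  finally show ?thesis by (simp add: right_diff_distrib sum_subtractf)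
qed

lemma vdm_lead: "mfps_coeff (vdm m) (rho m) = 1"
  unfolding vdm_def rho_def by (rule prod_diff_lead[where m = m]) (auto simp: pairs_iff)

lemma only_vars_vdm: "only_vars (Inl ` {1..m}) (vdm m)"
  unfolding vdm_def
  by (intro only_vars_prod) (auto simp: pairs_iff intro!: only_vars_diff only_vars_var)

lemma only_vars_vdm': "only_vars (range Inl) (vdm m)"
  using only_vars_vdm[of m] unfolding only_vars_def by blast

lemma xhom_x_var: "xhom 1 (x_var i)"
  using xhom_var[of "Inl i :: nat + nat"] by simp

lemma xhom_vdm: "xhom (card (pairs m)) (vdm m)"
proof -
  have "xhom (\<Sum>p\<in>pairs m. 1) (vdm m)"
    unfolding vdm_def case_prod_unfold by (intro xhom_prod xhom_diff xhom_x_var)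
  then show ?thesis by simp
qed

lemma vdm_cancel:
  assumes "vdm m * f = 0"
  shows "f = 0"
proof -
  have "f = 0" if "finite I" "I \<subseteq> pairs m" "(\<Prod>(b, a)\<in>I. x_var b - x_var a) * f = 0" for I
    using that
  proof (induction I rule: finite_induct)
    case (insert p I)
    obtain b a where p: "p = (b, a)" by (cases p)
    have "(x_var b - x_var a) * ((\<Prod>(b, a)\<in>I. x_var b - x_var a) * f) = 0"
      using insert p by (simp add: mult.assoc)
    then have "(\<Prod>(b, a)\<in>I. x_var b - x_var a) * f = 0"
      by (rule var_diff_cancel[rotated]) (use insert.prems p in \<open>auto simp: pairs_iff\<close>)
    then show ?case using insert by simp
  qed simp
  from this[of "pairs m"] assms show ?thesis by (simp add: vdm_def)
qed

lemma vdm_antisym: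
  assumes "1 \<le> i" "i < m"
  shows "vswap (Inl i) (Inl (Suc i)) (vdm m) = - vdm m"
proof -
  let ?s = "transpose i (Suc i)" and ?I = "pairs m - {(Suc i, i)}"
  let ?R = "\<Prod>(b, a)\<in>?I. x_var b - x_var a"
  have mem: "(?s b, ?s a) \<in> ?I" if "(b, a) \<in> ?I" for a b
    using that assms by (auto simp: pairs_iff transpose_def split: if_splits)
  have t: "transpose (Inl i) (Inl (Suc i)) (Inl j) = (Inl (?s j) :: nat + nat)" for j
    by (auto simp: transpose_def)
  have "vswap (Inl i) (Inl (Suc i)) ?R = (\<Prod>(b, a)\<in>?I. x_var (?s b) - x_var (?s a))"
    by (simp add: vswap_prod case_prod_unfold vswap_diff vswap_var t)
  also have "\<dots> = ?R"
    by (intro prod.reindex_bij_witness[of _ "\<lambda>(b, a). (?s b, ?s a)" "\<lambda>(b, a). (?s b, ?s a)"])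
      (use mem in auto)
  finally have R: "vswap (Inl i) (Inl (Suc i)) ?R = ?R" .
  have "vdm m = (x_var (Suc i) - x_var i) * ?R"
    unfolding vdm_def using assms by (subst prod.remove[of _ "(Suc i, i)"]) (auto simp: pairs_iff)
  then show ?thesis by (simp add: vswap_mult R vswap_diff vswap_var left_diff_distrib)
qed

text \<open>An operator in y does not mix different exponents of x and commutes with multiplication
  by a series in x alone; hence a slice of given x exponents that is 0 stays 0.\<close>

lemma slice_zero:
  fixes f P V :: "(nat + nat) mfps"
  assumes "pi_rel (Inr k) (Inr (Suc k)) f P" "only_vars (range Inl) V"
    and 0: "\<And>e'. (\<And>j. lookup e' (Inl j) = lookup e (Inl j)) \<Longrightarrow> mfps_coeff (V * f) e' = 0"
  shows "mfps_coeff (V * P) e = 0"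
proof -
  let ?Z = "\<lambda>e' :: nat + nat \<Rightarrow>\<^sub>0 nat. \<forall>j. lookup e' (Inl j) = lookup e (Inl j)"
  have V: "vswap (Inr k) (Inr (Suc k)) V = V"
  proof (rule mfps_eqI)
    fix m :: "nat + nat \<Rightarrow>\<^sub>0 nat"
    let ?m = "map_key (transpose (Inr k) (Inr (Suc k))) m"
    show "mfps_coeff (vswap (Inr k) (Inr (Suc k)) V) m = mfps_coeff V m"
    proof (cases "keys m \<subseteq> range Inl")
      case True
      have "lookup m (Inr j) = 0" for j
        using True by (metis in_keys_iff imageE sum.distinct(1) subsetD)
      then have "?m = m"
        by (intro poly_mapping_eqI) (auto simp: transpose_def)
      then show ?thesis by (simp add: coeff_vswap)
    next
      case False
      then obtain j where j: "lookup m (Inr j) \<noteq> 0"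
        by (metis (no_types, lifting) in_keys_iff rangeI subsetI sum.exhaust)
      have "lookup ?m (Inr (transpose k (Suc k) j)) \<noteq> 0"
        using j by (auto simp: transpose_def)
      then have "\<not> keys ?m \<subseteq> range Inl"
        by (metis in_keys_iff imageE sum.distinct(1) subsetD)
      then show ?thesis using False assms(2) by (simp add: coeff_vswap only_vars_def) metis
    qed
  qed
  have "pi_rel (Inr k) (Inr (Suc k)) (V * f) (V * P)"
    using pi_rel_mult[OF V assms(1)] by (simp add: mult.commute)
  then have "pi_rel (Inr k) (Inr (Suc k)) (restr ?Z (V * f)) (restr ?Z (V * P))"
    by (rule pi_rel_restr[where Z' = ?Z]) (auto simp: transpose_def lookup_add lookup_single)
  moreover have "restr ?Z (V * f) = 0"
    using 0 by (intro mfps_eqI) auto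
  ultimately have "pi_rel (Inr k) (Inr (Suc k)) 0 (restr ?Z (V * P))" by simp
  then have "restr ?Z (V * P) = 0"
    by (rule pi_rel_unique[OF _ _ pi_rel_0, rotated]) simp
  then have "mfps_coeff (restr ?Z (V * P)) e = 0" by simp
  then show ?thesis by simp
qed

text \<open>The coefficient of \<open>vdm m * D\<close> at an exponent with an adjacent weak descent \<open>(a, b)\<close> is
  expressed through those at \<open>(b, a)\<close> and \<open>(b - 1, a + 1)\<close>.\<close>

lemma kernel_zero:
  assumes rel: "\<And>i. 1 \<le> i \<Longrightarrow> i < m \<Longrightarrow>
      \<exists>P. pi_rel (Inl i) (Inl (Suc i)) D P \<and> pi_rel (Inr (m - i)) (Inr (Suc (m - i))) D P"
    and zero: "\<And>e. (\<And>i. 1 \<le> i \<Longrightarrow> i < m \<Longrightarrow> lookup e (Inl i) < lookup e (Inl (Suc i)))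
      \<Longrightarrow> mfps_coeff (vdm m * D) e = 0"
  shows "D = 0"
proof -
  \<comment> \<open>\<open>V\<close> decreases when degree moves from \<open>x_var i\<close> to
    \<open>x_var (Suc i)\<close>. It ignores the exponents of y, so the induction hypothesis covers
    whole slices, as \<open>slice_zero\<close> requires.\<close>
  define V where "V e = (\<Sum>j = 1..m. (m - j) * lookup e (Inl j))" for e :: "nat + nat \<Rightarrow>\<^sub>0 nat"
  have "mfps_coeff (vdm m * D) e = 0" for e
  proof (induction "V e" arbitrary: e rule: less_induct)
    case less
    show ?case
    proof (cases "\<forall>i. 1 \<le> i \<and> i < m \<longrightarrow> lookup e (Inl i) < lookup e (Inl (Suc i))")
      case True
      then show ?thesis by (intro zero) auto
    next
      case False
      then obtain i where i: "1 \<le> i" "i < m" "lookup e (Inl (Suc i)) \<le> lookup e (Inl i)"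
        by (auto simp: not_less)
      obtain P where P: "pi_rel (Inl i) (Inl (Suc i)) D P" "pi_rel (Inr (m - i)) (Inr (Suc (m - i))) D P"
        using rel[OF i(1,2)] by blast
      let ?u = "Inl i :: nat + nat" and ?v = "Inl (Suc i) :: nat + nat"
      have uv: "?u \<noteq> ?v" by simp
      obtain \<eta> s t where e: "e = line ?u ?v \<eta> s t" "lookup \<eta> ?u = 0" "lookup \<eta> ?v = 0"
        "t \<le> s" "lookup e ?u = t" "lookup e ?v = s - t"
        using uv by (rule line_cases)
      let ?l = "line ?u ?v \<eta> s"
      have st: "s - t \<le> t" using i e by simp
      have Vl: "V (?l t') = (\<Sum>j\<in>{1..m} - {i, Suc i}. (m - j) * lookup \<eta> (Inl j))
          + (m - i) * t' + (m - Suc i) * (s - t')" for t'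
      proof -
        have m: "{1..m} = insert i (insert (Suc i) ({1..m} - {i, Suc i}))" using i by auto
        have "(\<Sum>j\<in>{1..m} - {i, Suc i}. (m - j) * lookup (?l t') (Inl j))
          = (\<Sum>j\<in>{1..m} - {i, Suc i}. (m - j) * lookup \<eta> (Inl j))"
          by (rule sum.cong) (auto simp: lookup_line)
        then show ?thesis unfolding V_def using e by (subst m) (simp add: lookup_line)
      qed
      have less_V: "V (?l t') < V e" if "t' < t" for t'
      proof -
        obtain k where k: "m - i = Suc k" "m - Suc i = k" using i by (metis Suc_diff_Suc)
        from less_imp_Suc_add[OF that] obtain d where d: "t = t' + Suc d" by auto
        have "Suc k * t' + k * (s - t') < Suc k * t + k * (s - t)"
        proof -
          have "s - t' = (s - t) + Suc d" using d e(4) by simp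
          then show ?thesis unfolding d by (simp add: algebra_simps)
        qed
        then show ?thesis unfolding e(1) Vl k by simp
      qed
      \<comment> \<open>The operator in y transfers the vanishing from D to P, and this is the same
        P that the operator in x produces.\<close>
      have EQ: "mfps_coeff (vdm m * D) e' = 0 \<and> mfps_coeff (vdm m * P) (?l t') = 0"
        if "t' < t" "\<And>j. lookup e' (Inl j) = lookup (?l t') (Inl j)" for e' t'
      proof -
        have E: "mfps_coeff (vdm m * D) e'' = 0"
          if "\<And>j. lookup e'' (Inl j) = lookup (?l t') (Inl j)" for e''
        proof (rule less.hyps)
          have "V e'' = V (?l t')" unfolding V_def by (simp add: that)
          then show "V e'' < V e" using less_V[OF \<open>t' < t\<close>] by simp
        qed
        then show ?thesis using that slice_zero[OF P(2) only_vars_vdm'] by blast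
      qed
      note lin = pi_rel_antisym_line[OF uv e(2,3) P(1) vdm_antisym[OF i(1,2)]]
      \<comment> \<open>Either the reflected position is already known to give 0, or the position is
        its own reflection.\<close>
      have Q0: "mfps_coeff (vdm m * P) (?l t') = 0" if "s - t' < t \<or> s - t' = t'" "t' \<le> s" for t'
        using that(1)
      proof
        assume "s - t' < t"
        then have "mfps_coeff (vdm m * P) (?l (s - t')) = 0" using EQ by blast
        then show ?thesis using lin(3)[OF that(2)] by simp
      next
        assume "s - t' = t'"
        then show ?thesis using lin(3)[OF that(2)] by simp
      qed
      have Qt: "mfps_coeff (vdm m * P) (?l t) = 0" using st e(4) by (intro Q0) auto
      show ?thesis
      proof (cases "t = s")
        case True
        then show ?thesis using lin(2) Qt e(1) by simp
      next
        case False
        then have ts: "t < s" using e(4) by simp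
        have "mfps_coeff (vdm m * P) (?l (Suc t)) = 0" using ts st by (intro Q0) auto
        moreover have "mfps_coeff (vdm m * D) (?l (s - Suc t)) = 0"
          using EQ[of "s - Suc t" "?l (s - Suc t)"] ts st by auto
        ultimately show ?thesis using lin(1)[OF ts] Qt e(1) by simp
      qed
    qed
  qed
  then have "vdm m * D = 0" by (intro mfps_eqI) simp
  then show ?thesis by (rule vdm_cancel)
qed

section \<open>Duality between atoms and antidominant monomials\<close>

text \<open>The squared distance from \<open>rho m\<close>. Since consecutive entries of
  \<open>rho m\<close> differ by one, its centre on a line is (s - 1) / 2, as in
  \<open>antisym_vanish\<close>.\<close>

definition shifted_nrm :: "nat \<Rightarrow> (nat + nat \<Rightarrow>\<^sub>0 nat) \<Rightarrow> int" where
  "shifted_nrm m e = (\<Sum>j = 1..m. (int (lookup e (Inl j)) - (int j - 1))\<^sup>2)"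

lemma shifted_nrm_line_le:
  assumes "1 \<le> i" "i < m" "lookup \<eta> (Inl i) = 0" "lookup \<eta> (Inl (Suc i)) = 0"
    and "t \<le> s" "t' \<le> s" "\<bar>2 * int t - int s + 1\<bar> \<le> \<bar>2 * int t' - int s + 1\<bar>"
  shows "shifted_nrm m (line (Inl i) (Inl (Suc i)) \<eta> s t) \<le> shifted_nrm m (line (Inl i) (Inl (Suc i)) \<eta> s t')"
proof -
  let ?l = "line (Inl i) (Inl (Suc i)) \<eta> s"
  let ?r = "\<Sum>j\<in>{1..m} - {i, Suc i}. (int (lookup \<eta> (Inl j)) - (int j - 1))\<^sup>2"
  have m: "{1..m} = insert i (insert (Suc i) ({1..m} - {i, Suc i}))" using assms by auto
  have "2 * shifted_nrm m (?l t) = 2 * ?r + (int s - 2 * int i + 1)\<^sup>2 + (2 * int t - int s + 1)\<^sup>2" if "t \<le> s" for t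
  proof -
    have "(\<Sum>j\<in>{1..m} - {i, Suc i}. (int (lookup (?l t) (Inl j)) - (int j - 1))\<^sup>2) = ?r"
      by (rule sum.cong) (auto simp: lookup_line)
    then have "shifted_nrm m (?l t) = ?r + (int t - (int i - 1))\<^sup>2 + (int s - int t - int i)\<^sup>2"
      unfolding shifted_nrm_def using assms that by (subst m) (simp add: lookup_line of_nat_diff)
    then show ?thesis by (simp add: power2_eq_square algebra_simps)
  qed
  moreover have "(2 * int t - int s + 1)\<^sup>2 \<le> (2 * int t' - int s + 1)\<^sup>2"
    using assms(7) abs_le_square_iff by blast
  ultimately show ?thesis using assms(5,6) by smt
qed

lemma sum_square_add:
  fixes f g :: "'a \<Rightarrow> int"
  shows "(\<Sum>j\<in>A. (f j + g j)\<^sup>2) = (\<Sum>j\<in>A. (f j)\<^sup>2) + 2 * (\<Sum>j\<in>A. f j * g j) + (\<Sum>j\<in>A. (g j)\<^sup>2)"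
  by (simp add: power2_sum sum.distrib sum_distrib_left mult.assoc)

text \<open>The next two lemmas compare norms. The coefficients of \<open>vdm m\<close> times the atom at an exponent are
  combinations of coefficients of \<open>vdm m\<close> times the dominant monomial at exponents of no larger shifted
  norm, and there the exponents of \<open>vdm m\<close> only increase the norm. This settles the case that \<open>a\<close> has
  smaller norm than \<open>\<beta>\<close>. Otherwise the exponents of \<open>vdm m\<close> lead to monomials of the atom of norm at
  least that of \<open>a\<close>, while no monomial of the atom has larger norm than \<open>\<beta>\<close>.\<close>

lemma vdm_atom_zero:
  assumes "length \<beta> = m" "shifted_nrm m e < nrm (expo \<beta>)"
  shows "mfps_coeff (vdm m * in_x (atom \<beta>)) e = 0"
  using assms
proof (induction \<beta> arbitrary: e rule: atom_induct)
  case (dominant \<beta>)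
  show ?case
  proof (rule ccontr)
    assume "mfps_coeff (vdm m * in_x (atom \<beta>)) e \<noteq> 0"
    then obtain \<kappa> b where \<kappa>: "e = \<kappa> + b" "mfps_coeff (vdm m) \<kappa> \<noteq> 0" "mfps_coeff (in_x (atom \<beta>)) b \<noteq> 0"
      by (rule mfps_coeff_mult_nonzero)
    have b: "b = expo \<beta>"
      using \<kappa>(3) dominant.hyps by (simp add: atom_dominant in_x_x_power coeff_monom split: if_splits)
    let ?k = "\<lambda>j. int (lookup \<kappa> (Inl j)) - (int j - 1)"
    \<comment> \<open>The parts decrease, so their negatives are admissible weights.\<close>
    have "(\<Sum>j = 1..m. - int (\<beta> ! (j - 1)) * ?k j) \<le> 0"
    proof (rule vdm_weight[OF _ \<kappa>(2)])
      fix a b assume "1 \<le> a" "a < b" "b \<le> m"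
      then show "- int (\<beta> ! (a - 1)) \<le> - int (\<beta> ! (b - 1))"
        using sorted_wrt_nth_less[OF dominant.hyps, of "a - 1" "b - 1"] dominant.prems by auto
    qed
    then have k: "0 \<le> (\<Sum>j = 1..m. int (\<beta> ! (j - 1)) * ?k j)" by (simp add: sum_negf)
    have "shifted_nrm m e = (\<Sum>j = 1..m. (int (\<beta> ! (j - 1)) + ?k j)\<^sup>2)"
      unfolding shifted_nrm_def using dominant.prems
      by (intro sum.cong) (auto simp: \<kappa>(1) b lookup_add algebra_simps)
    also have "\<dots> = (\<Sum>j = 1..m. (int (\<beta> ! (j - 1)))\<^sup>2) + 2 * (\<Sum>j = 1..m. int (\<beta> ! (j - 1)) * ?k j) + (\<Sum>j = 1..m. (?k j)\<^sup>2)"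
      by (rule sum_square_add)
    also have "\<dots> \<ge> nrm (expo \<beta>)"
      using k sum_nonneg[of "{1..m}" "\<lambda>j. (?k j)\<^sup>2"] dominant.prems by (simp add: nrm_expo)
    finally show False using dominant.prems by simp
  qed
next
  case (ascent \<beta> i)
  let ?u = "Inl i :: nat + nat" and ?v = "Inl (Suc i) :: nat + nat"
  let ?g = "atom (swap_adj i \<beta>)"
  have i: "1 \<le> i" "i < m" using ascent by auto
  have uv: "?u \<noteq> ?v" by simp
  obtain \<eta> s t where e: "e = line ?u ?v \<eta> s t" "lookup \<eta> ?u = 0" "lookup \<eta> ?v = 0"
    "t \<le> s" "lookup e ?u = t" "lookup e ?v = s - t"
    using uv by (rule line_cases)
  have n: "nrm (expo (swap_adj i \<beta>)) = nrm (expo \<beta>)" using ascent by (simp add: expo_swap_adj nrm_map_key)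
  have IH: "mfps_coeff (vdm m * in_x ?g) e' = 0" if "shifted_nrm m e' \<le> shifted_nrm m e" for e'
    using ascent.IH[of e'] ascent.prems that n by simp
  note lin = pi_rel_antisym_line[OF uv e(2,3) pi_rel_in_x vdm_antisym[OF i]]
  have "mfps_coeff (vdm m * in_x (pi_op i ?g)) (line ?u ?v \<eta> s t) = 0"
  proof (rule antisym_vanish[where Q = "\<lambda>t. mfps_coeff (vdm m * in_x (pi_op i ?g)) (line ?u ?v \<eta> s t)"
        and E = "\<lambda>t. mfps_coeff (vdm m * in_x ?g) (line ?u ?v \<eta> s t)"])
    fix t' assume "t' \<le> s" "\<bar>2 * int t' - int s + 1\<bar> \<le> \<bar>2 * int t - int s + 1\<bar>"
    then show "mfps_coeff (vdm m * in_x ?g) (line ?u ?v \<eta> s t') = 0"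
      unfolding e(1) using i e by (intro IH) (auto intro: shifted_nrm_line_le)
  qed (use lin e in auto)
  moreover have "in_x (atom \<beta>) = in_x (pi_op i ?g) - in_x ?g"
    using ascent.hyps by (simp add: atom_ascent[of i] pi_op_def peval_simps)
  ultimately show ?case using IH[of e] e(1) by (simp add: right_diff_distrib)
qed

lemma vdm_atom_dual:
  assumes len: "length \<beta> = m"
    and incr: "\<And>i j. 1 \<le> i \<Longrightarrow> i < j \<Longrightarrow> j \<le> m \<Longrightarrow> lookup a (Inl i) \<le> lookup a (Inl j)"
  shows "mfps_coeff (vdm m * in_x (atom \<beta>)) (rho m + a) = (if a = expo \<beta> then 1 else 0)"
proof -
  let ?na = "\<Sum>j = 1..m. (int (lookup a (Inl j)))\<^sup>2"
  have sn: "shifted_nrm m (rho m + a) = ?na"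
    unfolding shifted_nrm_def by (intro sum.cong) (auto simp: lookup_add of_nat_diff)
  show ?thesis
  proof (cases "?na < nrm (expo \<beta>)")
    case True
    moreover have "a \<noteq> expo \<beta>" using True len by (auto simp: nrm_expo)
    ultimately show ?thesis using vdm_atom_zero[OF len, of "rho m + a"] sn by simp
  next
    case False
    \<comment> \<open>The norm of b exceeds that of a by at least the squared deviation of
      \<open>\<kappa>\<close> from \<open>rho m\<close>. By \<open>coeff_atom\<close> this forces
      \<open>b = expo \<beta>\<close>, and then the deviation is 0.\<close>
    have "\<kappa> = rho m \<and> b = a" if eq: "\<kappa> + b = rho m + a" and nz: "mfps_coeff (vdm m) \<kappa> \<noteq> 0"
      "mfps_coeff (in_x (atom \<beta>)) b \<noteq> 0" for \<kappa> b
    proof -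
      let ?a = "\<lambda>j. int (lookup a (Inl j))"
      let ?k = "\<lambda>j. (int j - 1) - int (lookup \<kappa> (Inl j))"
      have lk: "lookup \<kappa> w + lookup b w
          = lookup (rho m) w + lookup a w" for w
        using arg_cong[OF eq, of "\<lambda>e. lookup e w"] by (simp add: lookup_add)
      have lb: "int (lookup b (Inl j)) = ?a j + ?k j" if "j \<in> {1..m}" for j
        using lk[of "Inl j"] that by auto
      have "(\<Sum>j = 1..m. ?a j * (int (lookup \<kappa> (Inl j)) - (int j - 1))) \<le> 0"
        using incr by (intro vdm_weight[OF _ nz(1)]) auto
      then have w: "0 \<le> (\<Sum>j = 1..m. ?a j * ?k j)"
        by (simp add: right_diff_distrib sum_subtractf)
      have "(\<Sum>j = 1..m. (int (lookup b (Inl j)))\<^sup>2) = (\<Sum>j = 1..m. (?a j + ?k j)\<^sup>2)"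
        by (rule sum.cong) (simp_all add: lb)
      also have "\<dots> = ?na + 2 * (\<Sum>j = 1..m. ?a j * ?k j) + (\<Sum>j = 1..m. (?k j)\<^sup>2)"
        by (rule sum_square_add)
      finally have nb: "(\<Sum>j = 1..m. (int (lookup b (Inl j)))\<^sup>2) \<ge> ?na + (\<Sum>j = 1..m. (?k j)\<^sup>2)"
        using w by simp
      have k0: "0 \<le> (\<Sum>j = 1..m. (?k j)\<^sup>2)" by (rule sum_nonneg) simp
      have "(\<Sum>w\<in>Inl ` {1..m}. (int (lookup b w))\<^sup>2) \<le> nrm b" by (rule nrm_ge_sum) simp
      then have "(\<Sum>j = 1..m. (int (lookup b (Inl j)))\<^sup>2) \<le> nrm b" by (simp add: sum.reindex)
      then have "nrm (expo \<beta>) \<le> nrm b" using nb k0 False by linarith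
      then have b: "b = expo \<beta>" using nz(2) coeff_atom[of \<beta> b] by (simp split: if_splits)
      then have "(\<Sum>j = 1..m. (int (lookup b (Inl j)))\<^sup>2) = nrm (expo \<beta>)"
        by (simp add: nrm_expo len)
      then have "(\<Sum>j = 1..m. (?k j)\<^sup>2) = 0" using nb k0 False by linarith
      then have k: "?k j = 0" if "j \<in> {1..m}" for j
        using that by (subst (asm) sum_nonneg_eq_0_iff) auto
      have "\<kappa> = rho m"
      proof (rule poly_mapping_eqI)
        fix w
        show "lookup \<kappa> w = lookup (rho m) w"
        proof (cases "w \<in> Inl ` {1..m}")
          case True
          then obtain j where "w = Inl j" "j \<in> {1..m}" by blast
          then show ?thesis using k[of j] by auto
        next
          case False
          then have "lookup \<kappa> w = 0"
            using only_vars_vdm[of m] nz(1) by (auto simp: only_vars_def in_keys_iff subset_iff)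
          moreover have "lookup (rho m) w = 0" using False by (cases w) auto
          ultimately show ?thesis by simp
        qed
      qed
      with eq show ?thesis by simp
    qed
    then have "mfps_coeff (vdm m * in_x (atom \<beta>)) (rho m + a)
        = (\<Sum>(\<kappa>, b)\<in>{(rho m, a)}. mfps_coeff (vdm m) \<kappa> * mfps_coeff (in_x (atom \<beta>)) b)"
      unfolding mfps_coeff_mult by (intro sum.mono_neutral_right finite_mon_decomp) auto
    also have "\<dots> = mfps_coeff (in_x (atom \<beta>)) a" by (simp add: vdm_lead)
    also have "\<dots> = (if a = expo \<beta> then 1 else 0)"
    proof (rule coeff_atom)
      have "(\<Sum>w\<in>Inl ` {1..m}. (int (lookup a w))\<^sup>2) \<le> nrm a" by (rule nrm_ge_sum) simp
      then have "?na \<le> nrm a" by (simp add: sum.reindex)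
      with False show "nrm (expo \<beta>) \<le> nrm a" by simp
    qed
    finally show ?thesis .
  qed
qed

section \<open>The staircase kernel\<close>

definition vlt :: "'v \<Rightarrow> nat \<Rightarrow> 'v mfps \<Rightarrow> bool" where
  "vlt v n f \<longleftrightarrow> (\<forall>m. mfps_coeff f m \<noteq> 0 \<longrightarrow> lookup m v < n)"

lemma vlt_0 [simp]: "vlt v n 0" by (simp add: vlt_def)

lemma vlt_diff: "vlt v n f \<Longrightarrow> vlt v n g \<Longrightarrow> vlt v n (f - g)"
  by (force simp: vlt_def)

lemma vlt_mult: "vlt v n f \<Longrightarrow> vlt v (Suc k) g \<Longrightarrow> vlt v (n + k) (f * g)"
proof -
  assume f: "vlt v n f" and g: "vlt v (Suc k) g"
  have "lookup m v < n + k" if "mfps_coeff (f * g) m \<noteq> 0" for m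
  proof -
    from that obtain a b where m: "m = a + b" and ab: "mfps_coeff f a \<noteq> 0" "mfps_coeff g b \<noteq> 0"
      by (rule mfps_coeff_mult_nonzero)
    have "lookup a v < n" "lookup b v < Suc k"
      using ab f g by (simp_all add: vlt_def)
    then show ?thesis by (simp add: m lookup_add)
  qed
  then show ?thesis by (simp add: vlt_def)
qed

lemma vlt_only_vars: "only_vars (- {v}) f \<Longrightarrow> vlt v (Suc 0) f"
  by (auto simp: only_vars_def vlt_def in_keys_iff subset_iff)

lemma vlt_monom: "vlt v (Suc k) (mfps_monom (single v k))"
  by (simp add: vlt_def coeff_monom)

lemma vlt_mono: "vlt v n f \<Longrightarrow> n \<le> k \<Longrightarrow> vlt v k f"
  by (force simp: vlt_def)

lemma only_vars_mono: "only_vars X f \<Longrightarrow> X \<subseteq> Y \<Longrightarrow> only_vars Y f"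
  by (force simp: only_vars_def)

text \<open>The products agree at \<open>y = 1 / X\<close>, and \<open>W\<close> is the quotient of their difference by \<open>1 - X y\<close>.\<close>

lemma prod_diff_mod:
  fixes a :: "'i \<Rightarrow> 'v mfps" and v :: 'v
  defines "X \<equiv> mfps_var v"
  assumes "finite I" "\<And>i. i \<in> I \<Longrightarrow> only_vars (- {v}) (a i)" "only_vars (- {v}) y"
  shows "\<exists>W. (\<Prod>i\<in>I. X - a i) = X ^ card I * (\<Prod>i\<in>I. 1 - a i * y) + (1 - X * y) * W \<and> vlt v (card I) W"
  using assms(2,3)
proof (induction I rule: finite_induct)
  case empty
  show ?case by (rule exI[of _ 0]) simp
next
  case (insert i I)
  then obtain W where W: "(\<Prod>i\<in>I. X - a i) = X ^ card I * (\<Prod>i\<in>I. 1 - a i * y) + (1 - X * y) * W"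
    "vlt v (card I) W" by auto
  let ?P = "\<Prod>i\<in>I. 1 - a i * y"
  \<comment> \<open>From X - a = X (1 - a y) - a (1 - X y).\<close>
  let ?W = "W * (X - a i) - X ^ card I * (a i * ?P)"
  have "only_vars (- {v}) ?P"
    using insert.prems assms(4) by (intro only_vars_prod only_vars_diff only_vars_mult only_vars_1) auto
  then have 1: "vlt v (Suc (card I) + 0) (X ^ card I * (a i * ?P))"
    unfolding X_def var_power_monom using insert.prems
    by (intro vlt_mult vlt_monom vlt_only_vars only_vars_mult) auto
  have "vlt v (Suc (Suc 0)) (X - a i)"
    unfolding X_def using vlt_monom[of v 1] vlt_mono[OF vlt_only_vars[of v "a i"], of "Suc (Suc 0)"] insert.prems
    by (intro vlt_diff) (simp_all add: var_power_monom[symmetric])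
  then have "vlt v (card I + Suc 0) (W * (X - a i))" using W(2) by (rule vlt_mult[rotated])
  with 1 have lt: "vlt v (Suc (card I)) ?W" by (intro vlt_diff) simp_all
  have "(\<Prod>i\<in>insert i I. X - a i) = (X - a i) * (X ^ card I * ?P + (1 - X * y) * W)"
    using insert.hyps W(1) by simp
  also have "\<dots> = X ^ Suc (card I) * ((1 - a i * y) * ?P) + (1 - X * y) * ?W"
    by (simp add: algebra_simps)
  finally show ?case using lt insert.hyps by (intro exI[of _ ?W]) simp
qed

lemma keys_add_nat: "keys (a + b :: 'v \<Rightarrow>\<^sub>0 nat) = keys a \<union> keys b"
  by (auto simp: in_keys_iff lookup_add)

text \<open>Multiplication by 1 - x y preserves the part of a series that involves foreign
  variables. For \<open>geo\<close> this part is sent to that of 1, which is 0, and the factor can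
  be cancelled.\<close>

lemma only_vars_geo:
  assumes "Inl i \<in> X" "Inr j \<in> X"
  shows "only_vars X (geo i j)"
proof -
  let ?Z = "\<lambda>m. \<not> keys m \<subseteq> X"
  let ?h = "1 - x_var i * y_var j"
  have h: "only_vars X ?h" using assms by (intro only_vars_diff only_vars_mult only_vars_var only_vars_1)
  have "restr ?Z (?h * geo i j) = ?h * restr ?Z (geo i j)"
    using h by (intro restr_mult) (auto simp: only_vars_def keys_add_nat)
  moreover have "restr ?Z 1 = 0"
    by (rule mfps_eqI) (simp add: mfps_coeff_1)
  ultimately have "?h * restr ?Z (geo i j) = ?h * 0" by (simp add: geo_eq)
  then have "restr ?Z (geo i j) = 0" by (rule geo_cancel)
  then have "mfps_coeff (restr ?Z (geo i j)) m = 0" for m by simp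
  then show ?thesis unfolding only_vars_def coeff_restr by metis
qed

definition tri :: "nat \<Rightarrow> (nat \<times> nat) set" where
  "tri m = {(i, j). 1 \<le> i \<and> 1 \<le> j \<and> i + j \<le> Suc m}"

text \<open>The shift \<open>s\<close> of the variables \<open>y\<close> is needed for the induction on \<open>m\<close>, which splits off the first column.\<close>

definition tri_kern :: "nat \<Rightarrow> nat \<Rightarrow> (nat + nat) mfps" where
  "tri_kern m s = (\<Prod>(i, j)\<in>tri m. geo i (j + s))"

lemma finite_tri [simp]: "finite (tri m)"
  by (rule finite_subset[of _ "{..Suc m} \<times> {..Suc m}"]) (auto simp: tri_def)

lemma kern_tri: "kern (tri m) = tri_kern m 0"
  by (simp add: kern_def tri_kern_def)

lemma tri_kern_Suc: "tri_kern (Suc m) s = (\<Prod>i = 1..Suc m. geo i (Suc s)) * tri_kern m (Suc s)"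
proof -
  let ?A = "(\<lambda>i. (i, 1)) ` {1..Suc m}" and ?B = "(\<lambda>(i, j). (i, Suc j)) ` tri m"
  have t: "tri (Suc m) = ?A \<union> ?B"
  proof (intro equalityI subsetI)
    fix p assume "p \<in> tri (Suc m)"
    then obtain i j where p: "p = (i, j)" "1 \<le> i" "1 \<le> j" "i + j \<le> Suc (Suc m)" by (auto simp: tri_def)
    show "p \<in> ?A \<union> ?B"
    proof (cases "j = 1")
      case False
      then have "(i, j - 1) \<in> tri m" "p = (\<lambda>(i, j). (i, Suc j)) (i, j - 1)" using p by (auto simp: tri_def)
      then show ?thesis by blast
    qed (use p in auto)
  qed (auto simp: tri_def)
  have "tri_kern (Suc m) s = (\<Prod>(i, j)\<in>?A. geo i (j + s)) * (\<Prod>(i, j)\<in>?B. geo i (j + s))"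
    unfolding tri_kern_def t by (rule prod.union_disjoint) (simp, simp, auto simp: tri_def)
  also have "(\<Prod>(i, j)\<in>?A. geo i (j + s)) = (\<Prod>i = 1..Suc m. geo i (Suc s))"
    by (subst prod.reindex) (auto simp: inj_on_def)
  also have "(\<Prod>(i, j)\<in>?B. geo i (j + s)) = tri_kern m (Suc s)"
    unfolding tri_kern_def by (subst prod.reindex) (auto simp: inj_on_def intro!: prod.cong)
  finally show ?thesis .
qed

lemma vdm_Suc: "vdm (Suc m) = vdm m * (\<Prod>i = 1..m. x_var (Suc m) - x_var i)"
proof -
  have p: "pairs (Suc m) = pairs m \<union> Pair (Suc m) ` {1..m}"
    by (auto simp: pairs_iff less_Suc_eq_le le_Suc_eq)
  show ?thesis
    unfolding vdm_def p
    by (subst prod.union_disjoint) (auto simp: pairs_iff prod.reindex inj_on_def)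
qed

lemma rho_Suc: "rho (Suc m) = rho m + single (Inl (Suc m)) m"
proof (rule poly_mapping_eqI)
  fix w show "lookup (rho (Suc m)) w
    = lookup (rho m + single (Inl (Suc m)) m) w"
    by (cases w) (auto simp: lookup_add lookup_single when_def)
qed

text \<open>Strictly increasing exponents satisfy this. Cutting down to it removes the remainders of
  \<open>prod_diff_mod\<close>, whose degree in the last variable x is too small.\<close>

definition ge_rho :: "nat \<Rightarrow> (nat + nat \<Rightarrow>\<^sub>0 nat) \<Rightarrow> bool" where
  "ge_rho m e \<longleftrightarrow> (\<forall>j\<in>{1..m}. j - 1 \<le> lookup e (Inl j))"

text \<open>The last variable X occurs in the staircase only at the bottom of the first column.
  Modulo 1 - X y the new Vandermonde factor becomes a power of X times the denominators of all other
  boxes of that column, and cancels them. Iterating leaves one factor for each row, that of its last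
  box.\<close>

lemma vdm_tri_kern:
  "restr (ge_rho m) (vdm m * tri_kern m s)
    = restr (ge_rho m) (mfps_monom (rho m) * (\<Prod>j = 1..m. geo j (Suc m - j + s)))"
proof (induction m arbitrary: s)
  case 0
  have "rho 0 = 0" "tri 0 = {}" by (auto simp: rho_def pairs_def tri_def)
  then show ?case by (simp add: vdm_def pairs_def tri_kern_def)
next
  case (Suc m)
  let ?M = "Suc m" and ?y = "y_var (Suc s)"
  let ?X = "x_var ?M" and ?G = "geo ?M (Suc s)" and ?A = "\<Prod>i = 1..m. geo i (Suc s)" and ?F = "tri_kern m (Suc s)"
  let ?P = "\<Prod>i = 1..m. 1 - x_var i * ?y"
  have "\<exists>W. (\<Prod>i\<in>{1..m}. ?X - x_var i) = ?X ^ card {1..m} * (\<Prod>i\<in>{1..m}. 1 - x_var i * ?y) + (1 - ?X * ?y) * W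
      \<and> vlt (Inl ?M) (card {1..m}) W"
    by (rule prod_diff_mod) auto
  then obtain W where W: "(\<Prod>i = 1..m. ?X - x_var i) = ?X ^ m * ?P + (1 - ?X * ?y) * W" "vlt (Inl ?M) m W"
    by auto
  have PA: "?P * ?A = 1"
    by (subst prod.distrib[symmetric]) (simp add: geo_eq)
  have GA: "(\<Prod>i = 1..Suc m. geo i (Suc s)) = ?G * ?A" by (simp add: mult.commute)
  have "vdm ?M * tri_kern ?M s = (vdm m * (?X ^ m * ?P + (1 - ?X * ?y) * W)) * (?G * ?A * ?F)"
    by (simp only: vdm_Suc W(1) tri_kern_Suc GA mult_ac)
  also have "\<dots> = (?X ^ m * ?G) * (vdm m * ?F) * (?P * ?A) + ((1 - ?X * ?y) * ?G) * (W * (vdm m * ?F * ?A))"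
    by (simp only: distrib_left distrib_right mult_ac)
  also have "\<dots> = (?X ^ m * ?G) * (vdm m * ?F) + W * (vdm m * ?F * ?A)"
    by (simp only: PA geo_eq mult_1_left mult_1_right)
  finally have eq: "vdm ?M * tri_kern ?M s = (?X ^ m * ?G) * (vdm m * ?F) + W * (vdm m * ?F * ?A)" .
  have "only_vars (- {Inl ?M}) (vdm m * ?F * ?A)"
    unfolding tri_kern_def case_prod_unfold
    by (intro only_vars_mult only_vars_prod only_vars_geo only_vars_mono[OF only_vars_vdm]) (auto simp: tri_def)
  then have "vlt (Inl ?M) (m + 0) (W * (vdm m * ?F * ?A))"
    by (intro vlt_mult W(2) vlt_only_vars)
  \<comment> \<open>The remainder has degree below m in X, while \<open>ge_rho\<close> requires at
    least m.\<close>
  then have r0: "restr (ge_rho ?M) (W * (vdm m * ?F * ?A)) = 0"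
    by (intro mfps_eqI) (force simp: vlt_def ge_rho_def)
  have h: "only_vars {Inl ?M, Inr (Suc s)} (?X ^ m * ?G)"
    by (intro only_vars_mult only_vars_power only_vars_var only_vars_geo) auto
  have rh: "restr (ge_rho m) ((?X ^ m * ?G) * f) = (?X ^ m * ?G) * restr (ge_rho m) f" for f
  proof (rule restr_mult)
    fix a b assume "mfps_coeff (?X ^ m * ?G) b \<noteq> 0"
    then have "keys b \<subseteq> {Inl ?M, Inr (Suc s)}" using h by (simp add: only_vars_def)
    then have "lookup b (Inl j) = 0" if "j \<in> {1..m}" for j
      using that by (auto simp: in_keys_iff subset_iff)
    then show "ge_rho m (b + a) \<longleftrightarrow> ge_rho m a" by (simp add: ge_rho_def lookup_add)
  qed
  have rr: "restr (ge_rho ?M) f = restr (ge_rho ?M) (restr (ge_rho m) f)" for f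
    by (rule mfps_eqI) (auto simp: ge_rho_def)
  have "restr (ge_rho ?M) (vdm ?M * tri_kern ?M s) = restr (ge_rho ?M) ((?X ^ m * ?G) * (vdm m * ?F))"
    by (simp only: eq restr_add r0 add_0_right)
  also have "\<dots> = restr (ge_rho ?M) ((?X ^ m * ?G) * (mfps_monom (rho m) * (\<Prod>j = 1..m. geo j (Suc m - j + Suc s))))"
    using rr[of "(?X ^ m * ?G) * (vdm m * ?F)"]
      rr[of "(?X ^ m * ?G) * (mfps_monom (rho m) * (\<Prod>j = 1..m. geo j (Suc m - j + Suc s)))"]
    by (simp add: rh Suc.IH)
  also have "(?X ^ m * ?G) * (mfps_monom (rho m) * (\<Prod>j = 1..m. geo j (Suc m - j + Suc s)))
    = mfps_monom (rho ?M) * (\<Prod>j = 1..?M. geo j (Suc ?M - j + s))"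
  proof -
    have "(\<Prod>j = 1..m. geo j (Suc m - j + Suc s)) = (\<Prod>j = 1..m. geo j (Suc ?M - j + s))"
      by (rule prod.cong) (auto simp: Suc_diff_le)
    then show ?thesis
      by (simp add: rho_Suc monom_add var_power_monom mult_ac)
  qed
  finally show ?case .
qed

text \<open>In this product of geometric series each \<open>x_var j\<close> has the same exponent as
  its partner, and these exponents are free because \<open>\<tau>\<close> is injective. The proof
  multiplies the series H of the claimed coefficients by one denominator at a time.\<close>

lemma coeff_prod_geo:
  assumes "finite J" "inj_on \<tau> J"
  shows "mfps_coeff (\<Prod>j\<in>J. geo j (\<tau> j)) a =
    (if (\<forall>j\<in>J. lookup a (Inl j) = lookup a (Inr (\<tau> j)))
       \<and> (\<forall>j. j \<notin> J \<longrightarrow> lookup a (Inl j) = 0)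
       \<and> (\<forall>k. k \<notin> \<tau> ` J \<longrightarrow> lookup a (Inr k) = 0) then 1 else 0)"
proof -
  define cond where "cond J a \<longleftrightarrow> (\<forall>j\<in>J. lookup a (Inl j) = lookup a (Inr (\<tau> j)))
       \<and> (\<forall>j. j \<notin> J \<longrightarrow> lookup a (Inl j) = 0)
       \<and> (\<forall>k. k \<notin> \<tau> ` J \<longrightarrow> lookup a (Inr k) = 0)" for J and a :: "nat + nat \<Rightarrow>\<^sub>0 nat"
  define H where "H J = Abs_mfps (\<lambda>a. if cond J a then 1 else 0)" for J
  have "(\<Prod>j\<in>J. geo j (\<tau> j)) = H J"
    using assms
  proof (induction J rule: finite_induct)
    case empty
    show ?case
    proof (rule mfps_eqI)
      fix a :: "nat + nat \<Rightarrow>\<^sub>0 nat"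
      have "cond {} a \<longleftrightarrow> a = 0"
      proof
        assume c: "cond {} a"
        have "lookup a w = 0" for w using c by (cases w) (auto simp: cond_def)
        then show "a = 0" by (intro poly_mapping_eqI) simp
      qed (simp add: cond_def)
      then show "mfps_coeff (\<Prod>j\<in>{}. geo j (\<tau> j)) a = mfps_coeff (H {}) a"
        by (simp add: H_def mfps_coeff_1)
    qed
  next
    case (insert j J)
    have tj: "\<tau> j \<notin> \<tau> ` J" using insert by auto
    have tj': "\<forall>i\<in>J. \<tau> i \<noteq> \<tau> j \<and> i \<noteq> j" using tj insert.hyps by (metis imageI)
    let ?J = "insert j J"
    have "(1 - x_var j * y_var (\<tau> j)) * H ?J = H J"
    proof (rule mfps_eqI)
      fix a :: "nat + nat \<Rightarrow>\<^sub>0 nat"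
      let ?b = "a - single (Inl j) 1 - single (Inr (\<tau> j)) 1"
      let ?x = "lookup a (Inl j)" and ?y = "lookup a (Inr (\<tau> j))"
      have lb: "lookup ?b (Inl i) = (if i = j then ?x - 1 else lookup a (Inl i))"
        "lookup ?b (Inr k) = (if k = \<tau> j then ?y - 1 else lookup a (Inr k))" for i k
        by (auto simp: lookup_minus lookup_single when_def)
      have "mfps_coeff ((1 - x_var j * y_var (\<tau> j)) * H ?J) a
        = mfps_coeff (H ?J) a - (if ?x = 0 \<or> ?y = 0 then 0 else mfps_coeff (H ?J) ?b)"
        by (simp add: left_diff_distrib mult.assoc mfps_coeff_var_mult) (simp add: lookup_minus lookup_single)
      also have "\<dots> = mfps_coeff (H J) a"
      proof -
        have 0: "cond J a \<longrightarrow> ?x = 0 \<and> ?y = 0" using insert.hyps tj by (auto simp: cond_def)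
        consider "?x = 0" "?y = 0" | "?x = 0 \<and> ?y \<noteq> 0 \<or> ?x \<noteq> 0 \<and> ?y = 0" | "?x \<noteq> 0" "?y \<noteq> 0" by blast
        then show ?thesis
        proof cases
          case 1
          then have "cond ?J a \<longleftrightarrow> cond J a" unfolding cond_def by auto metis+
          with 1 show ?thesis by (simp add: H_def)
        next
          case 2
          then have "\<not> cond ?J a" "\<not> cond J a" using 0 by (auto simp: cond_def)
          with 2 show ?thesis by (auto simp: H_def)
        next
          case 3
          then have "cond ?J a \<longleftrightarrow> cond ?J ?b"
            unfolding cond_def lb using tj' by auto
          moreover have "\<not> cond J a" using 0 3 by auto
          ultimately show ?thesis using 3 by (simp add: H_def)
        qed
      qed
      finally show "mfps_coeff ((1 - x_var j * y_var (\<tau> j)) * H ?J) a = mfps_coeff (H J) a" .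
    qed
    moreover have "(1 - x_var j * y_var (\<tau> j)) * (\<Prod>j\<in>?J. geo j (\<tau> j)) = (\<Prod>j\<in>J. geo j (\<tau> j))"
      using insert.hyps by (simp add: mult.assoc[symmetric] geo_eq)
    ultimately have "(1 - x_var j * y_var (\<tau> j)) * (\<Prod>j\<in>?J. geo j (\<tau> j)) = (1 - x_var j * y_var (\<tau> j)) * H ?J"
      using insert by simp
    then show ?case by (rule geo_cancel)
  qed
  then show ?thesis by (simp add: H_def cond_def)
qed

section \<open>Solution of the staircase\<close>

lemma xdeg_expo: "xdeg (expo \<alpha>) = sum_list \<alpha>"
proof -
  have "xdeg (expo \<alpha>) = (\<Sum>j = 1..length \<alpha>. \<alpha> ! (j - 1))"
    by (simp add: expo_def xdeg_sum xdeg_single)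
  also have "\<dots> = sum_list \<alpha>"
    unfolding sum_list_sum_nth by (rule sum.reindex_bij_witness[of _ Suc "\<lambda>i. i - 1"]) auto
  finally show ?thesis .
qed

lemma xdeg_rho: "xdeg (rho m) = card (pairs m)"
  using xhom_vdm[of m] vdm_lead[of m] by (simp add: xhom_def)

definition expo_y :: "nat list \<Rightarrow> nat + nat \<Rightarrow>\<^sub>0 nat" where
  "expo_y \<alpha> = (\<Sum>j = 1..length \<alpha>. single (Inr j) (\<alpha> ! (j - 1)))"

lemma lookup_expo_y [simp]:
  "lookup (expo_y \<alpha>) (Inr j) = (if 1 \<le> j \<and> j \<le> length \<alpha> then \<alpha> ! (j - 1) else 0)"
  "lookup (expo_y \<alpha>) (Inl j) = 0"
  by (auto simp: expo_y_def lookup_sum lookup_single when_def)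

lemma in_y_x_power: "in_y (x_power \<alpha>) = mfps_monom (expo_y \<alpha>)"
  by (simp add: x_power_def expo_y_def peval_prod peval_power peval_var_apply var_power_monom prod_monom)

lemma expo_inject: "length \<alpha> = length \<beta> \<Longrightarrow> expo \<alpha> = expo \<beta> \<Longrightarrow> \<alpha> = \<beta>"
proof (rule nth_equalityI)
  fix i assume len: "length \<alpha> = length \<beta>" and eq: "expo \<alpha> = expo \<beta>" and i: "i < length \<alpha>"
  show "\<alpha> ! i = \<beta> ! i"
    using arg_cong[OF eq, of "\<lambda>e. lookup e (Inl (Suc i))"] len i by simp
qed

lemma finite_comps: "finite {\<alpha>. length \<alpha> = n \<and> sum_list \<alpha> = (d :: nat)}"
proof (rule finite_subset)
  show "{\<alpha>. length \<alpha> = n \<and> sum_list \<alpha> = d} \<subseteq> {xs. set xs \<subseteq> {..d} \<and> length xs = n}"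
    using member_le_sum_list by fastforce
qed (simp add: finite_lists_length_eq)

text \<open>Reversal carries place i to place \<open>length \<alpha> - i\<close> and turns ascents
  into descents.\<close>

lemma upper_rev:
  assumes "1 \<le> i" "i < length \<alpha>"
  shows "upper (length \<alpha> - i) (rev \<alpha>) = rev (lower i \<alpha>)"
proof -
  let ?k = "length \<alpha> - i"
  have k: "rev \<alpha> ! (?k - 1) = \<alpha> ! i" "rev \<alpha> ! ?k = \<alpha> ! (i - 1)"
    using assms by (simp_all add: rev_nth)
  have sw: "swap_adj ?k (rev \<alpha>) ! (?k - 1) = \<alpha> ! (i - 1)" "swap_adj ?k (rev \<alpha>) ! ?k = \<alpha> ! i"
    using nth_swap_adj'(1,2)[of ?k "rev \<alpha>"] assms unfolding k by simp_all
  have "swap_adj ?k (rev \<alpha>) = rev (swap_adj i \<alpha>)"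
  proof (rule nth_equalityI)
    fix j assume "j < length (swap_adj ?k (rev \<alpha>))"
    then have j: "j < length \<alpha>" by simp
    consider "j = ?k - 1" | "j = ?k" | "j \<noteq> ?k - 1" "j \<noteq> ?k" by blast
    then show "swap_adj ?k (rev \<alpha>) ! j = rev (swap_adj i \<alpha>) ! j"
    proof cases
      case 1
      then have "rev (swap_adj i \<alpha>) ! j = swap_adj i \<alpha> ! i" using assms by (simp add: rev_nth)
      then show ?thesis using assms 1 sw(1) by simp
    next
      case 2
      then have "rev (swap_adj i \<alpha>) ! j = swap_adj i \<alpha> ! (i - 1)" using assms by (simp add: rev_nth)
      then show ?thesis using assms 2 sw(2) by simp
    next
      case 3
      have "rev (swap_adj i \<alpha>) ! j = swap_adj i \<alpha> ! (length \<alpha> - Suc j)" using j by (simp add: rev_nth)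
      also have "\<dots> = \<alpha> ! (length \<alpha> - Suc j)" using 3 j assms by (intro nth_swap_adj_other) linarith+
      finally show ?thesis using 3 j by (simp add: rev_nth)
    qed
  qed simp
  then show ?thesis using k by (simp add: upper_def lower_def)
qed

text \<open>In the staircase rows i and i + 1 have lengths m + 1 - i and m - i, while columns m - i
  and m - i + 1 have lengths i + 1 and i. So this operator and the one of
  \<open>pi_rel_y_tri\<close> add the same box, which is the source of the relations between x and
  y.\<close>

lemma pi_rel_x_tri:
  assumes "1 \<le> i" "i < m"
  shows "pi_rel (Inl i) (Inl (Suc i)) (kern (tri m)) (kern (insert (Suc i, Suc m - i) (tri m)))"
  by (rule pi_rel_x_kern[OF finite_tri]) (use assms in \<open>auto simp: tri_def transpose_def split: if_splits\<close>)

lemma pi_rel_y_tri: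
  assumes "1 \<le> i" "i < m"
  shows "pi_rel (Inr (m - i)) (Inr (Suc (m - i))) (kern (tri m)) (kern (insert (Suc i, Suc m - i) (tri m)))"
proof -
  have "Suc m - i = Suc (m - i)" using assms by simp
  then show ?thesis
    by (simp only:, intro pi_rel_y_kern[OF finite_tri])
      (use assms in \<open>auto simp: tri_def transpose_def split: if_splits\<close>)
qed

text \<open>Subtracting \<open>rho m\<close> from e leaves a weakly increasing exponent. On the
  left, \<open>vdm_tri_kern\<close> gives 1 exactly when the exponents of y reverse those of x in
  degree d. On the right, duality leaves at most one composition; its reversal is dominant, so its
  key polynomial is a single monomial.\<close>

lemma coeff_staircase_lead:
  fixes d m :: nat
  assumes incr: "\<And>i. 1 \<le> i \<Longrightarrow> i < m \<Longrightarrow> lookup e (Inl i) < lookup e (Inl (Suc i))"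
  defines "C \<equiv> {\<alpha>. length \<alpha> = m \<and> sum_list \<alpha> = d}"
  shows "mfps_coeff (vdm m * xc d (kern (tri m))) e
    = mfps_coeff (vdm m * (\<Sum>\<alpha>\<in>C. in_x (atom \<alpha>) * in_y (key_poly (rev \<alpha>)))) e"
proof -
  \<comment> \<open>Strict increase from place to place gives an entry of at least j - 1 at place j,
    so that \<open>rho m\<close> can be subtracted.\<close>
  have grow: "lookup e (Inl i) + (j - i) \<le> lookup e (Inl j)"
    if "1 \<le> i" "i \<le> j" "j \<le> m" for i j
    using that(2,3)
  proof (induction rule: dec_induct)
    case (step k)
    then show ?case using incr[of k] that(1) by simp
  qed simp
  have ge: "j - 1 \<le> lookup e (Inl j)" if "1 \<le> j" "j \<le> m" for j
    using grow[of 1 j] that by simp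
  define a where "a = e - rho m"
  have e: "e = rho m + a"
  proof (rule poly_mapping_eqI)
    fix w show "lookup e w = lookup (rho m + a) w"
      using ge by (cases w) (auto simp: a_def lookup_add lookup_minus)
  qed
  have la: "lookup e (Inl j) = j - 1 + lookup a (Inl j)" if "1 \<le> j" "j \<le> m" for j
    using that by (simp add: e lookup_add)
  have mon: "lookup a (Inl i) \<le> lookup a (Inl j)" if "1 \<le> i" "i < j" "j \<le> m" for i j
    using grow[of i j] la[of i] la[of j] that by simp
  obtain p q where pq: "a = p + q" "keys p \<subseteq> range Inl" "keys q \<subseteq> range Inr"
    by (rule poly_mapping_split)
  have lp: "lookup p (Inr j) = 0" and lq: "lookup q (Inl j) = 0" for j
    using pq(2,3) by (auto simp: in_keys_iff subset_iff)
  have lap: "lookup a (Inl j) = lookup p (Inl j)"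
    "lookup a (Inr j) = lookup q (Inr j)" for j
    by (simp_all add: pq(1) lookup_add lp lq)
  have xq: "xdeg q = 0" unfolding xdeg_def using pq(3) by (intro sum.neutral) auto
  define dg where "dg \<longleftrightarrow> (\<forall>j\<in>{1..m}. lookup a (Inl j) = lookup a (Inr (Suc m - j)))
       \<and> (\<forall>j. j \<notin> {1..m} \<longrightarrow> lookup a (Inl j) = 0)
       \<and> (\<forall>k. k \<notin> (\<lambda>j. Suc m - j) ` {1..m} \<longrightarrow> lookup a (Inr k) = 0)"
  have "mfps_coeff (vdm m * kern (tri m)) e = mfps_coeff (restr (ge_rho m) (vdm m * kern (tri m))) e"
    using ge by (simp add: ge_rho_def)
  also have "\<dots> = mfps_coeff (mfps_monom (rho m) * (\<Prod>j = 1..m. geo j (Suc m - j))) e"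
    using ge vdm_tri_kern[of m 0] by (simp add: kern_tri ge_rho_def)
  also have "\<dots> = (if dg then 1 else 0)"
    unfolding e coeff_monom_mult dg_def by (rule coeff_prod_geo) (auto simp: inj_on_def)
  finally have K: "mfps_coeff (vdm m * kern (tri m)) e = (if dg then 1 else 0)" .
  have "vdm m * xc d (kern (tri m)) = xc (card (pairs m) + d) (vdm m * kern (tri m))"
    by (rule xc_mult_xhom) (rule xhom_vdm)
  then have L: "mfps_coeff (vdm m * xc d (kern (tri m))) e = (if xdeg p = d \<and> dg then 1 else 0)"
    using K by (simp add: coeff_xc e xdeg_add xdeg_rho pq(1) xq)
  have krho: "keys (rho m) \<subseteq> range Inl"
  proof
    fix w assume "w \<in> keys (rho m)"
    then show "w \<in> range Inl" by (cases w) (auto simp: in_keys_iff)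
  qed
  have contrib: "mfps_coeff (vdm m * (in_x (atom \<alpha>) * in_y g)) e
      = (if p = expo \<alpha> then mfps_coeff (in_y g) q else 0)" if "length \<alpha> = m" for \<alpha> g
  proof -
    have "mfps_coeff ((vdm m * in_x (atom \<alpha>)) * in_y g) ((rho m + p) + q)
      = mfps_coeff (vdm m * in_x (atom \<alpha>)) (rho m + p) * mfps_coeff (in_y g) q"
      using krho pq(2,3)
      by (intro coeff_mult_disjoint[where X = "range Inl" and Y = "range Inr"] only_vars_mult
          only_vars_vdm' only_vars_in_x only_vars_in_y) (auto simp: keys_add_nat)
    moreover have "mfps_coeff (vdm m * in_x (atom \<alpha>)) (rho m + p) = (if p = expo \<alpha> then 1 else 0)"
      using that mon unfolding lap by (intro vdm_atom_dual) auto
    ultimately show ?thesis by (simp add: e pq(1) mult.assoc add.assoc)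
  qed
  have "mfps_coeff (vdm m * (\<Sum>\<alpha>\<in>C. in_x (atom \<alpha>) * in_y (key_poly (rev \<alpha>)))) e
    = (\<Sum>\<alpha>\<in>C. if p = expo \<alpha> then mfps_coeff (in_y (key_poly (rev \<alpha>))) q else 0)"
    unfolding sum_distrib_left mfps_coeff_sum by (intro sum.cong contrib) (auto simp: C_def)
  also have "\<dots> = (if xdeg p = d \<and> dg then 1 else 0)"
  proof (cases "\<exists>\<alpha>\<in>C. p = expo \<alpha>")
    case True
    then obtain \<alpha> where \<alpha>: "\<alpha> \<in> C" "p = expo \<alpha>" by blast
    then have len: "length \<alpha> = m" and sd: "sum_list \<alpha> = d" by (auto simp: C_def)
    have "p = expo \<beta> \<longleftrightarrow> \<beta> = \<alpha>" if "\<beta> \<in> C" for \<beta>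
    proof
      assume "p = expo \<beta>"
      then show "\<beta> = \<alpha>" using that \<alpha> by (intro expo_inject) (simp_all add: C_def)
    qed (simp add: \<alpha>)
    then have "(\<Sum>\<beta>\<in>C. if p = expo \<beta> then mfps_coeff (in_y (key_poly (rev \<beta>))) q else 0)
      = (\<Sum>\<beta>\<in>C. if \<beta> = \<alpha> then mfps_coeff (in_y (key_poly (rev \<beta>))) q else 0)"
      by (intro sum.cong) auto
    also have "\<dots> = mfps_coeff (in_y (key_poly (rev \<alpha>))) q"
      using \<alpha>(1) finite_comps[of m d] by (simp add: C_def)
    also have "\<dots> = mfps_coeff (mfps_monom (expo_y (rev \<alpha>))) q"
    proof -
      have "sorted_wrt (\<le>) \<alpha>"
        unfolding sorted_wrt_iff_nth_less
      proof (intro allI impI)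
        fix i j assume "i < j" "j < length \<alpha>"
        then show "\<alpha> ! i \<le> \<alpha> ! j" using mon[of "Suc i" "Suc j"] len \<alpha>(2) unfolding lap by simp
      qed
      then have "sorted_wrt (\<ge>) (rev \<alpha>)" by (simp add: sorted_wrt_rev)
      then show ?thesis by (simp add: key_poly_dominant in_y_x_power)
    qed
    also have "\<dots> = (if q = expo_y (rev \<alpha>) then 1 else 0)" by (simp add: coeff_monom)
    also have "q = expo_y (rev \<alpha>) \<longleftrightarrow> xdeg p = d \<and> dg"
    proof
      assume q: "q = expo_y (rev \<alpha>)"
      have "k \<in> (\<lambda>j. Suc m - j) ` {1..m}" if "1 \<le> k" "k \<le> m" for k
        using that by (intro image_eqI[of _ _ "Suc m - k"]) auto
      then show "xdeg p = d \<and> dg"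
        unfolding dg_def lap using \<alpha>(2) len sd q by (auto simp: xdeg_expo rev_nth Suc_diff_le)
    next
      assume d: "xdeg p = d \<and> dg"
      show "q = expo_y (rev \<alpha>)"
      proof (rule poly_mapping_eqI)
        fix w
        show "lookup q w = lookup (expo_y (rev \<alpha>)) w"
        proof (cases w)
          case (Inr k)
          show ?thesis
          proof (cases "1 \<le> k \<and> k \<le> m")
            case True
            then have j: "Suc m - k \<in> {1..m}" and jj: "Suc m - (Suc m - k) = k" by auto
            have "lookup p (Inl (Suc m - k)) = lookup q (Inr (Suc m - (Suc m - k)))"
              using d j unfolding dg_def lap by blast
            then have "lookup p (Inl (Suc m - k)) = lookup q (Inr k)"
              by (simp only: jj)
            moreover have "lookup p (Inl (Suc m - k)) = \<alpha> ! (Suc m - k - 1)"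
              using \<alpha>(2) j len by auto
            moreover have "rev \<alpha> ! (k - 1) = \<alpha> ! (Suc m - k - 1)"
              using True len by (cases k) (simp_all add: rev_nth)
            ultimately show ?thesis using True Inr len by simp
          next
            case False
            then have "k \<notin> (\<lambda>j. Suc m - j) ` {1..m}" by auto
            then show ?thesis using d False Inr len unfolding dg_def lap by auto
          qed
        qed (simp add: lq)
      qed
    qed
    finally show ?thesis .
  next
    case False
    have "\<not> (xdeg p = d \<and> dg)"
    proof
      assume d: "xdeg p = d \<and> dg"
      let ?\<alpha> = "map (\<lambda>j. lookup p (Inl (Suc j))) [0..<m]"
      have "p = expo ?\<alpha>"
      proof (rule poly_mapping_eqI)
        fix w show "lookup p w = lookup (expo ?\<alpha>) w"
          using d unfolding dg_def lap by (cases w) (auto simp: lp)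
      qed
      moreover from this have "?\<alpha> \<in> C" using d xdeg_expo[of ?\<alpha>] by (simp add: C_def)
      ultimately show False using False by blast
    qed
    then show ?thesis using False by (simp add: sum.neutral)
  qed
  finally show ?thesis using L by simp
qed

text \<open>The difference of both sides satisfies \<open>kernel_zero\<close>: for the kernel
  because one box can be added by operators in x and in y, for the expansion because
  \<open>lower i\<close> on \<open>\<alpha>\<close> becomes \<open>upper (m - i)\<close> on its
  reversal.\<close>

lemma staircase_kernel:
  "xc d (kern (tri m)) = (\<Sum>\<alpha> | length \<alpha> = m \<and> sum_list \<alpha> = d. in_x (atom \<alpha>) * in_y (key_poly (rev \<alpha>)))"
proof -
  let ?C = "{\<alpha>. length \<alpha> = m \<and> sum_list \<alpha> = d}"
  let ?R = "\<Sum>\<alpha>\<in>?C. in_x (atom \<alpha>) * in_y (key_poly (rev \<alpha>))"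
  have "xc d (kern (tri m)) - ?R = 0"
  proof (rule kernel_zero[where m = m])
    fix i assume i: "1 \<le> i" "i < m"
    let ?F = "kern (insert (Suc i, Suc m - i) (tri m))"
    let ?P = "\<Sum>\<alpha>\<in>?C. in_x (atom \<alpha>) * in_y (key_poly (rev (lower i \<alpha>)))"
    have C: "{\<alpha>. length \<alpha> = m \<and> lower i \<alpha> \<in> ?C} = ?C" using i by (auto simp: sum_list_lower)
    have "pi_rel (Inl i) (Inl (Suc i)) ?R
      (\<Sum>\<alpha>\<in>{\<alpha>. length \<alpha> = m \<and> lower i \<alpha> \<in> ?C}. in_x (atom \<alpha>) * in_y (key_poly (rev (lower i \<alpha>))))"
      by (rule pi_rel_x_sum[where G = "\<lambda>\<alpha>. key_poly (rev \<alpha>)"]) (use finite_comps i in auto)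
    then have "pi_rel (Inl i) (Inl (Suc i)) ?R ?P" by (simp only: C)
    moreover have "pi_rel (Inr (m - i)) (Inr (Suc (m - i))) ?R ?P"
    proof -
      have "(\<Sum>\<alpha>\<in>?C. in_x (atom \<alpha>) * in_y (key_poly (upper (m - i) (rev \<alpha>)))) = ?P"
        using i by (intro sum.cong) (auto simp: upper_rev)
      moreover have "pi_rel (Inr (m - i)) (Inr (Suc (m - i))) ?R
        (\<Sum>\<alpha>\<in>?C. in_x (atom \<alpha>) * in_y (key_poly (upper (m - i) (rev \<alpha>))))"
        by (rule pi_rel_y_sum[where c = rev and n = m]) (use i in auto)
      ultimately show ?thesis by (simp only:)
    qed
    moreover have "pi_rel (Inl i) (Inl (Suc i)) (xc d (kern (tri m))) (xc d ?F)"
      by (intro pi_rel_xc pi_rel_x_tri i) simp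
    moreover have "pi_rel (Inr (m - i)) (Inr (Suc (m - i))) (xc d (kern (tri m))) (xc d ?F)"
      by (intro pi_rel_xc pi_rel_y_tri i) simp
    ultimately show "\<exists>P. pi_rel (Inl i) (Inl (Suc i)) (xc d (kern (tri m)) - ?R) P
        \<and> pi_rel (Inr (m - i)) (Inr (Suc (m - i))) (xc d (kern (tri m)) - ?R) P"
      by (intro exI[of _ "xc d ?F - ?P"] conjI pi_rel_diff)
  next
    fix e :: "nat + nat \<Rightarrow>\<^sub>0 nat"
    assume "\<And>i. 1 \<le> i \<Longrightarrow> i < m \<Longrightarrow> lookup e (Inl i) < lookup e (Inl (Suc i))"
    from coeff_staircase_lead[OF this]
    show "mfps_coeff (vdm m * (xc d (kern (tri m)) - ?R)) e = 0" by (simp add: right_diff_distrib)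
  qed
  then show ?thesis by simp
qed

section \<open>Strictification\<close>

text \<open>Strictification of a column below an imaginary entry \<open>b\<close>, which makes the recursion structural.\<close>

fun str_below :: "int \<Rightarrow> int list \<Rightarrow> int list" where
  "str_below b [] = []"
| "str_below b (c # cs) = min (b - 1) c # str_below (min (b - 1) c) cs"

lemma strictify_Cons: "strictify (c # cs) = c # str_below c cs"
  by (induction cs arbitrary: c) auto

lemma strictify_str_below: "(\<And>c. c \<in> set cs \<Longrightarrow> c < b) \<Longrightarrow> strictify cs = str_below b cs"
proof (cases cs)
  case (Cons c cs')
  moreover assume "\<And>c. c \<in> set cs \<Longrightarrow> c < b"
  ultimately have "min (b - 1) c = c" by force
  then show ?thesis using Cons by (simp add: strictify_Cons)
qed simp

lemma length_str_below [simp]: "length (str_below b cs) = length cs"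
  by (induction cs arbitrary: b) auto

lemma length_strictify [simp]: "length (strictify cs) = length cs"
  by (cases cs) (auto simp: strictify_Cons)

lemma str_below_less: "d \<in> set (str_below b cs) \<Longrightarrow> d < b"
  by (induction cs arbitrary: b) force+

lemma str_below_less_bound: "\<forall>c\<in>set cs. c < k \<Longrightarrow> d \<in> set (str_below b cs) \<Longrightarrow> d < k"
  by (induction cs arbitrary: b) (auto simp: min_less_iff_disj)

lemma sorted_str_below: "sorted_wrt (>) (str_below b cs)"
  by (induction cs arbitrary: b) (auto dest: str_below_less)

lemma sorted_strictify: "sorted_wrt (>) (strictify cs)"
  by (cases cs) (auto simp: strictify_Cons sorted_str_below dest: str_below_less)

lemma str_below_indep:
  assumes "\<And>c. c \<in> set cs \<Longrightarrow> c < k" "k \<le> b" "k \<le> b'"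
  shows "str_below b cs = str_below b' cs"
proof (cases cs)
  case (Cons c cs')
  then have "min (b - 1) c = c" "min (b' - 1) c = c" using assms by force+
  then show ?thesis using Cons by simp
qed simp

text \<open>Strictification only lowers entries. This is what keeps a column meeting a row of length
  0 from being positive.\<close>

lemma str_below_le: "c \<in> set cs \<Longrightarrow> \<exists>d\<in>set (str_below b cs). d \<le> c"
  by (induction cs arbitrary: b) auto

lemma strictify_le: "c \<in> set cs \<Longrightarrow> \<exists>d\<in>set (strictify cs). d \<le> c"
  by (cases cs) (auto simp: strictify_Cons dest: str_below_le[of _ _ "hd cs"])

lemma strictify_strict: "sorted_wrt (>) cs \<Longrightarrow> strictify cs = cs"
proof -
  have "sorted_wrt (>) cs \<Longrightarrow> \<forall>c\<in>set cs. c < b \<Longrightarrow> str_below b cs = cs" for b and cs :: "int list"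
  proof (induction cs arbitrary: b)
    case (Cons c cs)
    then have "min (b - 1) c = c" by simp
    then show ?case using Cons by simp
  qed simp
  then show "sorted_wrt (>) cs \<Longrightarrow> strictify cs = cs"
    by (cases cs) (auto simp: strictify_Cons)
qed

text \<open>The effect of \<open>upper k\<close> on a column of a key tableau, see
  \<open>int_col_upper\<close>; strictified columns change in the same way when a row of length k
  grows.\<close>

definition raise_elem :: "int \<Rightarrow> int set \<Rightarrow> int set" where
  "raise_elem k T = (if k \<in> T \<and> k + 1 \<notin> T then insert (k + 1) (T - {k}) else T)"

text \<open>Raising the entry k at p is visible unless k + 1 or k is already taken higher up, and in
  that case both columns strictify alike. The bound b is inserted as an imaginary entry so that
  \<open>b = k + 1\<close> fits the same formula.\<close>

lemma str_below_raise:
  fixes f f' :: "nat \<Rightarrow> int"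
  assumes "sorted_wrt (<) xs" "k + 1 \<le> b"
    and "f p = k" "f' p = k + 1" "\<And>x. x \<noteq> p \<Longrightarrow> f' x = f x"
    and "\<And>x. x \<in> set xs \<Longrightarrow> x < p \<Longrightarrow> k + 1 \<le> f x" "\<And>x. x \<in> set xs \<Longrightarrow> p < x \<Longrightarrow> f x < k"
  shows "insert b (set (str_below b (map f' xs))) = raise_elem k (insert b (set (str_below b (map f xs))))"
  using assms(1,2,6,7)
proof (induction xs arbitrary: b)
  case Nil
  then show ?case by (simp add: raise_elem_def)
next
  case (Cons x xs)
  have s: "sorted_wrt (<) xs" "\<And>y. y \<in> set xs \<Longrightarrow> x < y" using Cons.prems(1) by auto
  consider "x < p" | "x = p" | "p < x" by linarith
  then show ?case
  proof cases
    case 1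
    then have fx: "k + 1 \<le> f x" "f' x = f x" using Cons.prems(3) assms(5) by auto
    let ?d = "min (b - 1) (f x)"
    show ?thesis
    proof (cases "k + 1 \<le> ?d")
      case True
      have "insert ?d (set (str_below ?d (map f' xs))) = raise_elem k (insert ?d (set (str_below ?d (map f xs))))"
        using Cons.prems(3,4) s True by (intro Cons.IH) auto
      moreover have "k + 1 < b" using True by simp
      ultimately show ?thesis using fx by (auto simp: raise_elem_def)
    next
      case False
      then have d: "?d = k" "b = k + 1" using fx Cons.prems(2) by auto
      \<comment> \<open>Once the bound is at most k, the entries k and k + 1 are both cut down to
        the bound minus one.\<close>
      have "str_below k (map f' ys) = str_below k (map f ys)" for ys
      proof -
        have "str_below e (map f' ys) = str_below e (map f ys)" if "e \<le> k" for e
          using that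
        proof (induction ys arbitrary: e)
          case (Cons y ys)
          then have "min (e - 1) (f' y) = min (e - 1) (f y)" using assms(3-5) by (cases "y = p") auto
          then show ?case using Cons by simp
        qed simp
        then show ?thesis by simp
      qed
      then show ?thesis using fx d by (auto simp: raise_elem_def)
    qed
  next
    case 2
    have lo: "f y < k" "f' y = f y" if "y \<in> set xs" for y
      using that s 2 Cons.prems(4) assms(5) by force+
    have "map f' xs = map f xs" using lo by simp
    then have m: "str_below e (map f' xs) = str_below e (map f xs)" for e by (rule arg_cong)
    have i: "str_below (min (b - 1) (k + 1)) (map f xs) = str_below k (map f xs)"
      using lo(1) Cons.prems(2) by (intro str_below_indep[where k = k]) auto
    have less: "\<And>d e. d \<in> set (str_below e (map f xs)) \<Longrightarrow> d < k"
      using str_below_less_bound[of "map f xs" k] lo(1) by auto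
    have fp: "f x = k" "f' x = k + 1" using 2 assms by auto
    have nk: "k \<notin> set (str_below k (map f xs))" "k + 1 \<notin> set (str_below k (map f xs))" using less by force+
    show ?thesis
    proof (cases "b = k + 1")
      case True
      then show ?thesis using fp m by (auto simp: raise_elem_def)
    next
      case False
      then have "min (b - 1) k = k" "min (b - 1) (k + 1) = k + 1" using Cons.prems(2) by auto
      then show ?thesis using fp m i nk False Cons.prems(2) by (auto simp: raise_elem_def)
    qed
  next
    case 3
    have lo: "f y < k" "f' y = f y" if "y \<in> set (x # xs)" for y
      using that s(2)[of y] 3 Cons.prems(4)[of y] assms(5)[of y] by auto
    then have "map f' (x # xs) = map f (x # xs)" by simp
    then have "str_below b (map f' (x # xs)) = str_below b (map f (x # xs))" by (rule arg_cong)
    moreover have "k \<notin> insert b (set (str_below b (map f (x # xs))))"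
      using str_below_less_bound[of "map f (x # xs)" k k b] lo(1) Cons.prems(2) by auto
    ultimately show ?thesis by (simp only: raise_elem_def) simp
  qed
qed

definition str_set :: "(nat \<Rightarrow> int) \<Rightarrow> nat set \<Rightarrow> int set" where
  "str_set f S = set (strictify (map f (sorted_list_of_set S)))"

lemma str_set_cong: "finite S \<Longrightarrow> (\<And>x. x \<in> S \<Longrightarrow> f x = g x) \<Longrightarrow> str_set f S = str_set g S"
  unfolding str_set_def by (metis (no_types, lifting) map_cong set_sorted_list_of_set)

lemma str_set_raise:
  assumes "finite S" "f p = k" "f' p = k + 1" "\<And>x. x \<noteq> p \<Longrightarrow> f' x = f x"
    and "\<And>x. x \<in> S \<Longrightarrow> x < p \<Longrightarrow> k + 1 \<le> f x" "\<And>x. x \<in> S \<Longrightarrow> p < x \<Longrightarrow> f x < k"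
  shows "str_set f' S = raise_elem k (str_set f S)"
proof -
  \<comment> \<open>A bound above all entries does not affect strictification; being larger than k +
    1, it can be removed from both sets at the end.\<close>
  define b where "b = Max (insert (k + 1) (f ` S)) + 1"
  have "c \<le> Max (insert (k + 1) (f ` S))" if "c \<in> insert (k + 1) (f ` S)" for c
    using that assms(1) by (intro Max_ge) auto
  then have b: "k + 1 < b" "\<And>x. x \<in> S \<Longrightarrow> f x < b" by (force simp: b_def)+
  have b': "f' x < b" if "x \<in> S" for x using that b assms(3,4) by (cases "x = p") auto
  let ?xs = "sorted_list_of_set S"
  have f: "str_set f S = set (str_below b (map f ?xs))"
    unfolding str_set_def using b assms(1) by (subst strictify_str_below[of _ b]) auto
  have f': "str_set f' S = set (str_below b (map f' ?xs))"
    unfolding str_set_def using b' assms(1) by (subst strictify_str_below[of _ b]) auto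
  have "insert b (str_set f' S) = raise_elem k (insert b (str_set f S))"
    unfolding f f' using assms b by (intro str_below_raise) auto
  moreover have "b \<notin> str_set f S" "b \<notin> str_set f' S" unfolding f f' by (auto dest: str_below_less)
  ultimately show ?thesis using b(1) by (auto simp: raise_elem_def split: if_splits)
qed

text \<open>If i is present, its strictified value is at most c, so the entry that follows is cut to
  the same value whether it is c - 1 or c.\<close>

lemma str_set_adjacent:
  assumes "finite S" "Suc i \<in> S \<longrightarrow> i \<in> S" "f i = c" "f (Suc i) = c - 1"
    and "f' (Suc i) = c" "\<And>x. x \<noteq> Suc i \<Longrightarrow> f' x = f x"
  shows "str_set f' S = str_set f S"
proof -
  have str_below: "str_below b (map f' xs) = str_below b (map f xs)"
    if "sorted_wrt (<) xs" "Suc i \<in> set xs \<longrightarrow> i \<in> set xs \<or> b \<le> c" for b xs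
    using that
  proof (induction xs arbitrary: b)
    case (Cons x xs)
    let ?d = "min (b - 1) (f x)"
    have d: "min (b - 1) (f' x) = ?d"
    proof (cases "x = Suc i")
      case True
      then have "i \<notin> set (x # xs)" using Cons.prems(1) by auto
      then have "b \<le> c" using Cons.prems(2) True by auto
      then show ?thesis using True assms(4,5) by simp
    qed (simp add: assms(6))
    have "str_below ?d (map f' xs) = str_below ?d (map f xs)"
    proof (rule Cons.IH)
      show "Suc i \<in> set xs \<longrightarrow> i \<in> set xs \<or> ?d \<le> c"
        using Cons.prems assms(3) by (cases "x = i") auto
    qed (use Cons.prems in auto)
    then show ?case using d by simp
  qed simp
  define b where "b = Max (insert c (f ` S)) + 1"
  have "e \<le> Max (insert c (f ` S))" if "e \<in> insert c (f ` S)" for e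
    using that assms(1) by (intro Max_ge) auto
  then have b: "c < b" "\<And>x. x \<in> S \<Longrightarrow> f x < b" by (force simp: b_def)+
  have b': "f' x < b" if "x \<in> S" for x using that b assms(5,6) by (cases "x = Suc i") auto
  have "strictify (map f' (sorted_list_of_set S)) = strictify (map f (sorted_list_of_set S))"
    using b b' assms(1) str_below[of "sorted_list_of_set S" b] assms(2)
    by (subst (1 2) strictify_str_below[of _ b]) auto
  then show ?thesis by (simp add: str_set_def)
qed

text \<open>With only i + 1 present, its new entry is that of i, and putting i in place of i + 1
  keeps the order of the column.\<close>

lemma str_set_transpose:
  assumes "finite S" "Suc i \<in> S" "i \<notin> S" "f' (Suc i) = f i" "\<And>x. x \<noteq> Suc i \<Longrightarrow> f' x = f x"
  shows "str_set f' S = str_set f (transpose i (Suc i) ` S)"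
proof -
  let ?t = "transpose i (Suc i)" and ?xs = "sorted_list_of_set S"
  have mono: "?t x < ?t y" if "x \<in> S" "y \<in> S" "x < y" for x y
    using that assms(3) by (cases "x = i"; cases "y = i") (auto simp: transpose_def)
  have "sorted_list_of_set (?t ` S) = map ?t ?xs"
  proof (rule sorted_distinct_set_unique)
    have "sorted_wrt (<) (map ?t ?xs)"
      unfolding sorted_wrt_map
      by (rule sorted_wrt_mono_rel[of _ "(<)"]) (use mono assms(1) in auto)
    then show "sorted (map ?t ?xs)" "distinct (map ?t ?xs)" by (simp_all add: strict_sorted_iff)
  qed (use assms(1) in auto)
  moreover have "map f (map ?t ?xs) = map f' ?xs"
    using assms by (auto simp: transpose_def)
  ultimately show ?thesis by (simp only: str_set_def)
qed

lemma str_set_strict: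
  assumes "finite S" "\<And>x y. x \<in> S \<Longrightarrow> y \<in> S \<Longrightarrow> x < y \<Longrightarrow> f y < f x"
  shows "str_set f S = f ` S"
proof -
  have "sorted_wrt (\<lambda>x y. f y < f x) (sorted_list_of_set S)"
    by (rule sorted_wrt_mono_rel[of _ "(<)"]) (use assms in auto)
  then have "strictify (map f (sorted_list_of_set S)) = map f (sorted_list_of_set S)"
    by (intro strictify_strict) (simp add: sorted_wrt_map)
  then show ?thesis using assms(1) by (simp add: str_set_def)
qed

lemma str_set_le: "finite S \<Longrightarrow> x \<in> S \<Longrightarrow> \<exists>d\<in>str_set f S. d \<le> f x"
  unfolding str_set_def by (rule strictify_le) auto

lemma str_set_empty [simp]: "str_set f {} = {}"
  by (simp add: str_set_def)

section \<open>Strictified key tableaux and their compositions\<close>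

definition row :: "nat list \<Rightarrow> nat \<Rightarrow> int" where
  "row lam k = int (lam ! (k - 1))"

lemma str_B_plus:
  "str (B_plus lam \<alpha>) = map (\<lambda>r. rev (strictify (map (row lam) (sorted_list_of_set (col \<alpha> r)))))
     [1..<Suc (max_part \<alpha>)]"
  by (simp add: str_def B_plus_def key_tab_col rev_map o_def row_def[abs_def] del: upt_Suc Max_insert)

lemma Comp_iff:
  "\<alpha> \<in> Comp lam \<longleftrightarrow> length \<alpha> = length lam \<and> (\<forall>r\<ge>1. \<forall>e\<in>str_set (row lam) (col \<alpha> r). 0 < e)"
proof -
  have "(\<forall>c\<in>set (str (B_plus lam \<alpha>)). \<forall>e\<in>set c. e > 0)
    \<longleftrightarrow> (\<forall>r\<in>{1..max_part \<alpha>}. \<forall>e\<in>str_set (row lam) (col \<alpha> r). 0 < e)"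
    by (simp add: str_B_plus str_set_def atLeastLessThanSuc_atLeastAtMost del: upt_Suc Max_insert)
  also have "\<dots> \<longleftrightarrow> (\<forall>r\<ge>1. \<forall>e\<in>str_set (row lam) (col \<alpha> r). 0 < e)"
  proof
    assume a: "\<forall>r\<in>{1..max_part \<alpha>}. \<forall>e\<in>str_set (row lam) (col \<alpha> r). 0 < e"
    show "\<forall>r\<ge>1. \<forall>e\<in>str_set (row lam) (col \<alpha> r). 0 < e"
    proof (intro allI impI)
      fix r :: nat assume r: "1 \<le> r"
      show "\<forall>e\<in>str_set (row lam) (col \<alpha> r). 0 < e"
      proof (cases "r \<le> max_part \<alpha>")
        case False
        then have "col \<alpha> r = {}" using r col_empty_iff[of r \<alpha>] by linarith
        then show ?thesis by simp
      qed (use a r in auto)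
    qed
  qed auto
  finally show ?thesis unfolding Comp_def by blast
qed

text \<open>\<open>\<gamma>\<close> is \<open>\<alpha>\<^sup>\<lambda>\<close>, padded by zeros to an arbitrary length: the induction adds boxes in new columns
  while the number of variables \<open>y\<close> stays fixed.\<close>

definition is_comp_pow :: "nat list \<Rightarrow> nat list \<Rightarrow> nat list \<Rightarrow> bool" where
  "is_comp_pow lam \<alpha> \<gamma> \<longleftrightarrow> (\<forall>r\<ge>1. int ` col \<gamma> r = str_set (row lam) (col \<alpha> r))"

lemma is_comp_pow_card:
  assumes "is_comp_pow lam \<alpha> \<gamma>" "1 \<le> r"
  shows "card (col \<gamma> r) = card (col \<alpha> r)"
proof -
  have "card (col \<gamma> r) = card (int ` col \<gamma> r)" by (simp add: card_image)
  also have "\<dots> = card (str_set (row lam) (col \<alpha> r))" using assms by (simp add: is_comp_pow_def)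
  also have "\<dots> = length (strictify (map (row lam) (sorted_list_of_set (col \<alpha> r))))"
  proof -
    have "distinct cs" if "sorted_wrt (>) cs" for cs :: "int list"
      using that by (induction cs) auto
    from this[OF sorted_strictify] show ?thesis unfolding str_set_def by (rule distinct_card)
  qed
  finally show ?thesis by simp
qed

lemma max_part_eq:
  assumes "\<And>r. 1 \<le> r \<Longrightarrow> col \<gamma> r = {} \<longleftrightarrow> col \<alpha> r = {}"
  shows "max_part \<gamma> = max_part \<alpha>"
proof -
  have "max_part \<gamma> < r \<longleftrightarrow> max_part \<alpha> < r" if "1 \<le> r" for r
    using assms[OF that] col_empty_iff[OF that] by blast
  from this[of "Suc (max_part \<gamma>)"] this[of "Suc (max_part \<alpha>)"] show ?thesis by linarith
qed

lemma is_comp_pow_key_tab: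
  assumes "is_comp_pow lam \<alpha> \<gamma>"
  shows "map (map int) (key_tab \<gamma>) = str (B_plus lam \<alpha>)"
proof -
  have "col \<gamma> r = {} \<longleftrightarrow> col \<alpha> r = {}" if "1 \<le> r" for r
    using is_comp_pow_card[OF assms that] by (metis card_0_eq finite_col)
  then have m: "max_part \<gamma> = max_part \<alpha>" by (rule max_part_eq)
  have "map int (sorted_list_of_set (col \<gamma> r)) = rev (strictify (map (row lam) (sorted_list_of_set (col \<alpha> r))))"
    if "1 \<le> r" for r
  proof (rule sorted_distinct_set_unique)
    have "sorted_wrt (<) (map int (sorted_list_of_set (col \<gamma> r)))"
      by (simp add: sorted_wrt_map)
    then show "sorted (map int (sorted_list_of_set (col \<gamma> r)))" "distinct (map int (sorted_list_of_set (col \<gamma> r)))"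
      by (simp_all add: strict_sorted_iff)
    let ?s = "rev (strictify (map (row lam) (sorted_list_of_set (col \<alpha> r))))"
    have "sorted_wrt (<) ?s" using sorted_strictify by (simp add: sorted_wrt_rev)
    then show "sorted ?s" "distinct ?s" by (simp_all only: strict_sorted_iff)
    show "set (map int (sorted_list_of_set (col \<gamma> r))) = set ?s"
      using assms that by (simp add: is_comp_pow_def str_set_def)
  qed
  then show ?thesis unfolding str_B_plus key_tab_col m map_map by (intro map_cong) auto
qed

lemma key_tab_inject:
  assumes "length \<alpha> = length \<beta>" "key_tab \<alpha> = key_tab \<beta>"
  shows "\<alpha> = \<beta>"
proof (rule col_inject[OF assms(1)])
  fix r :: nat assume r: "1 \<le> r"
  have "length (key_tab \<alpha>) = length (key_tab \<beta>)" using assms(2) by simp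
  then have m: "max_part \<alpha> = max_part \<beta>" by (simp add: key_tab_col del: Max_insert upt_Suc)
  show "col \<alpha> r = col \<beta> r"
  proof (cases "r \<le> max_part \<alpha>")
    case True
    have "\<forall>r\<in>set [1..<Suc (max_part \<beta>)]. sorted_list_of_set (col \<alpha> r) = sorted_list_of_set (col \<beta> r)"
      using assms(2) unfolding key_tab_col m map_eq_conv .
    then have "sorted_list_of_set (col \<alpha> r) = sorted_list_of_set (col \<beta> r)" using True r m by auto
    then show ?thesis by (metis finite_col set_sorted_list_of_set)
  next
    case False
    then have "max_part \<alpha> < r" "max_part \<beta> < r" using m by linarith+
    then show ?thesis using col_empty_iff[OF r] by blast
  qed
qed

lemma comp_pow_eqI:
  assumes "is_comp_pow lam \<alpha> \<gamma>" "length \<gamma> = hd lam"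
  shows "comp_pow lam \<alpha> = \<gamma>"
  unfolding comp_pow_def
proof (rule the_equality)
  show "length \<gamma> = hd lam \<and> map (map int) (key_tab \<gamma>) = str (B_plus lam \<alpha>)"
    using assms is_comp_pow_key_tab by blast
next
  fix \<beta> assume b: "length \<beta> = hd lam \<and> map (map int) (key_tab \<beta>) = str (B_plus lam \<alpha>)"
  then have "map (map int) (key_tab \<beta>) = map (map int) (key_tab \<gamma>)"
    using is_comp_pow_key_tab[OF assms(1)] by simp
  then have "key_tab \<beta> = key_tab \<gamma>"
    by (rule injD[OF inj_mapI[OF inj_mapI], rotated]) (simp add: inj_of_nat)
  with b assms(2) show "\<beta> = \<gamma>" by (intro key_tab_inject) auto
qed

lemma int_col_upper:
  assumes "1 \<le> k" "k < length \<gamma>"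
  shows "int ` col (upper k \<gamma>) r = raise_elem (int k) (int ` col \<gamma> r)"
proof -
  have mem: "int j \<in> int ` A \<longleftrightarrow> j \<in> A" "int j + 1 \<in> int ` A \<longleftrightarrow> Suc j \<in> A" for j A
    by (auto simp: image_iff) (metis of_nat_Suc of_nat_eq_iff add.commute)+
  show ?thesis
  proof (cases "\<gamma> ! k < \<gamma> ! (k - 1)")
    case True
    then have c: "Suc k \<in> col \<gamma> r \<longrightarrow> k \<in> col \<gamma> r" using assms by (auto simp: col_def)
    have u: "col (upper k \<gamma>) r = transpose k (Suc k) ` col \<gamma> r"
      using True assms by (simp add: upper_def col_swap_adj)
    show ?thesis
    proof (cases "k \<in> col \<gamma> r \<and> Suc k \<notin> col \<gamma> r")
      case True
      then have "transpose k (Suc k) ` col \<gamma> r = insert (Suc k) (col \<gamma> r - {k})"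
        by (auto simp: transpose_def)
      then show ?thesis using True by (auto simp: u raise_elem_def mem)
    next
      case False
      then have "transpose k (Suc k) ` col \<gamma> r = col \<gamma> r"
        using c by (auto simp: set_eq_iff in_transpose_image_iff) (auto simp: transpose_def split: if_splits)
      then show ?thesis using False by (auto simp: u raise_elem_def mem)
    qed
  next
    case False
    then have "k \<in> col \<gamma> r \<longrightarrow> Suc k \<in> col \<gamma> r" using assms by (auto simp: col_def)
    then show ?thesis using False by (auto simp: upper_def raise_elem_def mem)
  qed
qed

section \<open>Adding boxes\<close>

text \<open>The invariant of the induction on boxes, with M variables y throughout and one identity
  for each degree in x; \<open>c \<alpha>\<close> is the padded form of
  \<open>comp_pow lam \<alpha>\<close>.\<close>

definition expands :: "nat list \<Rightarrow> nat \<Rightarrow> (nat list \<Rightarrow> nat list) \<Rightarrow> bool" where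
  "expands lam M c \<longleftrightarrow> (\<forall>\<alpha>\<in>Comp lam. length (c \<alpha>) = M \<and> is_comp_pow lam \<alpha> (c \<alpha>)) \<and>
    (\<forall>d. xc d (kern (cells lam))
      = (\<Sum>\<alpha> | \<alpha> \<in> Comp lam \<and> sum_list \<alpha> = d. in_x (atom \<alpha>) * in_y (key_poly (c \<alpha>))))"

lemma finite_cells: "finite (cells lam)"
proof (rule finite_subset)
  show "cells lam \<subseteq> (SIGMA i:{1..length lam}. {1..lam ! (i - 1)})" by (auto simp: cells_def)
qed auto

lemma finite_Comp_deg: "finite {\<alpha>. \<alpha> \<in> Comp lam \<and> sum_list \<alpha> = d}"
  by (rule finite_subset[OF _ finite_comps[of "length lam" d]]) (auto simp: Comp_def)

text \<open>Row p, counted from 0, is the only one of length k, so columns k and k + 1 have lengths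
  p + 1 and p. On strictified columns the new box acts as \<open>raise_elem k\<close>; since k is
  positive, this does not change whether all entries are positive.\<close>

lemma expands_y_box:
  assumes E: "expands lam M c" and p: "p < length lam" "lam ! p = k" and k: "1 \<le> k" "k < M"
    and before: "\<And>i. i < p \<Longrightarrow> k < lam ! i" and after: "\<And>i. p < i \<Longrightarrow> i < length lam \<Longrightarrow> lam ! i < k"
  shows "expands (lam[p := Suc k]) M (\<lambda>\<alpha>. upper k (c \<alpha>))"
proof -
  let ?lam = "lam[p := Suc k]"
  have str_set: "str_set (row ?lam) (col \<alpha> r) = raise_elem (int k) (str_set (row lam) (col \<alpha> r))"
    if "length \<alpha> = length lam" for \<alpha> r
  proof -
    let ?f = "(row lam)(Suc p := int k + 1)"
    have "str_set (row ?lam) (col \<alpha> r) = str_set ?f (col \<alpha> r)"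
      using p that by (intro str_set_cong) (auto simp: row_def col_def nth_list_update)
    also have "\<dots> = raise_elem (int k) (str_set (row lam) (col \<alpha> r))"
    proof (rule str_set_raise[where p = "Suc p"])
      fix x assume "x \<in> col \<alpha> r"
      then have x: "1 \<le> x" "x \<le> length lam" using that by (auto simp: col_def)
      { assume "x < Suc p"
        then have "x - 1 < p" using x by simp
        then show "int k + 1 \<le> row lam x" using before[of "x - 1"] by (simp add: row_def) }
      { assume "Suc p < x"
        then have "p < x - 1" "x - 1 < length lam" using x by auto
        then show "row lam x < int k" using after[of "x - 1"] by (simp add: row_def) }
    qed (use p in \<open>auto simp: row_def\<close>)
    finally show ?thesis .
  qed
  have pos: "(\<forall>e\<in>raise_elem (int k) T. 0 < e) \<longleftrightarrow> (\<forall>e\<in>T. 0 < e)" for T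
    using k by (auto simp: raise_elem_def)
  have Comp: "Comp ?lam = Comp lam"
    by (simp add: Comp_iff str_set pos set_eq_iff cong: conj_cong)
  have c: "length (c \<alpha>) = M" "is_comp_pow lam \<alpha> (c \<alpha>)" "length \<alpha> = length lam" if "\<alpha> \<in> Comp lam" for \<alpha>
    using E that by (auto simp: expands_def Comp_iff)
  have "is_comp_pow ?lam \<alpha> (upper k (c \<alpha>))" if "\<alpha> \<in> Comp lam" for \<alpha>
    using c[OF that] k by (simp add: is_comp_pow_def int_col_upper str_set)
  moreover have "xc d (kern (cells ?lam))
      = (\<Sum>\<alpha> | \<alpha> \<in> Comp lam \<and> sum_list \<alpha> = d. in_x (atom \<alpha>) * in_y (key_poly (upper k (c \<alpha>))))" for d
  proof -
    let ?C = "{\<alpha>. \<alpha> \<in> Comp lam \<and> sum_list \<alpha> = d}"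
    have cells: "cells ?lam = insert (Suc p, Suc k) (cells lam)"
    proof (rule set_eqI)
      fix q :: "nat \<times> nat"
      obtain i j where q: "q = (i, j)" by (cases q)
      show "q \<in> cells ?lam \<longleftrightarrow> q \<in> insert (Suc p, Suc k) (cells lam)"
        using p by (cases "i = Suc p") (auto simp: q cells_def nth_list_update)
    qed
    have "pi_rel (Inr k) (Inr (Suc k)) (kern (cells lam)) (kern (cells ?lam))"
      unfolding cells
    proof (rule pi_rel_y_kern[OF finite_cells])
      fix a b assume ab: "(a, b) \<in> cells lam - {(Suc p, k)}"
      then have a: "1 \<le> a" "a \<le> length lam" "1 \<le> b" "b \<le> lam ! (a - 1)" by (auto simp: cells_def)
      consider "a - 1 < p" | "a = Suc p" | "p < a - 1" using a(1) by linarith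
      then show "(a, transpose k (Suc k) b) \<in> cells lam - {(Suc p, k)}"
      proof cases
        case 1
        then show ?thesis using a before[OF 1] k by (auto simp: cells_def transpose_def)
      next
        case 2
        then show ?thesis using a ab p by (auto simp: cells_def transpose_def)
      next
        case 3
        then have "a - 1 < length lam" using a by simp
        then show ?thesis using a after[OF 3] by (auto simp: cells_def transpose_def)
      qed
    qed (use p k in \<open>auto simp: cells_def\<close>)
    then have "pi_rel (Inr k) (Inr (Suc k)) (xc d (kern (cells lam))) (xc d (kern (cells ?lam)))"
      by (rule pi_rel_xc) simp
    moreover have "xc d (kern (cells lam)) = (\<Sum>\<alpha>\<in>?C. in_x (atom \<alpha>) * in_y (key_poly (c \<alpha>)))"
      using E by (simp add: expands_def)
    moreover have "pi_rel (Inr k) (Inr (Suc k)) (\<Sum>\<alpha>\<in>?C. in_x (atom \<alpha>) * in_y (key_poly (c \<alpha>)))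
        (\<Sum>\<alpha>\<in>?C. in_x (atom \<alpha>) * in_y (key_poly (upper k (c \<alpha>))))"
      by (rule pi_rel_y_sum[where n = M]) (use c k in auto)
    ultimately show ?thesis using pi_rel_unique[of "Inr k :: nat + nat" "Inr (Suc k)"] by simp
  qed
  ultimately show ?thesis using c by (simp add: expands_def Comp)
qed

text \<open>Row i + 1 grows to the length of row i. In a column that contains i + 1 without i this
  amounts to replacing i + 1 by i; in all others strictification hides the growth.\<close>

lemma str_set_lower:
  assumes i: "1 \<le> i" "i < length \<alpha>" and f: "f i = b" "f (Suc i) = b - 1" "f' (Suc i) = b" "\<And>x. x \<noteq> Suc i \<Longrightarrow> f' x = f x"
  shows "str_set f' (col \<alpha> r) = str_set f (col (lower i \<alpha>) r)"
proof (cases "\<alpha> ! (i - 1) < \<alpha> ! i")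
  case True
  then have c: "i \<in> col \<alpha> r \<longrightarrow> Suc i \<in> col \<alpha> r" using i by (auto simp: col_def)
  have l: "col (lower i \<alpha>) r = transpose i (Suc i) ` col \<alpha> r"
    using True i by (simp add: lower_def col_swap_adj)
  show ?thesis
  proof (cases "Suc i \<in> col \<alpha> r \<and> i \<notin> col \<alpha> r")
    case True
    then show ?thesis unfolding l using f by (intro str_set_transpose) auto
  next
    case False
    then have "transpose i (Suc i) ` col \<alpha> r = col \<alpha> r"
      using c by (auto simp: set_eq_iff in_transpose_image_iff) (auto simp: transpose_def split: if_splits)
    moreover have "str_set f' (col \<alpha> r) = str_set f (col \<alpha> r)"
      using False by (intro str_set_adjacent[where c = b and i = i] f finite_col) auto
    ultimately show ?thesis by (simp add: l)
  qed
next
  case False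
  then have "Suc i \<in> col \<alpha> r \<longrightarrow> i \<in> col \<alpha> r" using i by (auto simp: col_def)
  then have "str_set f' (col \<alpha> r) = str_set f (col \<alpha> r)"
    by (intro str_set_adjacent[where c = b and i = i] f finite_col)
  then show ?thesis using False by (simp add: lower_def)
qed

text \<open>The strictified columns of \<open>\<alpha>\<close> for the new partition are those of
  \<open>lower i \<alpha>\<close> for the old one. So membership in \<open>Comp\<close> and the
  associated composition are both pulled back along \<open>lower i\<close>, which is how
  \<open>sum_lower\<close> transforms the expansion.\<close>

lemma expands_x_box:
  assumes E: "expands lam M c" and i: "1 \<le> i" "i < length lam"
    and b: "1 \<le> b" "lam ! (i - 1) = b" "lam ! i = b - 1"
  shows "expands (lam[i := b]) M (\<lambda>\<alpha>. c (lower i \<alpha>))"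
proof -
  let ?lam = "lam[i := b]"
  have str_set: "str_set (row ?lam) (col \<alpha> r) = str_set (row lam) (col (lower i \<alpha>) r)"
    if "length \<alpha> = length lam" for \<alpha> r
  proof (rule str_set_lower[where b = "int b"])
    fix x assume "x \<noteq> Suc i"
    then show "row ?lam x = row lam x" using i by (cases x) (auto simp: row_def nth_list_update)
  qed (use i b that in \<open>auto simp: row_def of_nat_diff\<close>)
  have Comp: "\<alpha> \<in> Comp ?lam \<longleftrightarrow> length \<alpha> = length lam \<and> lower i \<alpha> \<in> Comp lam" for \<alpha>
    by (auto simp: Comp_iff str_set)
  have "length (c (lower i \<alpha>)) = M" "is_comp_pow ?lam \<alpha> (c (lower i \<alpha>))" if "\<alpha> \<in> Comp ?lam" for \<alpha>
    using E that by (auto simp: expands_def Comp is_comp_pow_def str_set)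
  moreover have "xc d (kern (cells ?lam))
      = (\<Sum>\<alpha> | \<alpha> \<in> Comp ?lam \<and> sum_list \<alpha> = d. in_x (atom \<alpha>) * in_y (key_poly (c (lower i \<alpha>))))" for d
  proof -
    let ?C = "{\<alpha>. \<alpha> \<in> Comp lam \<and> sum_list \<alpha> = d}"
    have cells: "cells ?lam = insert (Suc i, b) (cells lam)"
    proof (rule set_eqI)
      fix q :: "nat \<times> nat"
      obtain a j where q: "q = (a, j)" by (cases q)
      show "q \<in> cells ?lam \<longleftrightarrow> q \<in> insert (Suc i, b) (cells lam)"
        using i b by (cases "a = Suc i") (auto simp: q cells_def nth_list_update)
    qed
    have "pi_rel (Inl i) (Inl (Suc i)) (kern (cells lam)) (kern (cells ?lam))"
      unfolding cells
      by (rule pi_rel_x_kern[OF finite_cells])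
        (use i b in \<open>auto simp: cells_def transpose_def split: if_splits\<close>)
    then have "pi_rel (Inl i) (Inl (Suc i)) (xc d (kern (cells lam))) (xc d (kern (cells ?lam)))"
      by (rule pi_rel_xc) simp
    moreover have "xc d (kern (cells lam)) = (\<Sum>\<alpha>\<in>?C. in_x (atom \<alpha>) * in_y (key_poly (c \<alpha>)))"
      using E by (simp add: expands_def)
    moreover have "pi_rel (Inl i) (Inl (Suc i)) (\<Sum>\<alpha>\<in>?C. in_x (atom \<alpha>) * in_y (key_poly (c \<alpha>)))
        (\<Sum>\<alpha>\<in>{\<alpha>. length \<alpha> = length lam \<and> lower i \<alpha> \<in> ?C}. in_x (atom \<alpha>) * in_y (key_poly (c (lower i \<alpha>))))"
      by (rule pi_rel_x_sum[where G = "\<lambda>\<alpha>. key_poly (c \<alpha>)"]) (use finite_Comp_deg i in \<open>auto simp: Comp_iff\<close>)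
    moreover have "{\<alpha>. length \<alpha> = length lam \<and> lower i \<alpha> \<in> ?C} = {\<alpha>. \<alpha> \<in> Comp ?lam \<and> sum_list \<alpha> = d}"
      using i by (auto simp: Comp sum_list_lower)
    ultimately show ?thesis using pi_rel_unique[of "Inl i :: nat + nat" "Inl (Suc i)"] by simp
  qed
  ultimately show ?thesis by (simp add: expands_def)
qed

section \<open>Trailing zeros\<close>

lemma x_power_append_zeros: "x_power (\<alpha> @ replicate k 0) = x_power \<alpha>"
proof -
  have "x_power (\<alpha> @ replicate k 0) = (\<Prod>i = 1..length \<alpha> + k. if i \<le> length \<alpha> then var i ^ (\<alpha> ! (i - 1)) else 1)"
    unfolding x_power_def by (rule prod.cong) (auto simp: nth_append)
  also have "\<dots> = (\<Prod>i = 1..length \<alpha>. if i \<le> length \<alpha> then var i ^ (\<alpha> ! (i - 1)) else 1)"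
    by (rule prod.mono_neutral_right) auto
  also have "\<dots> = x_power \<alpha>" unfolding x_power_def by (rule prod.cong) auto
  finally show ?thesis .
qed

lemma swap_adj_append: "1 \<le> i \<Longrightarrow> i < length \<alpha> \<Longrightarrow> swap_adj i (\<alpha> @ z) = swap_adj i \<alpha> @ z"
  by (cases i) (auto simp: swap_adj_def list_update_append1 nth_append)

lemma sorted_append_zeros:
  "sorted_wrt (\<ge>) \<alpha> \<Longrightarrow> sorted_wrt (\<ge>) (\<alpha> @ replicate k (0 :: nat))"
proof -
  have "sorted_wrt (\<ge>) (replicate k (0 :: nat))" by (induction k) auto
  then show "sorted_wrt (\<ge>) \<alpha> \<Longrightarrow> ?thesis" by (auto simp: sorted_wrt_append)
qed

lemma is_atom_append_zeros: "is_atom \<alpha> f \<Longrightarrow> is_atom (\<alpha> @ replicate k 0) f"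
proof (induction rule: is_atom.induct)
  case (dominant \<alpha>)
  have "sorted_wrt (\<ge>) (\<alpha> @ replicate k (0 :: nat))"
    using dominant by (rule sorted_append_zeros)
  from is_atom.dominant[OF this] show ?case by (simp only: x_power_append_zeros)
next
  case (ascent i \<alpha> f)
  show ?case
    by (rule is_atom.ascent) (use ascent in \<open>auto simp: nth_append swap_adj_append\<close>)
qed

lemma is_key_poly_append_zeros: "is_key_poly \<alpha> f \<Longrightarrow> is_key_poly (\<alpha> @ replicate k 0) f"
proof (induction rule: is_key_poly.induct)
  case (dominant \<alpha>)
  have "sorted_wrt (\<ge>) (\<alpha> @ replicate k (0 :: nat))"
    using dominant by (rule sorted_append_zeros)
  from is_key_poly.dominant[OF this] show ?case by (simp only: x_power_append_zeros)
next
  case (ascent i \<alpha> f)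
  show ?case
    by (rule is_key_poly.ascent) (use ascent in \<open>auto simp: nth_append swap_adj_append\<close>)
qed

lemma atom_append_zeros: "atom (\<alpha> @ replicate k 0) = atom \<alpha>"
  by (intro atom_eqI is_atom_append_zeros is_atom_atom)

lemma key_poly_append_zeros: "key_poly (\<alpha> @ replicate k 0) = key_poly \<alpha>"
  by (intro key_poly_eqI is_key_poly_append_zeros is_key_poly_key_poly)

text \<open>The difference m - i is truncated, so rows beyond m are 0 and the parts there must
  vanish. The entries of the first m rows are distinct and need no strictification; place x has
  entry m + 1 - x, which is reversal.\<close>

lemma expands_staircase:
  assumes lam: "\<And>i. i < length lam \<Longrightarrow> lam ! i = m - i" and m: "m \<le> length lam" "m \<le> M"
  shows "expands lam M (\<lambda>\<alpha>. rev (take m \<alpha>) @ replicate (M - m) 0)"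
proof -
  let ?n = "length lam" and ?c = "\<lambda>\<alpha> :: nat list. rev (take m \<alpha>) @ replicate (M - m) 0"
  have row: "row lam x = int (m - (x - 1))" if "x \<in> {1..?n}" for x
    using that lam[of "x - 1"] by (auto simp: row_def)
  have str_set: "str_set (row lam) (col \<alpha> r) = (\<lambda>x. int (Suc m - x)) ` col \<alpha> r"
    if "length \<alpha> = ?n" "col \<alpha> r \<subseteq> {1..m}" for \<alpha> :: "nat list" and r
  proof -
    have r: "row lam x = int (Suc m - x)" if "x \<in> col \<alpha> r" for x
      using that \<open>col \<alpha> r \<subseteq> {1..m}\<close> row[of x] m by force
    have "str_set (row lam) (col \<alpha> r) = row lam ` col \<alpha> r"
    proof (rule str_set_strict)
      fix x y assume "x \<in> col \<alpha> r" "y \<in> col \<alpha> r" "x < y"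
      then show "row lam y < row lam x" using r[of x] r[of y] that(2) by force
    qed simp
    also have "\<dots> = (\<lambda>x. int (Suc m - x)) ` col \<alpha> r" by (rule image_cong) (auto simp: r)
    finally show ?thesis .
  qed
  have sub_m: "col \<alpha> r \<subseteq> {1..m}"
    if "length \<alpha> = ?n" "\<forall>i. m \<le> i \<and> i < ?n \<longrightarrow> \<alpha> ! i = 0" "1 \<le> r" for \<alpha> :: "nat list" and r
  proof
    fix x assume x: "x \<in> col \<alpha> r"
    show "x \<in> {1..m}"
    proof (rule ccontr)
      assume "x \<notin> {1..m}"
      then have "m \<le> x - 1 \<and> x - 1 < ?n" using that(1) x by (auto simp: col_def)
      then have "\<alpha> ! (x - 1) = 0" using that(2) by blast
      then show False using x that(3) by (auto simp: col_def)
    qed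
  qed
  have Comp: "Comp lam = {\<alpha>. length \<alpha> = ?n \<and> (\<forall>i. m \<le> i \<and> i < ?n \<longrightarrow> \<alpha> ! i = 0)}"
  proof (intro equalityI subsetI CollectI conjI allI impI)
    fix \<alpha> i assume a: "\<alpha> \<in> Comp lam" and i: "m \<le> i \<and> i < ?n"
    show "\<alpha> ! i = 0"
    proof (rule ccontr)
      assume "\<alpha> ! i \<noteq> 0"
      \<comment> \<open>A nonzero part beyond place m puts a row of length 0 into the first
        column.\<close>
      then have "Suc i \<in> col \<alpha> 1" using a i by (auto simp: Comp_iff col_def)
      from str_set_le[OF finite_col this, of "row lam"] obtain d where d: "d \<in> str_set (row lam) (col \<alpha> 1)" "d \<le> row lam (Suc i)"
        by blast
      moreover have "row lam (Suc i) = 0" using row[of "Suc i"] i by simp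
      moreover have "0 < d" using a d(1) by (auto simp: Comp_iff)
      ultimately show False by simp
    qed
  next
    fix \<alpha> :: "nat list" assume a: "\<alpha> \<in> {\<alpha>. length \<alpha> = ?n \<and> (\<forall>i. m \<le> i \<and> i < ?n \<longrightarrow> \<alpha> ! i = 0)}"
    have sub: "col \<alpha> r \<subseteq> {1..m}" if "1 \<le> r" for r
      using a that by (intro sub_m) auto
    have "\<forall>e\<in>str_set (row lam) (col \<alpha> r). 0 < e" if "1 \<le> r" for r
      using a str_set[OF _ sub[OF that]] sub[OF that] by (auto simp: subset_iff)
    then show "\<alpha> \<in> Comp lam" using a by (auto simp: Comp_iff)
  qed (auto simp: Comp_iff)
  have pow: "length (?c \<alpha>) = M \<and> is_comp_pow lam \<alpha> (?c \<alpha>)" if a: "\<alpha> \<in> Comp lam" for \<alpha>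
  proof
    have len: "length \<alpha> = ?n" using a by (simp add: Comp)
    show lM: "length (?c \<alpha>) = M" using len m by simp
    show "is_comp_pow lam \<alpha> (?c \<alpha>)"
      unfolding is_comp_pow_def
    proof (intro allI impI)
      fix r :: nat assume r: "1 \<le> r"
      have sub: "col \<alpha> r \<subseteq> {1..m}" using a r by (intro sub_m) (auto simp: Comp)
      have nth: "?c \<alpha> ! (j - 1) = (if j \<le> m then \<alpha> ! (m - j) else 0)" if "1 \<le> j" "j \<le> M" for j
        using that len m by (auto simp: nth_append rev_nth)
      have "col (?c \<alpha>) r = (\<lambda>x. Suc m - x) ` col \<alpha> r"
      proof (intro equalityI subsetI)
        fix j assume "j \<in> col (?c \<alpha>) r"
        then have j: "1 \<le> j" "j \<le> M" "r \<le> ?c \<alpha> ! (j - 1)" using lM by (auto simp: col_def)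
        then have jm: "j \<le> m" "r \<le> \<alpha> ! (m - j)" using nth[of j] r by (auto split: if_splits)
        then have "Suc m - j \<in> col \<alpha> r" using j len m by (auto simp: col_def Suc_diff_le)
        then show "j \<in> (\<lambda>x. Suc m - x) ` col \<alpha> r" using jm j by (intro image_eqI[of _ _ "Suc m - j"]) auto
      next
        fix j assume "j \<in> (\<lambda>x. Suc m - x) ` col \<alpha> r"
        then obtain x where x: "x \<in> col \<alpha> r" "j = Suc m - x" by blast
        then have xm: "1 \<le> x" "x \<le> m" using sub by auto
        then have j: "1 \<le> j" "j \<le> m" "m - j = x - 1" using x(2) by auto
        have "r \<le> \<alpha> ! (x - 1)" using x(1) by (simp add: col_def)
        then have "r \<le> ?c \<alpha> ! (j - 1)" using nth[of j] j m by simp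
        then show "j \<in> col (?c \<alpha>) r" using j m lM by (simp add: col_def)
      qed
      then show "int ` col (?c \<alpha>) r = str_set (row lam) (col \<alpha> r)"
        using str_set[OF len sub] by (simp add: image_image)
    qed
  qed
  have cells: "cells lam = tri m"
  proof (rule set_eqI)
    fix q :: "nat \<times> nat"
    obtain i j where q: "q = (i, j)" by (cases q)
    show "q \<in> cells lam \<longleftrightarrow> q \<in> tri m"
    proof (cases "1 \<le> i \<and> i \<le> ?n")
      case True
      then have "lam ! (i - 1) = m - (i - 1)" by (intro lam) auto
      then show ?thesis using True by (auto simp: q cells_def tri_def)
    qed (use m in \<open>auto simp: q cells_def tri_def\<close>)
  qed
  have "xc d (kern (cells lam)) = (\<Sum>\<alpha> | \<alpha> \<in> Comp lam \<and> sum_list \<alpha> = d. in_x (atom \<alpha>) * in_y (key_poly (?c \<alpha>)))" for d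
  proof -
    let ?z = "replicate (?n - m) (0 :: nat)"
    have "xc d (kern (cells lam)) = (\<Sum>\<alpha> | length \<alpha> = m \<and> sum_list \<alpha> = d. in_x (atom \<alpha>) * in_y (key_poly (rev \<alpha>)))"
      unfolding cells by (rule staircase_kernel)
    also have "\<dots> = (\<Sum>\<alpha> | \<alpha> \<in> Comp lam \<and> sum_list \<alpha> = d. in_x (atom \<alpha>) * in_y (key_poly (?c \<alpha>)))"
    proof (rule sum.reindex_bij_witness[of _ "take m" "\<lambda>\<alpha>. \<alpha> @ ?z"])
      fix \<alpha> assume a: "\<alpha> \<in> {\<alpha>. \<alpha> \<in> Comp lam \<and> sum_list \<alpha> = d}"
      then have "drop m \<alpha> = ?z" by (intro nth_equalityI) (auto simp: Comp)
      then show t: "take m \<alpha> @ ?z = \<alpha>" using append_take_drop_id[of m \<alpha>] by simp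
      have "sum_list (take m \<alpha> @ ?z) = d" using a unfolding t by simp
      then show "take m \<alpha> \<in> {\<alpha>. length \<alpha> = m \<and> sum_list \<alpha> = d}"
        using a m by (simp add: Comp sum_list_replicate)
    next
      fix \<alpha> assume "\<alpha> \<in> {\<alpha>. length \<alpha> = m \<and> sum_list \<alpha> = d}"
      then show "take m (\<alpha> @ ?z) = \<alpha>" "\<alpha> @ ?z \<in> {\<alpha>. \<alpha> \<in> Comp lam \<and> sum_list \<alpha> = d}"
        "in_x (atom (\<alpha> @ ?z)) * in_y (key_poly (?c (\<alpha> @ ?z))) = in_x (atom \<alpha>) * in_y (key_poly (rev \<alpha>))"
        using m by (auto simp: Comp nth_append sum_list_replicate atom_append_zeros key_poly_append_zeros)
    qed
    finally show ?thesis .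
  qed
  with pow show ?thesis by (simp add: expands_def)
qed

section \<open>Removal of boxes\<close>

lemma sorted_ge_nth:
  fixes xs :: "nat list"
  shows "sorted_wrt (\<ge>) xs \<Longrightarrow> i \<le> j \<Longrightarrow> j < length xs \<Longrightarrow> xs ! j \<le> xs ! i"
  using sorted_wrt_nth_less[of "(\<ge>)" xs i j] by (cases "i = j") auto

lemma sorted_ge_update:
  fixes xs :: "nat list"
  assumes "sorted_wrt (\<ge>) xs" "p < length xs" "v \<le> xs ! p" "\<And>i. p < i \<Longrightarrow> i < length xs \<Longrightarrow> xs ! i \<le> v"
  shows "sorted_wrt (\<ge>) (xs[p := v])"
  unfolding sorted_wrt_iff_nth_less
proof (intro allI impI)
  fix i j assume "i < j" "j < length (xs[p := v])"
  then show "xs[p := v] ! j \<le> xs[p := v] ! i"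
    using assms sorted_ge_nth[OF assms(1), of i j] sorted_ge_nth[OF assms(1), of i p]
    by (auto simp: nth_list_update)
qed

text \<open>If neither kind of box can be removed, all steps of the boundary have length one.\<close>

lemma staircase_cases:
  fixes lam :: "nat list"
  assumes sorted: "sorted_wrt (\<ge>) lam" and "lam \<noteq> []"
  obtains
    (y_box) p where "p < length lam" "2 \<le> lam ! p" "\<And>i. p < i \<Longrightarrow> i < length lam \<Longrightarrow> lam ! i + 2 \<le> lam ! p"
  | (x_box) i where "1 \<le> i" "i < length lam" "1 \<le> lam ! i" "lam ! (i - 1) = lam ! i"
      "\<And>j. i < j \<Longrightarrow> j < length lam \<Longrightarrow> lam ! j < lam ! i"
  | (staircase) "\<And>i. i < length lam \<Longrightarrow> lam ! i = lam ! 0 - i" "lam ! 0 \<le> length lam"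
proof -
  let ?n = "length lam"
  consider (y) "\<exists>p<?n. 2 \<le> lam ! p \<and> (\<forall>i. p < i \<and> i < ?n \<longrightarrow> lam ! i + 2 \<le> lam ! p)"
    | (x) "\<exists>i. 1 \<le> i \<and> i < ?n \<and> 1 \<le> lam ! i \<and> lam ! (i - 1) = lam ! i"
    | (s) "\<not> (\<exists>p<?n. 2 \<le> lam ! p \<and> (\<forall>i. p < i \<and> i < ?n \<longrightarrow> lam ! i + 2 \<le> lam ! p))"
      "\<not> (\<exists>i. 1 \<le> i \<and> i < ?n \<and> 1 \<le> lam ! i \<and> lam ! (i - 1) = lam ! i)" by blast
  then show ?thesis
  proof cases
    case y
    then show ?thesis using y_box by blast
  next
    case x
    let ?I = "{i. 1 \<le> i \<and> i < ?n \<and> 1 \<le> lam ! i \<and> lam ! (i - 1) = lam ! i}"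
    have fin: "finite ?I" by simp
    \<comment> \<open>The last such row, so that a partition remains when its box is
      removed.\<close>
    define i where "i = Max ?I"
    have i: "i \<in> ?I" unfolding i_def using x fin by (intro Max_in) auto
    have "lam ! j < lam ! i" if j: "i < j" "j < ?n" for j
    proof (rule ccontr)
      assume "\<not> lam ! j < lam ! i"
      then have "lam ! i \<le> lam ! j" by simp
      moreover have "lam ! Suc i \<le> lam ! i" "lam ! j \<le> lam ! Suc i"
        using j by (auto intro!: sorted_ge_nth[OF sorted])
      ultimately have "Suc i \<in> ?I" using i j by auto
      then have "Suc i \<le> Max ?I" using fin by (intro Max_ge) auto
      then show False by (simp add: i_def)
    qed
    with i show ?thesis using x_box[of i] by blast
  next
    case s
    have step: "lam ! Suc i = lam ! i - 1" if "Suc i < ?n" for i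
    proof -
      have le: "lam ! Suc i \<le> lam ! i" using that by (auto intro!: sorted_ge_nth[OF sorted])
      have "\<not> (2 \<le> lam ! i \<and> lam ! Suc i + 2 \<le> lam ! i)"
      proof
        assume a: "2 \<le> lam ! i \<and> lam ! Suc i + 2 \<le> lam ! i"
        have "lam ! j + 2 \<le> lam ! i" if "i < j" "j < ?n" for j
          using a sorted_ge_nth[OF sorted, of "Suc i" j] that by simp
        then show False using s(1) a that by auto
      qed
      moreover have "\<not> (1 \<le> lam ! Suc i \<and> lam ! i = lam ! Suc i)"
        using s(2) that by (metis One_nat_def diff_Suc_1 le_add1 plus_1_eq_Suc)
      ultimately show ?thesis using le by linarith
    qed
    have all: "lam ! i = lam ! 0 - i" if "i < ?n" for i
      using that
    proof (induction i)
      case (Suc i)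
      then show ?case using step[of i] by simp
    qed simp
    \<comment> \<open>For the last row the condition on later rows is empty.\<close>
    have "\<not> 2 \<le> lam ! (?n - 1)" using s(1) \<open>lam \<noteq> []\<close> by auto
    then have "lam ! 0 - (?n - 1) \<le> 1" using all[of "?n - 1"] \<open>lam \<noteq> []\<close> by simp
    then have "lam ! 0 \<le> ?n" using \<open>lam \<noteq> []\<close> by (cases lam) auto
    with all show ?thesis by (rule staircase)
  qed
qed

lemma sum_list_update_less:
  fixes xs :: "nat list"
  shows "p < length xs \<Longrightarrow> v < xs ! p \<Longrightarrow> sum_list (xs[p := v]) < sum_list xs"
  using member_le_sum_list[of "xs ! p" xs] by (simp add: sum_list_update)

text \<open>M is only an upper bound of the first row, so it can stay fixed while boxes are removed
  down to a staircase.\<close>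

lemma expands_exists:
  assumes "lam \<noteq> []" "sorted_wrt (\<ge>) lam" "lam ! 0 \<le> M"
  shows "\<exists>c. expands lam M c"
  using assms
proof (induction "sum_list lam" arbitrary: lam rule: less_induct)
  case less
  from less.prems(2,1) show ?case
  proof (cases rule: staircase_cases)
    case (y_box p)
    let ?k = "lam ! p - 1"
    let ?l = "lam[p := ?k]"
    have le0: "lam ! p \<le> M" using sorted_ge_nth[OF less.prems(2), of 0 p] y_box(1) less.prems(3) by simp
    have srt: "sorted_wrt (\<ge>) ?l"
    proof (rule sorted_ge_update[OF less.prems(2) y_box(1)])
      fix i assume "p < i" "i < length lam"
      then show "lam ! i \<le> ?k" using y_box(3)[of i] by simp
    qed simp
    have "\<exists>c. expands ?l M c"
    proof (rule less.hyps)
      show "sum_list ?l < sum_list lam" using y_box by (intro sum_list_update_less) auto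
      show "?l ! 0 \<le> M" using less.prems le0 by (cases p) (auto simp: nth_list_update)
    qed (use less.prems srt in auto)
    then obtain c where c: "expands ?l M c" ..
    have "expands (?l[p := Suc ?k]) M (\<lambda>\<alpha>. upper ?k (c \<alpha>))"
    proof (rule expands_y_box[OF c])
      show "1 \<le> ?k" "?k < M" using y_box le0 by auto
      fix i assume "i < p"
      then show "?k < ?l ! i" using sorted_ge_nth[OF less.prems(2), of i p] y_box(1,2) by simp
    next
      fix i assume "p < i" "i < length ?l"
      then show "?l ! i < ?k" using y_box(3)[of i] by simp
    qed (use y_box in auto)
    moreover have "?l[p := Suc ?k] = lam" using y_box by simp
    ultimately show ?thesis by auto
  next
    case (x_box i)
    let ?b = "lam ! i"
    let ?l = "lam[i := ?b - 1]"
    have srt: "sorted_wrt (\<ge>) ?l"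
    proof (rule sorted_ge_update[OF less.prems(2) x_box(2)])
      fix j assume "i < j" "j < length lam"
      then show "lam ! j \<le> ?b - 1" using x_box(5)[of j] by simp
    qed simp
    have "\<exists>c. expands ?l M c"
    proof (rule less.hyps)
      show "sum_list ?l < sum_list lam" using x_box by (intro sum_list_update_less) auto
      show "?l ! 0 \<le> M" using less.prems x_box(1) by simp
    qed (use less.prems srt in auto)
    then obtain c where c: "expands ?l M c" ..
    have "expands (?l[i := ?b]) M (\<lambda>\<alpha>. c (lower i \<alpha>))"
      by (rule expands_x_box[OF c]) (use x_box in auto)
    moreover have "?l[i := ?b] = lam" by simp
    ultimately show ?thesis by auto
  next
    case staircase
    show ?thesis using expands_staircase[OF staircase less.prems(3)] by blast
  qed
qed

section \<open>The Cauchy identity\<close>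

lemma card_col_filter: "card (col \<alpha> r) = length (filter (\<lambda>a. r \<le> a) \<alpha>)"
proof -
  have "col \<alpha> r = Suc ` {i. i < length \<alpha> \<and> r \<le> \<alpha> ! i}"
  proof (intro equalityI subsetI)
    fix x assume "x \<in> col \<alpha> r"
    then show "x \<in> Suc ` {i. i < length \<alpha> \<and> r \<le> \<alpha> ! i}"
      by (intro image_eqI[of _ _ "x - 1"]) (auto simp: col_def)
  qed (auto simp: col_def)
  then show ?thesis by (simp add: length_filter_conv_card card_image)
qed

text \<open>Column r counts the parts of size at least r, so differences of successive column
  lengths give the multiplicities of the positive parts.\<close>

lemma dec_rearr_eqI:
  assumes "\<And>r. 1 \<le> r \<Longrightarrow> card (col \<beta> r) = card (col \<alpha> r)"
  shows "dec_rearr \<beta> = dec_rearr \<alpha>"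
proof -
  have c: "length (filter (\<lambda>a. r \<le> a) xs) = length (filter (\<lambda>a. Suc r \<le> a) xs) + count (mset xs) r"
    for r and xs :: "nat list"
    by (induction xs) auto
  have "mset (filter (\<lambda>a. 0 < a) \<beta>) = mset (filter (\<lambda>a. 0 < a) \<alpha>)"
  proof (rule multiset_eqI)
    fix r
    show "count (mset (filter (\<lambda>a. 0 < a) \<beta>)) r = count (mset (filter (\<lambda>a. 0 < a) \<alpha>)) r"
    proof (cases "r = 0")
      case False
      then have "count (mset \<beta>) r = count (mset \<alpha>) r"
        using c[of r \<alpha>] c[of r \<beta>] assms[of r] assms[of "Suc r"] by (simp add: card_col_filter)
      then show ?thesis using False by simp
    qed simp
  qed
  then have "sort (filter (\<lambda>a. 0 < a) \<beta>) = sort (filter (\<lambda>a. 0 < a) \<alpha>)"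
    by (intro properties_for_sort) auto
  then show ?thesis by (simp add: dec_rearr_def)
qed

text \<open>A monomial has one degree in x, so only the finitely many summands of that degree reach
  it.\<close>

lemma mfps_has_sum_xhom:
  assumes "\<And>i. i \<in> A \<Longrightarrow> xhom (\<delta> i) (f i)" "\<And>d. finite {i \<in> A. \<delta> i = d}"
    and "\<And>d. xc d s = (\<Sum>i | i \<in> A \<and> \<delta> i = d. f i)"
  shows "mfps_has_sum f A s"
  unfolding mfps_has_sum_def
proof (intro allI conjI)
  fix m
  let ?N = "{i \<in> A. mfps_coeff (f i) m \<noteq> 0}" and ?D = "{i \<in> A. \<delta> i = xdeg m}"
  have sub: "?N \<subseteq> ?D" using assms(1) by (auto simp: xhom_def)
  then show "finite ?N" using assms(2) by (rule finite_subset)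
  have "(\<Sum>i\<in>?N. mfps_coeff (f i) m) = (\<Sum>i\<in>?D. mfps_coeff (f i) m)"
    using sub assms(2) by (intro sum.mono_neutral_left) auto
  also have "\<dots> = mfps_coeff (xc (xdeg m) s) m" by (simp add: assms(3) mfps_coeff_sum)
  also have "\<dots> = mfps_coeff s m" by (simp add: coeff_xc)
  finally show "(\<Sum>i\<in>?N. mfps_coeff (f i) m) = mfps_coeff s m" .
qed

theorem corollary41:
  fixes lam :: "nat list"
  assumes "lam \<noteq> []" and "sorted_wrt (\<ge>) lam"
  shows "mfps_has_sum (\<lambda>\<alpha>. in_x (atom \<alpha>) * in_y (key_poly (comp_pow lam \<alpha>)))
           (Comp lam)
           (\<Prod>(i, j)\<in>cells lam. 1 / (1 - x_var i * y_var j))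
       \<and> mfps_has_sum (\<lambda>(\<alpha>, \<beta>). in_x (atom \<alpha>) * in_y (atom \<beta>))
           {(\<alpha>, \<beta>). \<alpha> \<in> Comp lam \<and> length \<beta> = hd lam \<and> dec_rearr \<beta> = dec_rearr \<alpha> \<and>
              tab_le (key_tab \<beta>) (key_tab (comp_pow lam \<alpha>))}
           (\<Prod>(i, j)\<in>cells lam. 1 / (1 - x_var i * y_var j))"
proof -
  have kern: "(\<Prod>(i, j)\<in>cells lam. 1 / (1 - x_var i * y_var j)) = kern (cells lam)"
    by (simp add: kern_def geo_def)
  have "lam ! 0 \<le> hd lam" using assms(1) by (simp add: hd_conv_nth)
  \<comment> \<open>With M equal to the first row, the padded composition has exactly the length of
    \<open>comp_pow\<close>.\<close>
  then obtain c where c: "expands lam (hd lam) c" using expands_exists assms by blast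
  have pow: "comp_pow lam \<alpha> = c \<alpha>" "length (c \<alpha>) = hd lam" "is_comp_pow lam \<alpha> (c \<alpha>)" if "\<alpha> \<in> Comp lam" for \<alpha>
    using c that comp_pow_eqI by (auto simp: expands_def)
  have xck: "xc d (kern (cells lam))
      = (\<Sum>\<alpha> | \<alpha> \<in> Comp lam \<and> sum_list \<alpha> = d. in_x (atom \<alpha>) * in_y (key_poly (comp_pow lam \<alpha>)))" for d
    using c pow(1) by (auto simp: expands_def intro!: sum.cong)
  let ?A = "{(\<alpha>, \<beta>). \<alpha> \<in> Comp lam \<and> length \<beta> = hd lam \<and> dec_rearr \<beta> = dec_rearr \<alpha> \<and>
      tab_le (key_tab \<beta>) (key_tab (comp_pow lam \<alpha>))}"
  \<comment> \<open>The double sum fibres over \<open>Comp lam\<close>; on each fibre the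
    rearrangements agree because the column lengths do.\<close>
  have A: "?A = (SIGMA \<alpha>:Comp lam. Low (comp_pow lam \<alpha>))"
  proof -
    have "dec_rearr \<beta> = dec_rearr \<alpha>" if "\<alpha> \<in> Comp lam" "\<beta> \<in> Low (comp_pow lam \<alpha>)" for \<alpha> \<beta>
      using that pow[OF that(1)] is_comp_pow_card by (intro dec_rearr_eqI) (auto simp: Low_iff)
    then show ?thesis using pow by (auto simp: Low_def)
  qed
  have D: "{p \<in> ?A. sum_list (fst p) = d}
      = (SIGMA \<alpha>:{\<alpha>. \<alpha> \<in> Comp lam \<and> sum_list \<alpha> = d}. Low (comp_pow lam \<alpha>))" for d
    unfolding A by auto
  have "mfps_has_sum (\<lambda>\<alpha>. in_x (atom \<alpha>) * in_y (key_poly (comp_pow lam \<alpha>))) (Comp lam) (kern (cells lam))"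
    by (rule mfps_has_sum_xhom[where \<delta> = sum_list]) (auto intro: xhom_term finite_Comp_deg xck)
  moreover have "mfps_has_sum (\<lambda>(\<alpha>, \<beta>). in_x (atom \<alpha>) * in_y (atom \<beta>)) ?A (kern (cells lam))"
  proof (rule mfps_has_sum_xhom[where \<delta> = "\<lambda>p. sum_list (fst p)"])
    show "finite {p \<in> ?A. sum_list (fst p) = d}" for d
      unfolding D by (intro finite_SigmaI finite_Comp_deg finite_Low)
    show "xc d (kern (cells lam)) = (\<Sum>p | p \<in> ?A \<and> sum_list (fst p) = d. (\<lambda>(\<alpha>, \<beta>). in_x (atom \<alpha>) * in_y (atom \<beta>)) p)" for d
    proof -
      have "xc d (kern (cells lam)) = (\<Sum>\<alpha> | \<alpha> \<in> Comp lam \<and> sum_list \<alpha> = d.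
          \<Sum>\<beta>\<in>Low (comp_pow lam \<alpha>). in_x (atom \<alpha>) * in_y (atom \<beta>))"
        by (simp add: xck key_poly_Low peval_sum sum_distrib_left)
      also have "\<dots> = (\<Sum>(\<alpha>, \<beta>)\<in>(SIGMA \<alpha>:{\<alpha>. \<alpha> \<in> Comp lam \<and> sum_list \<alpha> = d}. Low (comp_pow lam \<alpha>)).
          in_x (atom \<alpha>) * in_y (atom \<beta>))"
        by (rule sum.Sigma) (auto intro: finite_Comp_deg finite_Low)
      finally show ?thesis unfolding D .
    qed
  qed (auto intro: xhom_term)
  ultimately show ?thesis unfolding kern by blast
qed

end
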